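(* Let $n\ge2$, let the tensor $\mathbb A$ satisfy the relaxed ellipticity condition with constant $C_{\mathbb A}>0$, and let $\mathbf U\in\mathbf L_{\theta\#\sigma}$, where $\theta\in(2,\infty)$ if $n=2$, while $\theta\in[n,\infty)$ if $n\ge3$. (i) For all given data $\mathbf f\in\dot{\mathbf H}_\#^{-1}$ and $g\in\dot L_{2\#}$, the variational problem of finding $(\mathbf u,p)\in\dot{\mathbf H}_\#^1\times\dot L_{2\#}$ such that $$a_{\mathbb T;\mathbf U}(\mathbf u,\mathbf v)+b_{\mathbb T}(\mathbf v,p)=\langle\mathbf f,\mathbf v\rangle_{\mathbb T}\quad\forall\,\mathbf v\in\dot{\mathbf H}_\#^1,\qquad b_{\mathbb T}(\mathbf u,q)=-\langle g,q\rangle_{\mathbb T}\quad\forall\,q\in\dot L_{2\#},$$ has a unique solution $(\mathbf u,p)\in\dot{\mathbf H}_\#^1\times\dot L_{2\#}$, and $$\|\mathbf u\|_{\dot{\mathbf H}_\#^1}\le C_{uf}\|\mathbf f\|_{\dot{\mathbf H}_\#^{-1}}+C_{ug;U}\|g\|_{\dot L_{2\#}},\qquad \|p\|_{\dot L_{2\#}}\le C_{pf;U}\|\mathbf f\|_{\dot{\mathbf H}_\#^{-1}}+C_{pg;U}\|g\|_{\dot L_{2\#}},$$ where $C_{uf}=\pi^{-2}C_{\mathbb A}$, while the constants $C_{ug;U}=C_{pf;U}$ and $C_{pg;U}$ depend only on $C_{\mathbb A}$, $\|\mathbb A\|$, $n$, and $\mathbf U$. (ii) Moreover, the anisotropic Oseen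 system $$-\boldsymbol{\mathfrak L}\mathbf u+\nabla p+(\mathbf U\cdot\nabla)\mathbf u=\mathbf f,\qquad\mathrm{div}\,\mathbf u=g$$ is well-posed in $\dot{\mathbf H}_\#^1\times\dot L_{2\#}$ and its unique solution $(\mathbf u,p)\in\dot{\mathbf H}_\#^1\times\dot L_{2\#}$ is provided by the solution of the variational problem from item (i). (iii) The operator $$S_U:\dot{\mathbf H}_\#^1\times\dot L_{2\#}\to\dot{\mathbf H}_\#^{-1}\times\dot L_{2\#},\qquad S_U(\mathbf u,p)=(-\boldsymbol{\mathfrak L}\mathbf u+\nabla p+(\mathbf U\cdot\nabla)\mathbf u,\ \mathrm{div}\,\mathbf u),$$ is an isomorphism.
   Context: Repeated indices are summed from $1$ to $n$; $\partial_j=\partial/\partial x_j$. All functions and distributions are real-valued. $\mathbb A=(a_{kj}^{\alpha\beta})_{1\le k,j,\alpha,\beta\le n}$ is a tensor of real constants with the symmetry $a_{kj}^{\alpha\beta}=a_{\alpha j}^{k\beta}=a_{k\beta}^{\alpha j}$ (standing assumption). Relaxed ellipticity condition: there is a constant $C_{\mathbb A}>0$ such that $C_{\mathbb A}a_{kj}^{\alpha\beta}\zeta_{k\alpha}\zeta_{j\beta}\ge|\boldsymbol\zeta|^2:=\zeta_{k\alpha}\zeta_{k\alpha}$ for all $\boldsymbol\zeta\in\mathbb R^{n\times n}$ with $\boldsymbol\zeta=\boldsymbol\zeta^\top$ and $\sum_k\zeta_{kk}=0$. Norm: $\|\mathbb A\|:=\max|a_{kj}^{\alpha\beta}|$. $E_{j\beta}(\mathbf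 u)=\frac12(\partial_ju_\beta+\partial_\beta u_j)$ and $(\boldsymbol{\mathfrak L}\mathbf u)_k:=\partial_\alpha(a_{kj}^{\alpha\beta}E_{j\beta}(\mathbf u))=\partial_\alpha(a_{kj}^{\alpha\beta}\partial_\beta u_j)$. $((\mathbf U\cdot\nabla)\mathbf u)_k=U_j\partial_ju_k$. Bilinear forms: $a_{\mathbb T;\mathbf U}(\mathbf u,\mathbf v):=\langle a_{ij}^{\alpha\beta}E_{j\beta}(\mathbf u),E_{i\alpha}(\mathbf v)\rangle_{\mathbb T}+\langle(\mathbf U\cdot\nabla)\mathbf u,\mathbf v\rangle_{\mathbb T}$ for $\mathbf u,\mathbf v\in\dot{\mathbf H}^1_\#$; $b_{\mathbb T}(\mathbf v,q):=-\langle\mathrm{div}\,\mathbf v,q\rangle_{\mathbb T}$ for $\mathbf v\in\dot{\mathbf H}^1_\#$, $q\in\dot L_{2\#}$. $\mathbb T=[0,1)^n$ is the flat torus; functions/distributions on it are identified with $1$-periodic ones on $\mathbb R^n$. Fourier coefficients: $\hat g(\boldsymbol\xi)=\int_{\mathbb T}e^{-2\pi i\mathbf x\cdot\boldsymbol\xi}g(\mathbf x)d\mathbf x$, $\boldsymbol\xi\in\mathbb Z^n$, extended to periodic distributions. $H^s_\#$ is the space of periodic distributions with finite norm $\|g\|_{H^s_\#}=\big(\sum_{\boldsymbol\xi\in\mathbb Z^n}(1+|\boldsymbol\xi|^2)^s|\hat g(\boldsymbol\xi)|^2\big)^{1/2}$; $\dot H^s_\#=\{g\in H^s_\#:\hat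 g(\mathbf 0)=0\}$ with the same norm. $\langle g,f\rangle_{\mathbb T}=\sum_{\boldsymbol\xi}\hat g(\boldsymbol\xi)\hat f(-\boldsymbol\xi)$ is the duality product of $H^s_\#$ and $H^{-s}_\#$ (equal to $\int_{\mathbb T}gf\,d\mathbf x$ for $L_2$ functions). $L_{q\#}$ is the space of $1$-periodic functions in $L_{q,\rm loc}(\mathbb R^n)$ with the norm of $L_q(\mathbb T)$; $\dot L_{2\#}=\dot H^0_\#$. Bold symbols denote $n$-component vector versions (Euclidean norm of components); $\mathbf L_{\theta\#\sigma}=\{\mathbf w\in\mathbf L_{\theta\#}:\mathrm{div}\,\mathbf w=0\}$. Systems of PDEs are understood in the sense of (periodic) distributions. *)

theory Defs
  imports "HOL-Analysis.Analysis"
begin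

definition periodic :: "(real^'n \<Rightarrow> 'b) \<Rightarrow> bool" where
  "periodic f \<longleftrightarrow> (\<forall>x i. f (x + axis i 1) = f x)"

definition partial :: "'n \<Rightarrow> (real^'n \<Rightarrow> real) \<Rightarrow> real^'n \<Rightarrow> real" where
  "partial j \<phi> = (\<lambda>x. frechet_derivative \<phi> (at x) (axis j 1))"

text \<open>\<open>partials [j1, \<dots>, jm] \<phi>\<close> is the mixed derivative of order \<open>m\<close> taken in the directions
  \<open>j1, \<dots>, jm\<close>; lists of directions play the role of multi-indices.\<close>

definition partials :: "'n list \<Rightarrow> (real^'n \<Rightarrow> real) \<Rightarrow> real^'n \<Rightarrow> real" where
  "partials js = fold partial js"

definition test_funs :: "(real^'n \<Rightarrow> real) set" where
  "test_funs = {\<phi>. periodic \<phi> \<and> (\<forall>js x. partials js \<phi> differentiable (at x))}"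

lemma partials_Nil [simp]: "partials [] \<phi> = \<phi>"
  by (simp add: partials_def)

lemma partials_Cons [simp]: "partials (j # js) \<phi> = partials js (partial j \<phi>)"
  by (simp add: partials_def)

lemma test_funs_differentiable: "\<phi> \<in> test_funs \<Longrightarrow> \<phi> differentiable (at x)"
  unfolding test_funs_def by (auto dest: spec[of _ "[]"])

lemma test_funs_continuous: "\<phi> \<in> test_funs \<Longrightarrow> continuous_on S \<phi>"
  by (meson continuous_at_imp_continuous_on differentiable_imp_continuous_within
      test_funs_differentiable)

lemma partial_add:
  assumes "\<And>x. \<phi> differentiable (at x)" "\<And>x. \<psi> differentiable (at x)"
  shows "partial j (\<lambda>x. \<phi> x + \<psi> x) = (\<lambda>x. partial j \<phi> x + partial j \<psi> x)"
proof
  fix x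
  have "((\<lambda>x. \<phi> x + \<psi> x) has_derivative
      (\<lambda>h. frechet_derivative \<phi> (at x) h + frechet_derivative \<psi> (at x) h)) (at x)"
    using assms by (intro has_derivative_add) (auto simp: frechet_derivative_works[symmetric])
  from fun_cong[OF frechet_derivative_at[OF this], of "axis j 1"]
  show "partial j (\<lambda>x. \<phi> x + \<psi> x) x = partial j \<phi> x + partial j \<psi> x"
    by (simp add: partial_def)
qed

lemma partial_scale:
  assumes "\<And>x. \<phi> differentiable (at x)"
  shows "partial j (\<lambda>x. c * \<phi> x) = (\<lambda>x. c * partial j \<phi> x)"
proof
  fix x
  have "((\<lambda>x. c * \<phi> x) has_derivative (\<lambda>h. c * frechet_derivative \<phi> (at x) h)) (at x)"
    using assms by (intro has_derivative_mult_right) (auto simp: frechet_derivative_works[symmetric])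
  from fun_cong[OF frechet_derivative_at[OF this], of "axis j 1"]
  show "partial j (\<lambda>x. c * \<phi> x) x = c * partial j \<phi> x"
    by (simp add: partial_def)
qed

lemma partial_periodic:
  assumes "\<And>x. \<phi> differentiable (at x)" "periodic \<phi>"
  shows "periodic (partial j \<phi>)"
  unfolding periodic_def
proof (intro allI)
  fix x :: "real^'a" and i
  let ?D = "frechet_derivative \<phi> (at (x + axis i 1))"
  have "(\<phi> has_derivative ?D) (at (x + axis i 1))"
    using assms(1) frechet_derivative_works by blast
  then have "((\<phi> \<circ> (\<lambda>y. y + axis i 1)) has_derivative (?D \<circ> (\<lambda>h. h))) (at x)"
    by (intro diff_chain_at) (auto intro!: derivative_eq_intros)
  moreover have "\<phi> \<circ> (\<lambda>y. y + axis i 1) = \<phi>"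
    using assms(2) by (auto simp: periodic_def)
  ultimately have "(\<phi> has_derivative ?D) (at x)"
    by (simp add: o_def)
  from frechet_derivative_at[OF this]
  show "partial j \<phi> (x + axis i 1) = partial j \<phi> x"
    by (simp add: partial_def)
qed

lemma test_funs_partial: "\<phi> \<in> test_funs \<Longrightarrow> partial j \<phi> \<in> test_funs"
proof -
  assume *: "\<phi> \<in> test_funs"
  have "partials js (partial j \<phi>) differentiable (at x)" for js x
    using * unfolding test_funs_def by (auto dest: spec[of _ "j # js"])
  with partial_periodic[OF test_funs_differentiable[OF *]] * show ?thesis
    by (auto simp: test_funs_def)
qed

lemma partials_add:
  "\<phi> \<in> test_funs \<Longrightarrow> \<psi> \<in> test_funs \<Longrightarrow>
    partials js (\<lambda>x. \<phi> x + \<psi> x) = (\<lambda>x. partials js \<phi> x + partials js \<psi> x)"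
  by (induction js arbitrary: \<phi> \<psi>)
    (auto simp: partial_add test_funs_differentiable test_funs_partial)

lemma partials_scale:
  "\<phi> \<in> test_funs \<Longrightarrow> partials js (\<lambda>x. c * \<phi> x) = (\<lambda>x. c * partials js \<phi> x)"
  by (induction js arbitrary: \<phi>)
    (auto simp: partial_scale test_funs_differentiable test_funs_partial)

lemma test_funs_add:
  "\<phi> \<in> test_funs \<Longrightarrow> \<psi> \<in> test_funs \<Longrightarrow> (\<lambda>x. \<phi> x + \<psi> x) \<in> test_funs"
  using partials_add[of \<phi> \<psi>] by (auto simp: test_funs_def periodic_def)

lemma test_funs_scale: "\<phi> \<in> test_funs \<Longrightarrow> (\<lambda>x. c * \<phi> x) \<in> test_funs"
  using partials_scale[of \<phi> _ c] by (auto simp: test_funs_def periodic_def)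

text \<open>Continuity of a linear functional with respect to the seminorms
  \<open>\<phi> \<mapsto> max {sup |\<partial>\<^sup>\<alpha> \<phi>| : |\<alpha>| \<le> N}\<close> is expressed by quantifying over all bounds \<open>M\<close> of these
  seminorms. The value \<open>0\<close> outside \<open>test_funs\<close> makes equality of functionals coincide with
  equality of distributions.\<close>

definition is_pdist :: "((real^'n \<Rightarrow> real) \<Rightarrow> real) \<Rightarrow> bool" where
  "is_pdist T \<longleftrightarrow>
     (\<forall>\<phi>\<in>test_funs. \<forall>\<psi>\<in>test_funs. T (\<lambda>x. \<phi> x + \<psi> x) = T \<phi> + T \<psi>) \<and>
     (\<forall>\<phi>\<in>test_funs. \<forall>c. T (\<lambda>x. c * \<phi> x) = c * T \<phi>) \<and>
     (\<exists>N C. \<forall>\<phi>\<in>test_funs. \<forall>M.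
        (\<forall>js x. length js \<le> N \<longrightarrow> \<bar>partials js \<phi> x\<bar> \<le> M) \<longrightarrow> \<bar>T \<phi>\<bar> \<le> C * M) \<and>
     (\<forall>\<phi>. \<phi> \<notin> test_funs \<longrightarrow> T \<phi> = 0)"

lemma is_pdistI:
  assumes "\<And>\<phi> \<psi>. \<phi> \<in> test_funs \<Longrightarrow> \<psi> \<in> test_funs \<Longrightarrow> T (\<lambda>x. \<phi> x + \<psi> x) = T \<phi> + T \<psi>"
    and "\<And>\<phi> c. \<phi> \<in> test_funs \<Longrightarrow> T (\<lambda>x. c * \<phi> x) = c * T \<phi>"
    and "\<And>\<phi> M. \<phi> \<in> test_funs \<Longrightarrow>
      (\<forall>js x. length js \<le> N \<longrightarrow> \<bar>partials js \<phi> x\<bar> \<le> M) \<Longrightarrow> \<bar>T \<phi>\<bar> \<le> C * M"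
    and "\<And>\<phi>. \<phi> \<notin> test_funs \<Longrightarrow> T \<phi> = 0"
  shows "is_pdist T"
  unfolding is_pdist_def using assms by blast

lemma is_pdistD:
  assumes "is_pdist T"
  shows "\<phi> \<in> test_funs \<Longrightarrow> \<psi> \<in> test_funs \<Longrightarrow> T (\<lambda>x. \<phi> x + \<psi> x) = T \<phi> + T \<psi>"
    and "\<phi> \<in> test_funs \<Longrightarrow> T (\<lambda>x. c * \<phi> x) = c * T \<phi>"
    and "\<phi> \<notin> test_funs \<Longrightarrow> T \<phi> = 0"
  using assms unfolding is_pdist_def by blast+

lemma is_pdist_bound:
  assumes "is_pdist T"
  obtains N C where "\<And>\<phi> M. \<phi> \<in> test_funs \<Longrightarrow>
      (\<forall>js x. length js \<le> N \<longrightarrow> \<bar>partials js \<phi> x\<bar> \<le> M) \<Longrightarrow> \<bar>T \<phi>\<bar> \<le> C * M"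
  using assms unfolding is_pdist_def by blast

lemma is_pdist_zero: "is_pdist (\<lambda>\<phi>. 0)"
  by (rule is_pdistI[where C = 0]) auto

lemma is_pdist_add:
  assumes "is_pdist S" "is_pdist T"
  shows "is_pdist (\<lambda>\<phi>. S \<phi> + T \<phi>)"
proof -
  obtain N C where S: "\<And>\<phi> M. \<phi> \<in> test_funs \<Longrightarrow>
      (\<forall>js x. length js \<le> N \<longrightarrow> \<bar>partials js \<phi> x\<bar> \<le> M) \<Longrightarrow> \<bar>S \<phi>\<bar> \<le> C * M"
    using that by (rule is_pdist_bound[OF assms(1)])
  obtain N' C' where T: "\<And>\<phi> M. \<phi> \<in> test_funs \<Longrightarrow>
      (\<forall>js x. length js \<le> N' \<longrightarrow> \<bar>partials js \<phi> x\<bar> \<le> M) \<Longrightarrow> \<bar>T \<phi>\<bar> \<le> C' * M"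
    using that by (rule is_pdist_bound[OF assms(2)])
  show ?thesis
  proof (rule is_pdistI[where N = "max N N'" and C = "C + C'"])
    fix \<phi> :: "real^'a \<Rightarrow> real" and M
    assume "\<phi> \<in> test_funs" "\<forall>js x. length js \<le> max N N' \<longrightarrow> \<bar>partials js \<phi> x\<bar> \<le> M"
    then have "\<bar>S \<phi>\<bar> \<le> C * M" "\<bar>T \<phi>\<bar> \<le> C' * M"
      by (simp_all add: S T)
    then show "\<bar>S \<phi> + T \<phi>\<bar> \<le> (C + C') * M"
      unfolding distrib_right by linarith
  qed (simp_all add: is_pdistD[OF assms(1)] is_pdistD[OF assms(2)] distrib_left)
qed

lemma is_pdist_scale:
  assumes "is_pdist T"
  shows "is_pdist (\<lambda>\<phi>. c * T \<phi>)"
proof -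
  obtain N C where T: "\<And>\<phi> M. \<phi> \<in> test_funs \<Longrightarrow>
      (\<forall>js x. length js \<le> N \<longrightarrow> \<bar>partials js \<phi> x\<bar> \<le> M) \<Longrightarrow> \<bar>T \<phi>\<bar> \<le> C * M"
    using that by (rule is_pdist_bound[OF assms])
  show ?thesis
  proof (rule is_pdistI[where N = N and C = "\<bar>c\<bar> * C"])
    fix \<phi> :: "real^'a \<Rightarrow> real" and M
    assume "\<phi> \<in> test_funs" "\<forall>js x. length js \<le> N \<longrightarrow> \<bar>partials js \<phi> x\<bar> \<le> M"
    from mult_left_mono[OF T[OF this], of "\<bar>c\<bar>"] show "\<bar>c * T \<phi>\<bar> \<le> \<bar>c\<bar> * C * M"
      by (simp add: abs_mult mult.assoc)
  qed (simp_all add: is_pdistD[OF assms(1)] distrib_left mult.left_commute)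
qed

lemma is_pdist_deriv:
  assumes "is_pdist T"
  shows "is_pdist (\<lambda>\<phi>. if \<phi> \<in> test_funs then - T (partial j \<phi>) else 0)"
proof -
  obtain N C where T: "\<And>\<phi> M. \<phi> \<in> test_funs \<Longrightarrow>
      (\<forall>js x. length js \<le> N \<longrightarrow> \<bar>partials js \<phi> x\<bar> \<le> M) \<Longrightarrow> \<bar>T \<phi>\<bar> \<le> C * M"
    using that by (rule is_pdist_bound[OF assms(1)])
  show ?thesis
  proof (rule is_pdistI[where N = "Suc N" and C = C])
    fix \<phi> :: "real^'a \<Rightarrow> real" and M
    assume \<phi>: "\<phi> \<in> test_funs" "\<forall>js x. length js \<le> Suc N \<longrightarrow> \<bar>partials js \<phi> x\<bar> \<le> M"
    have "\<bar>partials js (partial j \<phi>) x\<bar> \<le> M" if "length js \<le> N" for js x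
      using \<phi>(2)[rule_format, of "j # js" x] that by simp
    then have "\<bar>T (partial j \<phi>)\<bar> \<le> C * M"
      using \<phi>(1) by (intro T test_funs_partial) blast+
    then show "\<bar>if \<phi> \<in> test_funs then - T (partial j \<phi>) else 0\<bar> \<le> C * M"
      using \<phi>(1) by simp
  qed (simp_all add: test_funs_add test_funs_scale partial_add partial_scale
      test_funs_differentiable is_pdistD[OF assms] test_funs_partial)
qed

typedef (overloaded) ('n::finite) pdist = "{T :: (real^'n \<Rightarrow> real) \<Rightarrow> real. is_pdist T}"
  morphisms dapply Abs_pdist
  using is_pdist_zero by blast

setup_lifting type_definition_pdist

instantiation pdist :: (finite) real_vector
begin

lift_definition zero_pdist :: "'a pdist" is "\<lambda>\<phi>. 0" by (rule is_pdist_zero)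
lift_definition plus_pdist :: "'a pdist \<Rightarrow> 'a pdist \<Rightarrow> 'a pdist" is "\<lambda>S T \<phi>. S \<phi> + T \<phi>"
  by (rule is_pdist_add)
lift_definition scaleR_pdist :: "real \<Rightarrow> 'a pdist \<Rightarrow> 'a pdist" is "\<lambda>c T \<phi>. c * T \<phi>"
  by (rule is_pdist_scale)
lift_definition uminus_pdist :: "'a pdist \<Rightarrow> 'a pdist" is "\<lambda>T \<phi>. - T \<phi>"
  using is_pdist_scale[of _ "-1"] by simp
lift_definition minus_pdist :: "'a pdist \<Rightarrow> 'a pdist \<Rightarrow> 'a pdist" is "\<lambda>S T \<phi>. S \<phi> - T \<phi>"
  using is_pdist_add[OF _ is_pdist_scale[of _ "-1"]] by simp

instance
  by standard (transfer, force simp: algebra_simps)+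

end

lift_definition ddiff :: "'n::finite \<Rightarrow> 'n pdist \<Rightarrow> 'n pdist"
  is "\<lambda>j T \<phi>. if \<phi> \<in> test_funs then - T (partial j \<phi>) else 0"
  by (rule is_pdist_deriv)

definition torus :: "(real^'n) set" where
  "torus = {x. \<forall>i. 0 \<le> x $ i \<and> x $ i < 1}"

definition Lq :: "real \<Rightarrow> (real^'n \<Rightarrow> real) set" where
  "Lq q = {f. f \<in> borel_measurable lebesgue \<and> periodic f \<and>
              set_integrable lebesgue torus (\<lambda>x. \<bar>f x\<bar> powr q)}"

lemma torus_lebesgue [measurable]: "torus \<in> sets (lebesgue :: (real^'n) measure)"
proof -
  have "torus = (\<Inter>i. {x :: real^'n. 0 \<le> x $ i} \<inter> {x. x $ i < 1})"
    by (auto simp: torus_def)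
  also have "\<dots> \<in> sets borel"
    by (intro sets.finite_INT sets.Int borel_closed borel_open closed_Collect_le open_Collect_less
        continuous_intros) auto
  finally show ?thesis
    by (metis sets_completionI_sets sets_lborel)
qed

lemma set_integrable_mult_test_fun:
  assumes "f \<in> Lq 1" "\<phi> \<in> test_funs"
  shows "set_integrable lebesgue torus (\<lambda>x. f x * \<phi> x)"
proof -
  have "bounded (\<phi> ` cbox 0 1)"
    by (intro compact_imp_bounded compact_continuous_image test_funs_continuous assms compact_cbox)
  then obtain B where B: "\<And>x. x \<in> cbox 0 1 \<Longrightarrow> \<bar>\<phi> x\<bar> \<le> B"
    by (auto simp: bounded_iff)
  have sub: "torus \<subseteq> (cbox 0 1 :: (real^'a) set)"
    by (auto simp: torus_def mem_box_cart less_imp_le)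
  have f: "set_integrable lebesgue torus f"
    using assms(1) unfolding Lq_def set_integrable_def
    by (subst integrable_norm_iff[symmetric]) (auto simp: abs_mult)
  have [measurable]: "\<phi> \<in> borel_measurable lebesgue"
    using borel_measurable_continuous_onI[OF test_funs_continuous[OF assms(2)]]
    by (simp add: measurable_completion)
  have [measurable]: "f \<in> borel_measurable lebesgue"
    using assms(1) by (simp add: Lq_def)
  show ?thesis
    unfolding set_integrable_def
  proof (rule Bochner_Integration.integrable_bound)
    show "integrable lebesgue (\<lambda>x. B * (indicator torus x *\<^sub>R f x))"
      using f by (auto simp: set_integrable_def)
    show "AE x in lebesgue. norm (indicator torus x *\<^sub>R (f x * \<phi> x))
        \<le> norm (B * (indicator torus x *\<^sub>R f x))"
    proof (rule AE_I2)
      fix x :: "real^'a"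
      show "norm (indicator torus x *\<^sub>R (f x * \<phi> x)) \<le> norm (B * (indicator torus x *\<^sub>R f x))"
      proof (cases "x \<in> torus")
        case True
        then have "\<bar>\<phi> x\<bar> \<le> \<bar>B\<bar>" using B sub by force
        then show ?thesis
          using True by (simp add: abs_mult mult.commute[of "\<bar>f x\<bar>"] mult_right_mono)
      qed simp
    qed
  qed measurable
qed

lift_definition dist_of :: "(real^'n::finite \<Rightarrow> real) \<Rightarrow> 'n pdist"
  is "\<lambda>f \<phi>. if f \<in> Lq 1 \<and> \<phi> \<in> test_funs
            then set_lebesgue_integral lebesgue torus (\<lambda>x. f x * \<phi> x) else 0"
proof -
  fix f :: "real^'n \<Rightarrow> real"
  let ?T = "\<lambda>\<phi>. if f \<in> Lq 1 \<and> \<phi> \<in> test_funs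
            then set_lebesgue_integral lebesgue torus (\<lambda>x. f x * \<phi> x) else 0"
  show "is_pdist ?T"
  proof (cases "f \<in> Lq 1")
    case False
    then show ?thesis by (simp add: is_pdist_zero)
  next
    case True
    note int = set_integrable_mult_test_fun[OF True]
    have f: "set_integrable lebesgue torus (\<lambda>x. \<bar>f x\<bar>)"
      using True by (simp add: Lq_def)
    have bound: "\<bar>?T \<phi>\<bar> \<le> set_lebesgue_integral lebesgue torus (\<lambda>x. \<bar>f x\<bar>) * M"
      if \<phi>: "\<phi> \<in> test_funs" and M: "\<forall>js x. length js \<le> 0 \<longrightarrow> \<bar>partials js \<phi> x\<bar> \<le> M" for \<phi> M
    proof -
      have "\<bar>\<phi> x\<bar> \<le> M" for x
        using M[rule_format, of "[]"] by simp
      then have *: "\<bar>f x * \<phi> x\<bar> \<le> \<bar>f x\<bar> * M" for x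
        by (simp add: abs_mult mult_left_mono)
      have "\<bar>set_lebesgue_integral lebesgue torus (\<lambda>x. f x * \<phi> x)\<bar>
          \<le> set_lebesgue_integral lebesgue torus (\<lambda>x. \<bar>f x * \<phi> x\<bar>)"
        using set_integral_norm_bound[OF int[OF \<phi>]] by simp
      also have "\<dots> \<le> set_lebesgue_integral lebesgue torus (\<lambda>x. \<bar>f x\<bar> * M)"
        using set_integrable_abs[OF int[OF \<phi>]] f *
        by (intro set_integral_mono set_integrable_mult_left) auto
      finally show ?thesis using True \<phi> by simp
    qed
    show ?thesis
    proof (rule is_pdistI[OF _ _ bound])
      fix \<phi> \<psi> :: "real^'n \<Rightarrow> real"
      assume "\<phi> \<in> test_funs" "\<psi> \<in> test_funs"
      then show "?T (\<lambda>x. \<phi> x + \<psi> x) = ?T \<phi> + ?T \<psi>"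
        using True by (simp add: test_funs_add distrib_left set_integral_add int)
    next
      fix \<phi> :: "real^'n \<Rightarrow> real" and c
      assume "\<phi> \<in> test_funs"
      then show "?T (\<lambda>x. c * \<phi> x) = c * ?T \<phi>"
        using True by (simp add: test_funs_scale mult.left_commute)
    qed auto
  qed
qed

text \<open>For a distribution belonging to \<open>L\<^sub>2\<close> the representative \<open>h\<close> is determined up to a null
  set, so the choice in \<open>L2_rep\<close> is immaterial. The product \<open>fmult w D\<close> is only meant for
  \<open>D\<close> in \<open>L\<^sub>2\<close> and \<open>w\<close> in \<open>L\<^sub>q\<close> with \<open>q \<ge> 2\<close>, when the product of functions is
  integrable.\<close>

definition L2_rep :: "'n::finite pdist \<Rightarrow> real^'n \<Rightarrow> real" where
  "L2_rep D = (SOME h. h \<in> Lq 2 \<and> dist_of h = D)"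

definition fmult :: "(real^'n \<Rightarrow> real) \<Rightarrow> 'n::finite pdist \<Rightarrow> 'n pdist" where
  "fmult w D = dist_of (\<lambda>x. w x * L2_rep D x)"

definition phase :: "int^'n \<Rightarrow> real^'n \<Rightarrow> real" where
  "phase \<xi> x = 2 * pi * (\<Sum>i\<in>UNIV. x $ i * of_int (\<xi> $ i))"

text \<open>\<open>g\<close> is real-valued and acts on real test functions, so it is applied to the real and the
  imaginary part of \<open>exp (- 2 \<pi> \<i> x \<bullet> \<xi>)\<close> separately.\<close>

definition fourier :: "'n::finite pdist \<Rightarrow> int^'n \<Rightarrow> complex" where
  "fourier g \<xi> = Complex (dapply g (\<lambda>x. cos (phase \<xi> x))) (- dapply g (\<lambda>x. sin (phase \<xi> x)))"

definition weight :: "int^'n \<Rightarrow> real" where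
  "weight \<xi> = 1 + (\<Sum>i\<in>UNIV. (real_of_int (\<xi> $ i))\<^sup>2)"

definition Hs :: "real \<Rightarrow> 'n::finite pdist set" where
  "Hs s = {g. (\<lambda>\<xi>. weight \<xi> powr s * (cmod (fourier g \<xi>))\<^sup>2) summable_on UNIV}"

definition Hs_norm :: "real \<Rightarrow> 'n::finite pdist \<Rightarrow> real" where
  "Hs_norm s g = sqrt (\<Sum>\<^sub>\<infinity>\<xi>. weight \<xi> powr s * (cmod (fourier g \<xi>))\<^sup>2)"

definition Hs_dot :: "real \<Rightarrow> 'n::finite pdist set" where
  "Hs_dot s = {g \<in> Hs s. fourier g 0 = 0}"

abbreviation L2_dot :: "'n::finite pdist set" where
  "L2_dot \<equiv> Hs_dot 0"

abbreviation L2_norm :: "'n::finite pdist \<Rightarrow> real" where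
  "L2_norm \<equiv> Hs_norm 0"

text \<open>The sum is real for real-valued \<open>g\<close> and \<open>f\<close>.\<close>

definition pairing :: "'n::finite pdist \<Rightarrow> 'n pdist \<Rightarrow> real" where
  "pairing g f = Re (\<Sum>\<^sub>\<infinity>\<xi>. fourier g \<xi> * fourier f (- \<xi>))"

type_synonym 'n vdist = "'n pdist ^ 'n"

definition vHs_dot :: "real \<Rightarrow> 'n::finite vdist set" where
  "vHs_dot s = {u. \<forall>k. u $ k \<in> Hs_dot s}"

definition vHs_norm :: "real \<Rightarrow> 'n::finite vdist \<Rightarrow> real" where
  "vHs_norm s u = sqrt (\<Sum>k\<in>UNIV. (Hs_norm s (u $ k))\<^sup>2)"

definition vpairing :: "'n::finite vdist \<Rightarrow> 'n vdist \<Rightarrow> real" where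
  "vpairing f v = (\<Sum>k\<in>UNIV. pairing (f $ k) (v $ k))"

definition dvg :: "'n::finite vdist \<Rightarrow> 'n pdist" where
  "dvg u = (\<Sum>j\<in>UNIV. ddiff j (u $ j))"

definition grad :: "'n::finite pdist \<Rightarrow> 'n vdist" where
  "grad p = (\<chi> k. ddiff k p)"

definition strain :: "'n::finite vdist \<Rightarrow> 'n \<Rightarrow> 'n \<Rightarrow> 'n pdist" where
  "strain u j \<beta> = (1/2) *\<^sub>R (ddiff j (u $ \<beta>) + ddiff \<beta> (u $ j))"

definition Lq_sol :: "real \<Rightarrow> (real^'n::finite \<Rightarrow> real^'n) set" where
  "Lq_sol q = {U. (\<forall>j. (\<lambda>x. U x $ j) \<in> Lq q) \<and> dvg (\<chi> j. dist_of (\<lambda>x. U x $ j)) = 0}"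

definition convection :: "(real^'n \<Rightarrow> real^'n) \<Rightarrow> 'n::finite vdist \<Rightarrow> 'n vdist" where
  "convection U u = (\<chi> k. \<Sum>j\<in>UNIV. fmult (\<lambda>x. U x $ j) (ddiff j (u $ k)))"

text \<open>\<open>A k j \<alpha> \<beta>\<close> is the coefficient with lower indices \<open>k, j\<close> and upper indices \<open>\<alpha>, \<beta>\<close>.\<close>

type_synonym 'n tensor = "'n \<Rightarrow> 'n \<Rightarrow> 'n \<Rightarrow> 'n \<Rightarrow> real"

definition tensor_symmetric :: "'n tensor \<Rightarrow> bool" where
  "tensor_symmetric A \<longleftrightarrow>
     (\<forall>k j \<alpha> \<beta>. A k j \<alpha> \<beta> = A \<alpha> j k \<beta> \<and> A k j \<alpha> \<beta> = A k \<beta> \<alpha> j)"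

definition relaxed_elliptic :: "'n::finite tensor \<Rightarrow> real \<Rightarrow> bool" where
  "relaxed_elliptic A C \<longleftrightarrow> C > 0 \<and>
     (\<forall>\<zeta> :: real^'n^'n. transpose \<zeta> = \<zeta> \<and> trace \<zeta> = 0 \<longrightarrow>
        C * (\<Sum>k\<in>UNIV. \<Sum>j\<in>UNIV. \<Sum>\<alpha>\<in>UNIV. \<Sum>\<beta>\<in>UNIV. A k j \<alpha> \<beta> * \<zeta> $ k $ \<alpha> * \<zeta> $ j $ \<beta>)
          \<ge> (\<Sum>k\<in>UNIV. \<Sum>\<alpha>\<in>UNIV. \<zeta> $ k $ \<alpha> * \<zeta> $ k $ \<alpha>))"

definition tensor_norm :: "'n::finite tensor \<Rightarrow> real" where
  "tensor_norm A = Max (range (\<lambda>(k, j, \<alpha>, \<beta>). \<bar>A k j \<alpha> \<beta>\<bar>))"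

definition stress :: "'n::finite tensor \<Rightarrow> 'n vdist \<Rightarrow> 'n \<Rightarrow> 'n \<Rightarrow> 'n pdist" where
  "stress A u k \<alpha> = (\<Sum>j\<in>UNIV. \<Sum>\<beta>\<in>UNIV. A k j \<alpha> \<beta> *\<^sub>R strain u j \<beta>)"

definition lop :: "'n::finite tensor \<Rightarrow> 'n vdist \<Rightarrow> 'n vdist" where
  "lop A u = (\<chi> k. \<Sum>\<alpha>\<in>UNIV. ddiff \<alpha> (stress A u k \<alpha>))"

definition a_form :: "'n::finite tensor \<Rightarrow> (real^'n \<Rightarrow> real^'n) \<Rightarrow> 'n vdist \<Rightarrow> 'n vdist \<Rightarrow> real" where
  "a_form A U u v =
     (\<Sum>i\<in>UNIV. \<Sum>\<alpha>\<in>UNIV. pairing (stress A u i \<alpha>) (strain v i \<alpha>)) + vpairing (convection U u) v"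

definition b_form :: "'n::finite vdist \<Rightarrow> 'n pdist \<Rightarrow> real" where
  "b_form v q = - pairing (dvg v) q"

definition variational_solution ::
  "'n::finite tensor \<Rightarrow> (real^'n \<Rightarrow> real^'n) \<Rightarrow> 'n vdist \<times> 'n pdist \<Rightarrow> 'n vdist \<times> 'n pdist \<Rightarrow> bool"
where
  "variational_solution A U = (\<lambda>(f, g) (u, p).
     u \<in> vHs_dot 1 \<and> p \<in> L2_dot \<and>
     (\<forall>v\<in>vHs_dot 1. a_form A U u v + b_form v p = vpairing f v) \<and>
     (\<forall>q\<in>L2_dot. b_form u q = - pairing g q))"

definition oseen_op ::
  "'n::finite tensor \<Rightarrow> (real^'n \<Rightarrow> real^'n) \<Rightarrow> 'n vdist \<times> 'n pdist \<Rightarrow> 'n vdist \<times> 'n pdist" where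
  "oseen_op A U = (\<lambda>(u, p). (- lop A u + grad p + convection U u, dvg u))"

definition oseen_solution ::
  "'n::finite tensor \<Rightarrow> (real^'n \<Rightarrow> real^'n) \<Rightarrow> 'n vdist \<times> 'n pdist \<Rightarrow> 'n vdist \<times> 'n pdist \<Rightarrow> bool"
where
  "oseen_solution A U = (\<lambda>(f, g) (u, p).
     u \<in> vHs_dot 1 \<and> p \<in> L2_dot \<and>
     - lop A u + grad p + convection U u = f \<and> dvg u = g)"

definition pair_norm :: "real \<Rightarrow> 'n::finite vdist \<times> 'n pdist \<Rightarrow> real" where
  "pair_norm s = (\<lambda>(u, p). sqrt ((vHs_norm s u)\<^sup>2 + (L2_norm p)\<^sup>2))"

text \<open>Subspaces of a real vector space that carry their own norm. Well-posedness is meant in the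
  sense of Hadamard; \<open>R y x\<close> says that \<open>x\<close> is a solution for the data \<open>y\<close>.\<close>

definition well_posed ::
  "'a::real_vector set \<Rightarrow> ('a \<Rightarrow> real) \<Rightarrow> 'b::real_vector set \<Rightarrow> ('b \<Rightarrow> real) \<Rightarrow> ('b \<Rightarrow> 'a \<Rightarrow> bool) \<Rightarrow> bool"
where
  "well_posed X nX Y nY R \<longleftrightarrow>
     (\<forall>y\<in>Y. \<exists>!x. x \<in> X \<and> R y x) \<and>
     (\<forall>y\<in>Y. \<forall>x\<in>X. R y x \<longrightarrow> (\<forall>\<epsilon>>0. \<exists>\<delta>>0. \<forall>y'\<in>Y. \<forall>x'\<in>X.
        R y' x' \<and> nY (y' - y) < \<delta> \<longrightarrow> nX (x' - x) < \<epsilon>))"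

definition isomorphism_on ::
  "'a::real_vector set \<Rightarrow> ('a \<Rightarrow> real) \<Rightarrow> 'b::real_vector set \<Rightarrow> ('b \<Rightarrow> real) \<Rightarrow> ('a \<Rightarrow> 'b) \<Rightarrow> bool"
where
  "isomorphism_on X nX Y nY S \<longleftrightarrow>
     (\<forall>x\<in>X. \<forall>x'\<in>X. S (x + x') = S x + S x') \<and> (\<forall>x\<in>X. \<forall>c. S (c *\<^sub>R x) = c *\<^sub>R S x) \<and>
     bij_betw S X Y \<and>
     (\<exists>K. \<forall>x\<in>X. nY (S x) \<le> K * nX x) \<and> (\<exists>K. \<forall>x\<in>X. nX x \<le> K * nY (S x))"

end

theory Submission
  imports Defs
begin

text \<open>On solenoidal fields the problem is coercive: the strain is symmetric and trace-free, so that
  relaxed ellipticity applies to it, its norm controls the gradient frequency by frequency, and the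
  convection term is skew-symmetric because \<open>U\<close> is solenoidal. After multiplying Fourier
  coefficients by \<open>weight \<xi> powr (s/2)\<close> all the Sobolev spaces become closed subspaces of one
  space of square-summable families, where the momentum equation tested with solenoidal fields is
  \<open>P (T u) = P f\<close> for the Leray projection \<open>P\<close>, and is solved by a contraction. Functionals in the
  kernel of \<open>P\<close> are gradients, which yields the pressure; a prescribed divergence is lifted
  explicitly.

  Convection is a bounded map of \<open>H\<^sup>1\<close> into \<open>H\<^sup>-\<^sup>1\<close> because multiplication by a function in
  \<open>L\<^sub>\<theta>\<close> maps \<open>H\<^sup>1\<close> into \<open>L\<^sub>2\<close>; this only needs the growth of the lattice sums of
  \<open>1 / weight\<close> over dyadic cubes.\<close>

section \<open>Square-summable families\<close>

text \<open>Two facts connect the coordinate spaces with the given distributions: Fourier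
  coefficients determine a distribution (\<open>fourier_inject\<close>), and every hermitian
  square-summable family is attained by an L2 function (\<open>riesz_fischer\<close>). Convection
  needs the second one together with almost-everywhere uniqueness, since \<open>fmult\<close>
  multiplies by a chosen representative. Origin of C/pi^2: at a nonzero frequency xi the weight is
  at most 2 |xi|^2, while a solenoidal field with coefficient z has a strain of squared norm 2 pi^2
  |xi|^2 |z|^2, hence at least pi^2 times the weighted |z|^2. The flow U is absent from this
  constant because convection is skew. It enters the others because a prescribed divergence is
  lifted to a field to which the whole operator is then applied, and because the pressure is read
  off the equation. Uniqueness, injectivity and continuity of the inverse all come from a priori
  estimates that hold for every solution.\<close>

typedef (overloaded) ('i, 'b::real_inner) ell2 =
  "{f :: 'i \<Rightarrow> 'b. (\<lambda>i. (norm (f i))\<^sup>2) summable_on UNIV}"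
  morphisms ell2_nth Abs_ell2
proof
  show "(\<lambda>i. 0) \<in> {f :: 'i \<Rightarrow> 'b. (\<lambda>i. (norm (f i))\<^sup>2) summable_on UNIV}"
    by simp
qed

setup_lifting type_definition_ell2

lemma square_summable_add:
  fixes f g :: "'i \<Rightarrow> 'b::real_normed_vector"
  assumes "(\<lambda>i. (norm (f i))\<^sup>2) summable_on A" "(\<lambda>i. (norm (g i))\<^sup>2) summable_on A"
  shows "(\<lambda>i. (norm (f i + g i))\<^sup>2) summable_on A"
proof (rule summable_on_comparison_test)
  show "(\<lambda>i. 2 * (norm (f i))\<^sup>2 + 2 * (norm (g i))\<^sup>2) summable_on A"
    by (intro summable_on_add summable_on_cmult_right assms)
  show "(norm (f i + g i))\<^sup>2 \<le> 2 * (norm (f i))\<^sup>2 + 2 * (norm (g i))\<^sup>2" for i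
  proof -
    have "(norm (f i + g i))\<^sup>2 \<le> (norm (f i) + norm (g i))\<^sup>2"
      by (intro power_mono norm_triangle_ineq) simp
    also have "\<dots> \<le> 2 * (norm (f i))\<^sup>2 + 2 * (norm (g i))\<^sup>2"
      using zero_le_power2[of "norm (f i) - norm (g i)"] by (simp add: power2_eq_square algebra_simps)
    finally show ?thesis .
  qed
qed simp

lemma square_summable_scaleR:
  fixes f :: "'i \<Rightarrow> 'b::real_normed_vector"
  assumes "(\<lambda>i. (norm (f i))\<^sup>2) summable_on A"
  shows "(\<lambda>i. (norm (c *\<^sub>R f i))\<^sup>2) summable_on A"
  using summable_on_cmult_right[OF assms, of "c\<^sup>2"] by (simp add: power_mult_distrib)

lemma square_summable_inner:
  fixes f g :: "'i \<Rightarrow> 'b::real_inner"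
  assumes "(\<lambda>i. (norm (f i))\<^sup>2) summable_on A" "(\<lambda>i. (norm (g i))\<^sup>2) summable_on A"
  shows "(\<lambda>i. f i \<bullet> g i) summable_on A"
proof -
  \<comment> \<open>Polarization: the inner product is a combination of squared norms.\<close>
  have "(\<lambda>i. (1/2) * ((norm (f i + g i))\<^sup>2 + - ((norm (f i))\<^sup>2 + (norm (g i))\<^sup>2))) summable_on A"
    by (intro summable_on_cmult_right summable_on_add summable_on_uminus[THEN iffD2] 
        square_summable_add assms)
  then show ?thesis
    by (simp add: power2_norm_eq_inner inner_add_left inner_add_right inner_commute)
qed

instantiation ell2 :: (type, real_inner) real_vector
begin

lift_definition zero_ell2 :: "('a, 'b) ell2" is "\<lambda>i. 0" by simp
lift_definition plus_ell2 :: "('a, 'b) ell2 \<Rightarrow> ('a, 'b) ell2 \<Rightarrow> ('a, 'b) ell2"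
  is "\<lambda>f g i. f i + g i" by (rule square_summable_add)
lift_definition scaleR_ell2 :: "real \<Rightarrow> ('a, 'b) ell2 \<Rightarrow> ('a, 'b) ell2"
  is "\<lambda>c f i. c *\<^sub>R f i" by (rule square_summable_scaleR)
lift_definition uminus_ell2 :: "('a, 'b) ell2 \<Rightarrow> ('a, 'b) ell2" is "\<lambda>f i. - f i" by simp
lift_definition minus_ell2 :: "('a, 'b) ell2 \<Rightarrow> ('a, 'b) ell2 \<Rightarrow> ('a, 'b) ell2"
  is "\<lambda>f g i. f i - g i"
  using square_summable_add[of _ _ "\<lambda>i. - _ i"] by simp

instance
  by standard (transfer; simp add: algebra_simps)+

end

instantiation ell2 :: (type, real_inner) real_inner
begin

lift_definition inner_ell2 :: "('a, 'b) ell2 \<Rightarrow> ('a, 'b) ell2 \<Rightarrow> real"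
  is "\<lambda>f g. \<Sum>\<^sub>\<infinity>i. f i \<bullet> g i" .
definition norm_ell2 :: "('a, 'b) ell2 \<Rightarrow> real" where "norm_ell2 x = sqrt (x \<bullet> x)"
definition sgn_ell2 :: "('a, 'b) ell2 \<Rightarrow> ('a, 'b) ell2" where "sgn_ell2 x = x /\<^sub>R norm x"
definition dist_ell2 :: "('a, 'b) ell2 \<Rightarrow> ('a, 'b) ell2 \<Rightarrow> real" where "dist_ell2 x y = norm (x - y)"
definition uniformity_ell2 :: "(('a, 'b) ell2 \<times> ('a, 'b) ell2) filter" where
  "uniformity_ell2 = (INF e\<in>{0 <..}. principal {(x, y). dist x y < e})"
definition open_ell2 :: "('a, 'b) ell2 set \<Rightarrow> bool" where
  "open_ell2 U = (\<forall>x\<in>U. eventually (\<lambda>(x', y). x' = x \<longrightarrow> y \<in> U) uniformity)"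

instance
proof
  fix x y z :: "('a, 'b) ell2" and c :: real
  show "x \<bullet> y = y \<bullet> x"
    by transfer (simp add: inner_commute)
  show "(x + y) \<bullet> z = x \<bullet> z + y \<bullet> z"
    by transfer (simp add: inner_add_left infsum_add square_summable_inner)
  show "c *\<^sub>R x \<bullet> y = c * (x \<bullet> y)"
    by transfer (simp add: infsum_cmult_right')
  show "0 \<le> x \<bullet> x"
    by transfer (auto intro!: infsum_nonneg)
  show "x \<bullet> x = 0 \<longleftrightarrow> x = 0"
  proof transfer
    fix f :: "'a \<Rightarrow> 'b" assume f: "(\<lambda>i. (norm (f i))\<^sup>2) summable_on UNIV"
    show "(\<Sum>\<^sub>\<infinity>i. f i \<bullet> f i) = 0 \<longleftrightarrow> f = (\<lambda>i. 0)"
      using nonneg_infsum_le_0D[of "\<lambda>i. f i \<bullet> f i" UNIV] square_summable_inner[OF f f] by fastforce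
  qed
qed (rule norm_ell2_def sgn_ell2_def dist_ell2_def uniformity_ell2_def open_ell2_def)+

end

lemma ell2_nth_simps [simp]:
  "ell2_nth 0 i = 0" "ell2_nth (x + y) i = ell2_nth x i + ell2_nth y i"
  "ell2_nth (x - y) i = ell2_nth x i - ell2_nth y i" "ell2_nth (c *\<^sub>R x) i = c *\<^sub>R ell2_nth x i"
  "ell2_nth (- x) i = - ell2_nth x i"
  by (transfer; simp)+

lemma ell2_eqI: "(\<And>i. ell2_nth x i = ell2_nth y i) \<Longrightarrow> x = y"
  by transfer auto

lemma ell2_summable: "(\<lambda>i. (norm (ell2_nth x i))\<^sup>2) summable_on UNIV"
  by transfer

lemma ell2_nth_Abs:
  "(\<lambda>i. (norm (f i))\<^sup>2) summable_on UNIV \<Longrightarrow> ell2_nth (Abs_ell2 f) = f"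
  by (simp add: Abs_ell2_inverse)

lemma inner_ell2_eq: "x \<bullet> y = (\<Sum>\<^sub>\<infinity>i. ell2_nth x i \<bullet> ell2_nth y i)"
  by transfer simp

lemma norm_ell2_sq: "(norm x)\<^sup>2 = (\<Sum>\<^sub>\<infinity>i. (norm (ell2_nth x i))\<^sup>2)"
  unfolding power2_norm_eq_inner by (rule inner_ell2_eq)

lemma sum_norm_ell2_le: "finite F \<Longrightarrow> (\<Sum>i\<in>F. (norm (ell2_nth x i))\<^sup>2) \<le> (norm x)\<^sup>2"
  unfolding norm_ell2_sq by (intro finite_sum_le_infsum ell2_summable) auto

lemma norm_ell2_nth_le: "norm (ell2_nth x i) \<le> norm x"
  using sum_norm_ell2_le[of "{i}" x] by (auto intro: power2_le_imp_le[OF _ norm_ge_zero])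

lemma bounded_linear_ell2_nth: "bounded_linear (\<lambda>x. ell2_nth x i)"
  by (rule bounded_linear_intro[where K = 1]) (auto simp: norm_ell2_nth_le)

text \<open>The limit is taken coordinatewise. Sums of squares over a finite set pass to the limit
  in one index, so the Cauchy bound survives there, and being uniform in the finite set it extends
  to the infinite sum.\<close>

instance ell2 :: (type, "{real_inner, complete_space}") complete_space
proof
  fix X :: "nat \<Rightarrow> ('a, 'b) ell2"
  assume X: "Cauchy X"
  have "Cauchy (\<lambda>n. ell2_nth (X n) i)" for i
    using bounded_linear.Cauchy[OF bounded_linear_ell2_nth X] .
  then obtain f where f: "\<And>i. (\<lambda>n. ell2_nth (X n) i) \<longlonglongrightarrow> f i"
    unfolding Cauchy_convergent_iff convergent_def by metis
  have tail: "(\<Sum>i\<in>F. (norm (ell2_nth (X n) i - f i))\<^sup>2) \<le> e\<^sup>2"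
    if "finite F" and N: "\<And>m n. m \<ge> N \<Longrightarrow> n \<ge> N \<Longrightarrow> norm (X n - X m) < e" and "n \<ge> N" for F N n e
  proof (rule LIMSEQ_le_const2)
    show "(\<lambda>m. \<Sum>i\<in>F. (norm (ell2_nth (X n) i - ell2_nth (X m) i))\<^sup>2) \<longlonglongrightarrow>
        (\<Sum>i\<in>F. (norm (ell2_nth (X n) i - f i))\<^sup>2)"
      by (intro tendsto_intros f)
    have "(\<Sum>i\<in>F. (norm (ell2_nth (X n) i - ell2_nth (X m) i))\<^sup>2) \<le> e\<^sup>2" if "m \<ge> N" for m
    proof -
      have "(\<Sum>i\<in>F. (norm (ell2_nth (X n) i - ell2_nth (X m) i))\<^sup>2) \<le> (norm (X n - X m))\<^sup>2"
        using sum_norm_ell2_le[OF \<open>finite F\<close>, of "X n - X m"] by simp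
      also have "\<dots> \<le> e\<^sup>2"
        using N[OF that \<open>n \<ge> N\<close>] by (intro power_mono) auto
      finally show ?thesis .
    qed
    then show "\<exists>N. \<forall>m\<ge>N. (\<Sum>i\<in>F. (norm (ell2_nth (X n) i - ell2_nth (X m) i))\<^sup>2) \<le> e\<^sup>2"
      by blast
  qed
  have small: "(\<lambda>i. (norm (ell2_nth (X n) i - f i))\<^sup>2) summable_on UNIV \<and>
      (\<Sum>\<^sub>\<infinity>i. (norm (ell2_nth (X n) i - f i))\<^sup>2) \<le> e\<^sup>2"
    if N: "\<And>m n. m \<ge> N \<Longrightarrow> n \<ge> N \<Longrightarrow> norm (X n - X m) < e" and "n \<ge> N" for N n e
  proof
    show s: "(\<lambda>i. (norm (ell2_nth (X n) i - f i))\<^sup>2) summable_on UNIV"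
      using tail[OF _ that] by (intro nonneg_bdd_above_summable_on) (auto simp: bdd_above_def)
    show "(\<Sum>\<^sub>\<infinity>i. (norm (ell2_nth (X n) i - f i))\<^sup>2) \<le> e\<^sup>2"
      using tail[OF _ that] by (intro infsum_le_finite_sums s) auto
  qed
  have Cau: "\<exists>N. \<forall>m\<ge>N. \<forall>n\<ge>N. norm (X n - X m) < e" if "e > 0" for e
    using X that unfolding Cauchy_def dist_norm by blast
  obtain N where "\<And>m n. m \<ge> N \<Longrightarrow> n \<ge> N \<Longrightarrow> norm (X n - X m) < 1"
    using Cau[of 1] by auto
  from small[OF this, of N] have "(\<lambda>i. (norm (ell2_nth (X N) i - f i))\<^sup>2) summable_on UNIV" by simp
  \<comment> \<open>The limit family is \<open>X N\<close> minus a square-summable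
    difference.\<close>
  from square_summable_add[OF ell2_summable[of "X N"] square_summable_scaleR[OF this, of "-1"]]
  have f2: "(\<lambda>i. (norm (f i))\<^sup>2) summable_on UNIV" by simp
  have "X \<longlonglongrightarrow> Abs_ell2 f"
  proof (rule LIMSEQ_I)
    fix r :: real assume "r > 0"
    then obtain N where N: "\<And>m n. m \<ge> N \<Longrightarrow> n \<ge> N \<Longrightarrow> norm (X n - X m) < r / 2"
      using Cau[of "r/2"] by auto
    have "norm (X n - Abs_ell2 f) \<le> r / 2" if "n \<ge> N" for n
    proof (rule power2_le_imp_le)
      show "(norm (X n - Abs_ell2 f))\<^sup>2 \<le> (r / 2)\<^sup>2"
        using small[OF N that] ell2_nth_Abs[OF f2] unfolding norm_ell2_sq by simp
    qed (use \<open>r > 0\<close> in simp)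
    then show "\<exists>N. \<forall>n\<ge>N. norm (X n - Abs_ell2 f) < r"
      using \<open>r > 0\<close> by (intro exI[of _ N]) force
  qed
  then show "convergent X"
    by (auto simp: convergent_def)
qed

text \<open>Lax-Milgram: \<open>x \<mapsto> x - \<rho> (G x - f)\<close> is a contraction for small \<open>\<rho>\<close>. As \<open>G\<close> is an
  operator into \<open>V\<close> and not a bilinear form, no Riesz representation is needed.\<close>

lemma coercive_surjective:
  fixes V :: "'a::real_inner set"
  assumes "complete V" "subspace V" and G_V: "\<And>x. x \<in> V \<Longrightarrow> G x \<in> V"
    and diff: "\<And>x y. x \<in> V \<Longrightarrow> y \<in> V \<Longrightarrow> G (x - y) = G x - G y"
    and bound: "\<And>x. x \<in> V \<Longrightarrow> norm (G x) \<le> M * norm x"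
    and coercive: "\<And>x. x \<in> V \<Longrightarrow> x \<bullet> G x \<ge> \<alpha> * (norm x)\<^sup>2"
    and "\<alpha> > 0" "f \<in> V"
  shows "\<exists>x\<in>V. G x = f"
proof -
  \<comment> \<open>\<open>K\<close> is a bound for \<open>G\<close> that is at least
    \<open>\<alpha>\<close>, so the root defining \<open>q\<close> is real. The value of
    \<open>\<rho>\<close> minimizes 1 - 2 \<rho> \<alpha> + \<rho>^2 K^2, and \<open>q\<close> is
    the root of that minimum.\<close>
  define K where "K = max M \<alpha>"
  define \<rho> where "\<rho> = \<alpha> / K\<^sup>2"
  define q where "q = sqrt (1 - \<alpha>\<^sup>2 / K\<^sup>2)"
  have K: "K > 0" "K \<ge> \<alpha>" using \<open>\<alpha> > 0\<close> by (auto simp: K_def)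
  have "\<alpha>\<^sup>2 / K\<^sup>2 \<le> 1" "\<alpha>\<^sup>2 / K\<^sup>2 > 0"
    using K \<open>\<alpha> > 0\<close> by (auto simp: power_mono)
  then have q: "0 \<le> q" "q < 1" "q\<^sup>2 = 1 - \<alpha>\<^sup>2 / K\<^sup>2"
    by (auto simp: q_def)
  let ?\<Phi> = "\<lambda>x. x - \<rho> *\<^sub>R (G x - f)"
  have contr: "norm (z - \<rho> *\<^sub>R G z) \<le> q * norm z" if "z \<in> V" for z
  proof (rule power2_le_imp_le)
    have "norm (G z) \<le> K * norm z"
      using bound[OF that] by (smt (verit) K_def mult_right_mono norm_ge_zero)
    then have "(norm (G z))\<^sup>2 \<le> K\<^sup>2 * (norm z)\<^sup>2"
      by (metis norm_ge_zero power_mono power_mult_distrib)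
    then have 1: "\<rho>\<^sup>2 * (norm (G z))\<^sup>2 \<le> \<rho>\<^sup>2 * (K\<^sup>2 * (norm z)\<^sup>2)"
      by (intro mult_left_mono) auto
    have 2: "\<rho> * (\<alpha> * (norm z)\<^sup>2) \<le> \<rho> * (z \<bullet> G z)"
      using coercive[OF that] \<open>\<alpha> > 0\<close> by (intro mult_left_mono) (auto simp: \<rho>_def)
    have "(norm (z - \<rho> *\<^sub>R G z))\<^sup>2 = (norm z)\<^sup>2 - 2 * (\<rho> * (z \<bullet> G z)) + \<rho>\<^sup>2 * (norm (G z))\<^sup>2"
      unfolding power2_norm_eq_inner
      by (simp add: inner_diff_left inner_diff_right inner_commute power2_eq_square)
    also have "\<dots> \<le> (norm z)\<^sup>2 - 2 * (\<rho> * (\<alpha> * (norm z)\<^sup>2)) + \<rho>\<^sup>2 * (K\<^sup>2 * (norm z)\<^sup>2)"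
      using 1 2 by linarith
    also have "\<dots> = (q * norm z)\<^sup>2"
      unfolding power_mult_distrib q(3) using K(1)
      by (simp add: \<rho>_def field_simps power2_eq_square)
    finally show "(norm (z - \<rho> *\<^sub>R G z))\<^sup>2 \<le> (q * norm z)\<^sup>2" .
  qed (use q in auto)
  have "\<exists>!x\<in>V. ?\<Phi> x = x"
  proof (rule Banach_fix[OF \<open>complete V\<close> _ q(1,2)])
    show "V \<noteq> {}" using \<open>f \<in> V\<close> by auto
    show "?\<Phi> ` V \<subseteq> V"
      using \<open>subspace V\<close> G_V \<open>f \<in> V\<close> by (auto intro!: subspace_diff subspace_scale)
    fix x y assume "x \<in> V" "y \<in> V"
    then have "norm ((x - y) - \<rho> *\<^sub>R G (x - y)) \<le> q * norm (x - y)"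
      by (intro contr subspace_diff[OF \<open>subspace V\<close>])
    moreover have "?\<Phi> x - ?\<Phi> y = (x - y) - \<rho> *\<^sub>R G (x - y)"
      using \<open>x \<in> V\<close> \<open>y \<in> V\<close> by (simp add: diff scaleR_diff_right)
    ultimately show "dist (?\<Phi> x) (?\<Phi> y) \<le> q * dist x y"
      by (simp only: dist_norm)
  qed
  then obtain x where "x \<in> V" "\<rho> *\<^sub>R (G x - f) = 0" by auto
  moreover have "\<rho> \<noteq> 0" using \<open>\<alpha> > 0\<close> K by (auto simp: \<rho>_def)
  ultimately show ?thesis by auto
qed

section \<open>Trigonometric polynomials\<close>

lemma phase_add_left: "phase (\<xi> + \<eta>) x = phase \<xi> x + phase \<eta> x"
  by (simp add: phase_def distrib_left sum.distrib)

lemma phase_minus_left [simp]: "phase (- \<xi>) x = - phase \<xi> x"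
  by (simp add: phase_def sum_negf)

lemma phase_diff_left: "phase (\<xi> - \<eta>) x = phase \<xi> x - phase \<eta> x"
  using phase_add_left[of \<xi> "- \<eta>" x] by simp

lemma phase_zero_left [simp]: "phase 0 x = 0"
  by (simp add: phase_def)

lemma phase_axis [simp]: "phase \<xi> (axis i t) = 2 * pi * (t * of_int (\<xi> $ i))"
proof -
  have "(\<Sum>k\<in>UNIV. axis i t $ k * real_of_int (\<xi> $ k)) = (\<Sum>k\<in>UNIV. if k = i then t * of_int (\<xi> $ i) else 0)"
    by (intro sum.cong) (auto simp: axis_def)
  then show ?thesis by (simp add: phase_def)
qed

lemma linear_phase: "linear (phase \<xi>)"
  by (rule linearI) (simp_all add: phase_def sum.distrib distrib_right distrib_left sum_distrib_left mult_ac)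

lemma phase_has_derivative: "(phase \<xi> has_derivative phase \<xi>) (at x)"
  by (intro bounded_linear_imp_has_derivative linear_conv_bounded_linear[THEN iffD1] linear_phase)

lemma phase_add_axis: "phase \<xi> (x + axis i t) = phase \<xi> x + 2 * pi * (t * of_int (\<xi> $ i))"
  by (simp add: linear_add[OF linear_phase])

lemma cos_phase_deriv:
  "((\<lambda>x. cos (phase \<xi> x)) has_derivative (\<lambda>h. - sin (phase \<xi> x) * phase \<xi> h)) (at x)"
  by (auto intro!: derivative_eq_intros phase_has_derivative)

lemma sin_phase_deriv:
  "((\<lambda>x. sin (phase \<xi> x)) has_derivative (\<lambda>h. cos (phase \<xi> x) * phase \<xi> h)) (at x)"
  by (auto intro!: derivative_eq_intros phase_has_derivative)

lemma partial_eqI: "(\<And>x. (f has_derivative f' x) (at x)) \<Longrightarrow> partial j f = (\<lambda>x. f' x (axis j 1))"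
  unfolding partial_def by (metis frechet_derivative_at)

lemma partial_cos_phase:
  "partial j (\<lambda>x. cos (phase \<xi> x)) = (\<lambda>x. - (2 * pi * of_int (\<xi> $ j)) * sin (phase \<xi> x))"
  by (subst partial_eqI[OF cos_phase_deriv]) (simp add: fun_eq_iff)

lemma partial_sin_phase:
  "partial j (\<lambda>x. sin (phase \<xi> x)) = (\<lambda>x. (2 * pi * of_int (\<xi> $ j)) * cos (phase \<xi> x))"
  by (subst partial_eqI[OF sin_phase_deriv]) (simp add: fun_eq_iff)

text \<open>Generated by single modes, so that closure under products and derivatives needs checking
  on modes only. Constants are modes of frequency 0. The algebra property is what makes polynomial
  approximation available later.\<close>

inductive_set trig :: "(real^'n::finite \<Rightarrow> real) set" where
  trig_cos: "(\<lambda>x. c * cos (phase \<xi> x)) \<in> trig"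
| trig_sin: "(\<lambda>x. c * sin (phase \<xi> x)) \<in> trig"
| trig_add: "f \<in> trig \<Longrightarrow> g \<in> trig \<Longrightarrow> (\<lambda>x. f x + g x) \<in> trig"

lemma trig_const: "(\<lambda>x. c) \<in> trig"
  using trig_cos[of c 0] by simp

lemma trig_scale: "f \<in> trig \<Longrightarrow> (\<lambda>x. c * f x) \<in> trig"
  by (induction rule: trig.induct)
    (auto simp: distrib_left mult.assoc[symmetric] intro: trig.intros)

lemma trig_sum: "(\<And>i. i \<in> I \<Longrightarrow> f i \<in> trig) \<Longrightarrow> (\<lambda>x. \<Sum>i\<in>I. f i x) \<in> trig"
  by (induction I rule: infinite_finite_induct) (auto intro: trig_const trig_add)

text \<open>Product-to-sum formulas: two modes multiply to modes of the sum and the difference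
  frequency.\<close>

lemma trig_mult_cos:
  assumes "f \<in> trig" shows "(\<lambda>x. f x * cos (phase \<xi> x)) \<in> trig"
  using assms
proof induction
  case (trig_cos c \<eta>)
  have "(\<lambda>x. c / 2 * cos (phase (\<eta> - \<xi>) x) + c / 2 * cos (phase (\<eta> + \<xi>) x)) \<in> trig"
    by (intro trig.intros)
  then show ?case
    by (simp add: phase_add_left phase_diff_left cos_add cos_diff field_simps)
next
  case (trig_sin c \<eta>)
  have "(\<lambda>x. c / 2 * sin (phase (\<eta> - \<xi>) x) + c / 2 * sin (phase (\<eta> + \<xi>) x)) \<in> trig"
    by (intro trig.intros)
  then show ?case
    by (simp add: phase_add_left phase_diff_left sin_add sin_diff field_simps)
qed (simp add: distrib_right trig_add)

lemma trig_mult_sin: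
  assumes "f \<in> trig" shows "(\<lambda>x. f x * sin (phase \<xi> x)) \<in> trig"
  using assms
proof induction
  case (trig_cos c \<eta>)
  have "(\<lambda>x. c / 2 * sin (phase (\<eta> + \<xi>) x) + (- c / 2) * sin (phase (\<eta> - \<xi>) x)) \<in> trig"
    by (intro trig.intros)
  then show ?case
    by (simp add: phase_add_left phase_diff_left sin_add sin_diff field_simps)
next
  case (trig_sin c \<eta>)
  have "(\<lambda>x. c / 2 * cos (phase (\<eta> - \<xi>) x) + (- c / 2) * cos (phase (\<eta> + \<xi>) x)) \<in> trig"
    by (intro trig.intros)
  then show ?case
    by (simp add: phase_add_left phase_diff_left cos_add cos_diff field_simps)
qed (simp add: distrib_right trig_add)

lemma trig_mult:
  assumes "f \<in> trig" "g \<in> trig" shows "(\<lambda>x. f x * g x) \<in> trig"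
  using assms(2)
proof induction
  case (trig_cos c \<eta>)
  show ?case using trig_scale[OF trig_mult_cos[OF assms(1)], of c \<eta>] by (simp add: mult_ac)
next
  case (trig_sin c \<eta>)
  show ?case using trig_scale[OF trig_mult_sin[OF assms(1)], of c \<eta>] by (simp add: mult_ac)
qed (simp add: distrib_left trig_add)

lemma trig_differentiable:
  assumes "f \<in> trig" shows "f differentiable (at x)"
  using assms
proof induction
  case (trig_cos c \<xi>)
  show ?case
    using has_derivative_mult_right[OF cos_phase_deriv] unfolding differentiable_def by blast
next
  case (trig_sin c \<xi>)
  show ?case
    using has_derivative_mult_right[OF sin_phase_deriv] unfolding differentiable_def by blast
qed (simp add: differentiable_add)

lemma trig_partial:
  assumes "f \<in> trig" shows "partial j f \<in> trig"
  using assms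
proof induction
  case (trig_cos c \<xi>)
  have "(\<lambda>x. cos (phase \<xi> x)) differentiable (at x)" for x
    using trig_differentiable[OF trig.trig_cos[of 1 \<xi>]] by simp
  then show ?case
    using trig.trig_sin[of "c * - (2 * pi * of_int (\<xi> $ j))" \<xi>]
    by (simp add: partial_scale partial_cos_phase mult.assoc)
next
  case (trig_sin c \<xi>)
  have "(\<lambda>x. sin (phase \<xi> x)) differentiable (at x)" for x
    using trig_differentiable[OF trig.trig_sin[of 1 \<xi>]] by simp
  then show ?case
    using trig.trig_cos[of "c * (2 * pi * of_int (\<xi> $ j))" \<xi>]
    by (simp add: partial_scale partial_sin_phase mult.assoc)
qed (simp add: partial_add trig_differentiable trig_add)

lemma cos_add_int_2pi: "cos (x + 2 * pi * of_int k) = cos x"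
  by (simp add: cos_add)

lemma sin_add_int_2pi: "sin (x + 2 * pi * of_int k) = sin x"
  by (simp add: sin_add)

lemma trig_periodic:
  assumes "f \<in> trig" shows "periodic f"
  using assms
  by induction (simp_all add: periodic_def phase_add_axis cos_add_int_2pi sin_add_int_2pi)

lemma trig_partials: "f \<in> trig \<Longrightarrow> partials js f \<in> trig"
  by (induction js arbitrary: f) (auto simp: trig_partial)

lemma trig_test_funs: "f \<in> trig \<Longrightarrow> f \<in> test_funs"
  by (simp add: test_funs_def trig_periodic trig_differentiable trig_partials)

lemma cos_phase_test [simp]: "(\<lambda>x. cos (phase \<xi> x)) \<in> test_funs"
  and sin_phase_test [simp]: "(\<lambda>x. sin (phase \<xi> x)) \<in> test_funs"
  using trig_test_funs[OF trig_cos[of 1 \<xi>]] trig_test_funs[OF trig_sin[of 1 \<xi>]] by simp_all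

lemma const_test [simp]: "(\<lambda>x. c) \<in> test_funs"
  by (intro trig_test_funs trig_const)

lemma test_funs_periodic: "f \<in> test_funs \<Longrightarrow> periodic f"
  by (simp add: test_funs_def)

lemma test_funs_partials: "f \<in> test_funs \<Longrightarrow> partials js f \<in> test_funs"
  by (induction js arbitrary: f) (auto intro: test_funs_partial)

lemma test_funs_sum: "(\<And>i. i \<in> I \<Longrightarrow> f i \<in> test_funs) \<Longrightarrow> (\<lambda>x. \<Sum>i\<in>I. f i x) \<in> test_funs"
  by (induction I rule: infinite_finite_induct) (auto intro: test_funs_add)

lemma test_funs_diff: "f \<in> test_funs \<Longrightarrow> g \<in> test_funs \<Longrightarrow> (\<lambda>x. f x - g x) \<in> test_funs"
  using test_funs_add[OF _ test_funs_scale[of g "-1"]] by simp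

text \<open>The real part of the exponential sum with coefficients \<open>c\<close>. For symmetric
  \<open>F\<close> and hermitian \<open>c\<close> that sum is already real, so nothing is
  lost.\<close>

definition trig_poly :: "(int^'n) set \<Rightarrow> (int^'n \<Rightarrow> complex) \<Rightarrow> real^'n::finite \<Rightarrow> real" where
  "trig_poly F c x = (\<Sum>\<xi>\<in>F. Re (c \<xi>) * cos (phase \<xi> x) - Im (c \<xi>) * sin (phase \<xi> x))"

lemma trig_poly_trig: "trig_poly F c \<in> trig"
proof -
  have "(\<lambda>x. Re (c \<xi>) * cos (phase \<xi> x) + (- Im (c \<xi>)) * sin (phase \<xi> x)) \<in> trig" for \<xi>
    by (intro trig.intros)
  then show ?thesis
    unfolding trig_poly_def[abs_def] by (intro trig_sum) simp
qed

lemma trig_poly_test [simp]: "trig_poly F c \<in> test_funs"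
  by (intro trig_test_funs trig_poly_trig)

section \<open>Distributions on trigonometric modes\<close>

lemma dapply_add: "f \<in> test_funs \<Longrightarrow> g \<in> test_funs \<Longrightarrow>
    dapply T (\<lambda>x. f x + g x) = dapply T f + dapply T g"
  and dapply_scale: "f \<in> test_funs \<Longrightarrow> dapply T (\<lambda>x. c * f x) = c * dapply T f"
  and dapply_out: "f \<notin> test_funs \<Longrightarrow> dapply T f = 0"
  using dapply[of T] is_pdistD[of "dapply T"] by auto

lemma dapply_sum_right: "(\<And>i. i \<in> I \<Longrightarrow> f i \<in> test_funs) \<Longrightarrow>
    dapply T (\<lambda>x. \<Sum>i\<in>I. f i x) = (\<Sum>i\<in>I. dapply T (f i))"
proof (induction I rule: infinite_finite_induct)
  case empty
  show ?case using dapply_scale[of "\<lambda>x. 0" T 0] by simp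
next
  case (infinite A)
  show ?case using dapply_scale[of "\<lambda>x. 0" T 0] infinite by simp
qed (simp add: dapply_add test_funs_sum)

lemma dapply_diff: "f \<in> test_funs \<Longrightarrow> g \<in> test_funs \<Longrightarrow>
    dapply T (\<lambda>x. f x - g x) = dapply T f - dapply T g"
  using dapply_add[of f "\<lambda>x. (-1) * g x" T] dapply_scale[of g T "-1"] test_funs_scale[of g "-1"] by simp

lemma dapply_uminus: "f \<in> test_funs \<Longrightarrow> dapply T (\<lambda>x. - f x) = - dapply T f"
  using dapply_scale[of f T "-1"] by simp

lemma pdist_eqI: "(\<And>\<phi>. \<phi> \<in> test_funs \<Longrightarrow> dapply S \<phi> = dapply T \<phi>) \<Longrightarrow> S = T"
  by (metis dapply_inject dapply_out ext)

lemma dapply_simps [simp]: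
  "dapply 0 \<phi> = 0" "dapply (S + T) \<phi> = dapply S \<phi> + dapply T \<phi>"
  "dapply (S - T) \<phi> = dapply S \<phi> - dapply T \<phi>" "dapply (c *\<^sub>R T) \<phi> = c * dapply T \<phi>"
  "dapply (- T) \<phi> = - dapply T \<phi>"
  by (transfer; simp)+

lemma dapply_sum_left: "dapply (\<Sum>i\<in>I. T i) \<phi> = (\<Sum>i\<in>I. dapply (T i) \<phi>)"
  by (induction I rule: infinite_finite_induct) auto

lemma dapply_ddiff: "\<phi> \<in> test_funs \<Longrightarrow> dapply (ddiff j T) \<phi> = - dapply T (partial j \<phi>)"
  by transfer simp

lemma fourier_minus: "fourier T (- \<xi>) = cnj (fourier T \<xi>)"
proof -
  have "dapply T (\<lambda>x. (-1) * sin (phase \<xi> x)) = (-1) * dapply T (\<lambda>x. sin (phase \<xi> x))"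
    by (rule dapply_scale) simp
  then show ?thesis by (simp add: fourier_def complex_eq_iff)
qed

lemma fourier_simps [simp]:
  "fourier 0 \<xi> = 0" "fourier (S + T) \<xi> = fourier S \<xi> + fourier T \<xi>"
  "fourier (S - T) \<xi> = fourier S \<xi> - fourier T \<xi>" "fourier (c *\<^sub>R T) \<xi> = c *\<^sub>R fourier T \<xi>"
  "fourier (- T) \<xi> = - fourier T \<xi>"
  by (simp_all add: fourier_def complex_eq_iff)

lemma fourier_sum [simp]: "fourier (\<Sum>i\<in>I. T i) \<xi> = (\<Sum>i\<in>I. fourier (T i) \<xi>)"
  by (induction I rule: infinite_finite_induct) auto

lemma fourier_ddiff: "fourier (ddiff j T) \<xi> = 2 * pi * \<i> * of_int (\<xi> $ j) * fourier T \<xi>"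
  by (simp add: fourier_def complex_eq_iff dapply_ddiff partial_cos_phase partial_sin_phase dapply_scale
      dapply_uminus test_funs_scale)

text \<open>\<open>fourier T (- \<xi>)\<close> is the value of \<open>T\<close> on the exponential
  with phase \<open>phase \<xi>\<close>, so a mode with coefficient \<open>c \<xi>\<close> is sent
  to the real part of the product.\<close>

lemma dapply_trig_poly: "dapply T (trig_poly F c) = Re (\<Sum>\<xi>\<in>F. c \<xi> * fourier T (- \<xi>))"
proof -
  have "dapply T (\<lambda>x. Re (c \<xi>) * cos (phase \<xi> x) - Im (c \<xi>) * sin (phase \<xi> x)) =
      Re (c \<xi> * fourier T (- \<xi>))" for \<xi>
    unfolding fourier_minus
    by (subst dapply_diff) (auto simp: dapply_scale fourier_def intro!: test_funs_scale)
  then show ?thesis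
    unfolding trig_poly_def[abs_def] Re_sum
    by (subst dapply_sum_right) (auto intro!: test_funs_diff test_funs_scale)
qed

lemma partial_trig_poly:
  "partial j (trig_poly F c) = trig_poly F (\<lambda>\<xi>. 2 * pi * \<i> * of_int (\<xi> $ j) * c \<xi>)"
proof
  fix x
  have "(trig_poly F c has_derivative (\<lambda>h. \<Sum>\<xi>\<in>F. Re (c \<xi>) * (- sin (phase \<xi> x) * phase \<xi> h) -
      Im (c \<xi>) * (cos (phase \<xi> x) * phase \<xi> h))) (at x)" for x
    unfolding trig_poly_def[abs_def]
    by (intro has_derivative_sum has_derivative_diff has_derivative_mult_right
        cos_phase_deriv sin_phase_deriv)
  from fun_cong[OF partial_eqI[OF this], of j x]
  show "partial j (trig_poly F c) x = trig_poly F (\<lambda>\<xi>. 2 * pi * \<i> * of_int (\<xi> $ j) * c \<xi>) x"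
    unfolding trig_poly_def by (auto intro!: sum.cong simp: algebra_simps)
qed

section \<open>Integration over the torus\<close>

abbreviation TM :: "(real^'n::finite) measure" where "TM \<equiv> restrict_space lebesgue torus"

lemma torus_borel [measurable]: "(torus :: (real^'n::finite) set) \<in> sets borel"
proof -
  have "torus = (\<Inter>i. {x :: real^'n. 0 \<le> x $ i} \<inter> {x. x $ i < 1})"
    by (auto simp: torus_def)
  also have "\<dots> \<in> sets borel"
    by (intro sets.finite_INT sets.Int borel_closed borel_open closed_Collect_le open_Collect_less
        continuous_intros) auto
  finally show ?thesis .
qed

lemma torus_subset_cbox: "(torus :: (real^'n::finite) set) \<subseteq> cbox 0 1"
  by (auto simp: torus_def mem_box_cart less_imp_le)

lemma box_subset_torus: "box 0 1 \<subseteq> (torus :: (real^'n::finite) set)"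
  by (auto simp: torus_def mem_box_cart less_imp_le)

lemma emeasure_torus: "emeasure lebesgue (torus :: (real^'n::finite) set) = 1"
proof -
  have one: "(\<Prod>b\<in>Basis. (1 - (0 :: real^'n)) \<bullet> b) = (1 :: real)"
    by (intro prod.neutral) (auto simp: Basis_vec_def inner_axis)
  have le: "\<And>b. b \<in> Basis \<Longrightarrow> (0::real^'n) \<bullet> b \<le> 1 \<bullet> b"
    by (auto simp: Basis_vec_def inner_axis)
  have "emeasure lebesgue (torus :: (real^'n) set) \<le> emeasure lebesgue (cbox 0 (1 :: real^'n))"
    by (intro emeasure_mono torus_subset_cbox) auto
  moreover have "emeasure lebesgue (box 0 (1 :: real^'n)) \<le> emeasure lebesgue (torus :: (real^'n) set)"
    by (intro emeasure_mono box_subset_torus) auto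
  moreover have "emeasure lebesgue (cbox 0 (1 :: real^'n)) = 1" "emeasure lebesgue (box 0 (1 :: real^'n)) = 1"
    using le one by (auto simp add: emeasure_lborel_cbox_eq emeasure_lborel_box_eq)
  ultimately show ?thesis by simp
qed

interpretation TM: finite_measure "TM :: (real^'n::finite) measure"
  by standard (simp add: emeasure_restrict_space emeasure_torus)

lemma measure_TM [simp]: "measure (TM :: (real^'n::finite) measure) torus = 1"
  by (simp add: measure_def emeasure_restrict_space emeasure_torus)

lemma torus_integral_eq:
  fixes f :: "real^'n::finite \<Rightarrow> real"
  shows "set_lebesgue_integral lebesgue torus f = integral\<^sup>L TM f"
  unfolding set_lebesgue_integral_def by (subst integral_restrict_space) auto

lemma torus_integrable_eq:
  fixes f :: "real^'n::finite \<Rightarrow> real"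
  shows "set_integrable lebesgue torus f \<longleftrightarrow> integrable TM f"
  unfolding set_integrable_def by (subst integrable_restrict_space) auto

lemma measurable_TM: "f \<in> borel_measurable lebesgue \<Longrightarrow> f \<in> borel_measurable TM"
  by (rule measurable_restrict_space1)

lemma continuous_measurable_lebesgue:
  "continuous_on UNIV (f :: real^'n::finite \<Rightarrow> real) \<Longrightarrow> f \<in> borel_measurable lebesgue"
  using borel_measurable_continuous_onI[of f] by (simp add: measurable_completion)

lemma Lq_iff: "f \<in> Lq q \<longleftrightarrow> f \<in> borel_measurable lebesgue \<and> periodic f \<and> integrable TM (\<lambda>x. \<bar>f x\<bar> powr q)"
  by (simp add: Lq_def torus_integrable_eq)

lemma Lq1_iff: "f \<in> Lq 1 \<longleftrightarrow> f \<in> borel_measurable lebesgue \<and> periodic f \<and> integrable TM f"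
proof (cases "f \<in> borel_measurable lebesgue")
  case True
  show ?thesis
    using integrable_norm_iff[OF measurable_TM[OF True]] True by (simp add: Lq_iff)
qed (simp add: Lq_iff)

lemma Lq2_iff: "f \<in> Lq 2 \<longleftrightarrow> f \<in> borel_measurable lebesgue \<and> periodic f \<and> integrable TM (\<lambda>x. (f x)\<^sup>2)"
  by (simp add: Lq_iff)

text \<open>The measure is finite, so the majorant \<open>1 + \<bar>f x\<bar> powr q\<close> is
  integrable.\<close>

lemma Lq_mono:
  assumes "f \<in> Lq q" "0 < p" "p \<le> q" shows "f \<in> Lq p"
proof -
  have f: "f \<in> borel_measurable lebesgue" using assms by (simp add: Lq_iff)
  have [measurable]: "f \<in> borel_measurable TM" by (rule measurable_TM[OF f])
  have "integrable TM (\<lambda>x. \<bar>f x\<bar> powr p)"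
  proof (rule Bochner_Integration.integrable_bound)
    show "integrable TM (\<lambda>x. 1 + \<bar>f x\<bar> powr q)"
      using assms by (auto simp: Lq_iff)
    show "AE x in TM. norm (\<bar>f x\<bar> powr p) \<le> norm (1 + \<bar>f x\<bar> powr q)"
    proof (rule AE_I2)
      fix x
      have "\<bar>f x\<bar> powr p \<le> 1 + \<bar>f x\<bar> powr q"
      proof (cases "\<bar>f x\<bar> \<le> 1")
        case True
        then have "\<bar>f x\<bar> powr p \<le> 1" using assms by (simp add: powr_le1)
        then show ?thesis by (simp add: add_increasing2)
      next
        case False
        then show ?thesis using powr_mono[of p q "\<bar>f x\<bar>"] assms by linarith
      qed
      then show "norm (\<bar>f x\<bar> powr p) \<le> norm (1 + \<bar>f x\<bar> powr q)" by simp
    qed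
  qed measurable
  then show ?thesis using assms by (simp add: Lq_iff)
qed

lemma dapply_dist_of:
  "f \<in> Lq 1 \<Longrightarrow> \<phi> \<in> test_funs \<Longrightarrow> dapply (dist_of f) \<phi> = (\<integral>x. f x * \<phi> x \<partial>TM)"
  by transfer (simp add: torus_integral_eq)

lemma integrable_Lq1_test: "f \<in> Lq 1 \<Longrightarrow> \<phi> \<in> test_funs \<Longrightarrow> integrable TM (\<lambda>x. f x * \<phi> x)"
  using set_integrable_mult_test_fun by (simp add: torus_integrable_eq)

lemma periodic_int_shift:
  assumes "periodic f" shows "f (x + axis i (of_int k)) = f x"
proof -
  have nat: "f (x + axis i (real m)) = f x" for x m
  proof (induction m)
    case (Suc m)
    have "x + axis i (real (Suc m)) = (x + axis i (real m)) + axis i 1"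
      by (simp add: vec_eq_iff axis_def)
    then show ?case using assms Suc unfolding periodic_def by metis
  qed (simp add: axis_def zero_vec_def[symmetric])
  show ?thesis
  proof (cases k)
    case (nonneg m) then show ?thesis by (simp add: nat)
  next
    case (neg m)
    have "x + axis i (of_int k) + axis i (real (Suc m)) = x"
      by (simp add: vec_eq_iff axis_def neg)
    then show ?thesis using nat[of "x + axis i (of_int k)" "Suc m"] by metis
  qed
qed

text \<open>Reduces pointwise claims about periodic functions to the torus; integer shifts are
  undone one coordinate at a time.\<close>

lemma periodic_frac:
  fixes f :: "real^'n::finite \<Rightarrow> 'b"
  assumes "periodic f" shows "f (\<chi> i. frac (x $ i)) = f x"
proof -
  have *: "f (y + (\<Sum>i\<in>I. axis i (of_int (k i)))) = f y" if "finite I" for I y and k :: "'n \<Rightarrow> int"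
    using that
  proof (induction I)
    case (insert i I)
    have "y + (\<Sum>i\<in>insert i I. axis i (of_int (k i))) =
        (y + (\<Sum>i\<in>I. axis i (of_int (k i)))) + axis i (of_int (k i))"
      using insert by (simp add: algebra_simps)
    then show ?case using insert periodic_int_shift[OF assms] by metis
  qed auto
  have "x = (\<chi> i. frac (x $ i)) + (\<Sum>i\<in>UNIV. axis i (of_int \<lfloor>x $ i\<rfloor>))"
    by (simp add: vec_eq_iff axis_def frac_def if_distrib[of "\<lambda>f. f _"] cong: if_cong)
  then show ?thesis using *[of UNIV] by (metis finite)
qed

lemma frac_torus: "(\<chi> i. frac (x $ i)) \<in> torus"
  by (simp add: torus_def frac_lt_1)

lemma periodic_continuous_bounded:
  fixes f :: "real^'n::finite \<Rightarrow> real"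
  assumes "periodic f" "continuous_on UNIV f"
  obtains B where "\<And>x. \<bar>f x\<bar> \<le> B"
proof -
  have "bounded (f ` cbox 0 1)"
    by (intro compact_imp_bounded compact_continuous_image compact_cbox) (metis assms(2) continuous_on_subset subset_UNIV)
  then obtain B where "\<And>x. x \<in> cbox 0 1 \<Longrightarrow> \<bar>f x\<bar> \<le> B" by (auto simp: bounded_iff)
  then have "\<bar>f x\<bar> \<le> B" for x
    using torus_subset_cbox frac_torus[of x] periodic_frac[OF assms(1), of x] by (metis subsetD)
  then show ?thesis using that by blast
qed

lemma test_funs_bounded:
  assumes "\<phi> \<in> test_funs" obtains B where "\<And>x. \<bar>\<phi> x\<bar> \<le> B"
  using periodic_continuous_bounded[OF test_funs_periodic[OF assms] test_funs_continuous[OF assms]] by blast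

lemma integrable_TM_continuous:
  fixes f :: "real^'n::finite \<Rightarrow> real"
  assumes "periodic f" "continuous_on UNIV f" shows "integrable TM f"
proof -
  obtain B where "\<And>x. \<bar>f x\<bar> \<le> B" using periodic_continuous_bounded[OF assms] by blast
  then show ?thesis
    by (intro TM.integrable_const_bound[of _ B] measurable_TM continuous_measurable_lebesgue assms) auto
qed

lemma test_funs_Lq:
  assumes \<phi>: "\<phi> \<in> test_funs" and "q \<ge> 0" shows "\<phi> \<in> Lq q"
proof -
  obtain B where B: "\<And>x. \<bar>\<phi> x\<bar> \<le> B" using test_funs_bounded[OF \<phi>] by blast
  have m: "\<phi> \<in> borel_measurable lebesgue"
    by (intro continuous_measurable_lebesgue test_funs_continuous \<phi>)
  have "integrable TM (\<lambda>x. \<bar>\<phi> x\<bar> powr q)"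
    using B \<open>q \<ge> 0\<close> measurable_TM[OF m]
    by (intro TM.integrable_const_bound[of _ "B powr q"]) (auto intro!: powr_mono2)
  then show ?thesis using m \<phi> by (auto simp: Lq_iff test_funs_periodic)
qed

lemma torus_bounded_integrable_lborel:
  fixes f :: "real^'n::finite \<Rightarrow> real"
  assumes f: "continuous_on UNIV f" and [measurable]: "A \<in> sets borel" and "A \<subseteq> torus"
  shows "integrable lborel (\<lambda>x. indicat_real A x * f x)"
proof -
  have "integrable lborel (\<lambda>x. indicator (cbox 0 1) x *\<^sub>R f x)"
    by (intro borel_integrable_compact continuous_on_subset[OF f]) auto
  from integrable_mult_indicator[OF _ this, of A]
  have "integrable lborel (\<lambda>x. indicator A x *\<^sub>R (indicator (cbox 0 1) x *\<^sub>R f x))" by simp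
  moreover have "(\<lambda>x. indicator A x *\<^sub>R (indicator (cbox 0 1) x *\<^sub>R f x)) = (\<lambda>x. indicat_real A x * f x)"
    using \<open>A \<subseteq> torus\<close> torus_subset_cbox by (auto simp: indicator_def fun_eq_iff)
  ultimately show ?thesis by simp
qed

lemma integral_TM_lborel:
  fixes f :: "real^'n::finite \<Rightarrow> real"
  assumes f: "continuous_on UNIV f"
  shows "(\<integral>x. f x \<partial>TM) = (\<integral>x. indicat_real torus x * f x \<partial>lborel)"
proof -
  have [measurable]: "f \<in> borel_measurable borel" using f by (rule borel_measurable_continuous_onI)
  have "(\<integral>x. f x \<partial>TM) = (\<integral>x. indicat_real torus x * f x \<partial>lebesgue)"
    by (subst integral_restrict_space) auto
  also have "\<dots> = (\<integral>x. indicat_real torus x * f x \<partial>lborel)"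
    by (rule integral_completion) measurable
  finally show ?thesis .
qed

lemma lborel_integral_shift:
  fixes f :: "'a::euclidean_space \<Rightarrow> real"
  assumes [measurable]: "f \<in> borel_measurable borel"
  shows "(\<integral>x. f (x + a) \<partial>lborel) = (\<integral>x. f x \<partial>lborel)"
proof -
  have "(\<integral>x. f x \<partial>lborel) = (\<integral>x. f x \<partial>(distr lborel borel ((+) a)))"
    by (simp add: lborel_distr_plus)
  also have "\<dots> = (\<integral>x. f (a + x) \<partial>lborel)"
    by (rule integral_distr) measurable
  finally show ?thesis by (simp add: add.commute)
qed

lemma lborel_integrable_shift:
  fixes f :: "'a::euclidean_space \<Rightarrow> real"
  assumes f: "integrable lborel f"
  shows "integrable lborel (\<lambda>x. f (x + a))"
proof -
  have [measurable]: "f \<in> borel_measurable borel" using f by auto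
  have "integrable (distr lborel borel ((+) a)) f" using f by (simp add: lborel_distr_plus)
  then have "integrable lborel (\<lambda>x. f (a + x))" by (subst (asm) integrable_distr_eq) auto
  then show ?thesis by (simp add: add.commute)
qed

text \<open>Shifting the half-open cube by \<open>t\<close> moves the slab \<open>B\<close> below
  height \<open>t\<close> out at the top. Moving it back by a full period leaves the periodic
  integrand unchanged, and \<open>A\<close> together with \<open>B\<close> is the cube
  again.\<close>

lemma integral_TM_shift:
  fixes f :: "real^'n::finite \<Rightarrow> real"
  assumes "periodic f" and f: "continuous_on UNIV f" and t: "0 \<le> t" "t \<le> 1"
  shows "(\<integral>x. f (x + axis i t) \<partial>TM) = (\<integral>x. f x \<partial>TM)"
proof -
  have [measurable]: "f \<in> borel_measurable borel" using f by (rule borel_measurable_continuous_onI)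
  define A B :: "(real^'n) set" where "A = torus \<inter> {x. x $ i \<ge> t}" and "B = torus \<inter> {x. x $ i < t}"
  have AB [measurable]: "A \<in> sets borel" "B \<in> sets borel"
    unfolding A_def B_def
    by (intro sets.Int torus_borel borel_closed borel_open closed_Collect_le open_Collect_less continuous_intros)+
  have intA: "integrable lborel (\<lambda>x. indicat_real A x * f x)"
    and intB: "integrable lborel (\<lambda>x. indicat_real B x * f x)"
    by (intro torus_bounded_integrable_lborel f AB; auto simp: A_def B_def)+
  have per: "f (x + axis i (-1)) = f x" for x
    using periodic_int_shift[OF assms(1), of x i "-1"] by simp
  have ax: "axis i t + axis i (- t) = (0 :: real^'n)" by (simp add: vec_eq_iff axis_def)
  have "(\<integral>x. f (x + axis i t) \<partial>TM) = (\<integral>x. indicat_real torus x * f (x + axis i t) \<partial>lborel)"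
    by (intro integral_TM_lborel continuous_on_compose2[OF f] continuous_intros) auto
  also have "\<dots> = (\<integral>x. indicat_real torus ((x + axis i t) + axis i (-t)) * f (x + axis i t) \<partial>lborel)"
    by (simp add: add.assoc ax)
  also have "\<dots> = (\<integral>x. indicat_real torus (x + axis i (-t)) * f x \<partial>lborel)"
    by (rule lborel_integral_shift[where f = "\<lambda>x. indicat_real torus (x + axis i (-t)) * f x"]) measurable
  also have "\<dots> = (\<integral>x. indicat_real A x * f x + indicat_real B (x + axis i (-1)) * f (x + axis i (-1)) \<partial>lborel)"
  proof (rule Bochner_Integration.integral_cong[OF refl])
    fix x :: "real^'n"
    have "indicat_real torus (x + axis i (-t)) = indicat_real A x + indicat_real B (x + axis i (-1))"
    proof (cases "\<forall>k. k \<noteq> i \<longrightarrow> 0 \<le> x $ k \<and> x $ k < 1")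
      case True
      have eq: "(\<forall>k. 0 \<le> (x + axis i s) $ k \<and> (x + axis i s) $ k < 1) \<longleftrightarrow> 0 \<le> x $ i + s \<and> x $ i + s < 1" for s
        using True by (auto simp: axis_def)
      show ?thesis
        using t eq[of "-t"] eq[of 0] eq[of "-1"] by (auto simp: A_def B_def torus_def indicator_def axis_def)
    next
      case False
      then obtain k where k: "k \<noteq> i" "\<not> (0 \<le> x $ k \<and> x $ k < 1)" by blast
      have "x + axis i s \<notin> torus" for s
        using k by (auto simp: torus_def axis_def intro!: exI[of _ k])
      moreover have "x \<notin> torus" using k by (auto simp: torus_def)
      ultimately show ?thesis by (simp add: A_def B_def)
    qed
    then show "indicat_real torus (x + axis i (-t)) * f x =
        indicat_real A x * f x + indicat_real B (x + axis i (-1)) * f (x + axis i (-1))"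
      by (simp add: per distrib_right)
  qed
  also have "\<dots> = (\<integral>x. indicat_real A x * f x \<partial>lborel) +
      (\<integral>x. indicat_real B (x + axis i (-1)) * f (x + axis i (-1)) \<partial>lborel)"
    by (intro Bochner_Integration.integral_add intA lborel_integrable_shift[OF intB])
  also have "(\<integral>x. indicat_real B (x + axis i (-1)) * f (x + axis i (-1)) \<partial>lborel) =
      (\<integral>x. indicat_real B x * f x \<partial>lborel)"
    by (rule lborel_integral_shift[where f = "\<lambda>x. indicat_real B x * f x"]) measurable
  also have "(\<integral>x. indicat_real A x * f x \<partial>lborel) + (\<integral>x. indicat_real B x * f x \<partial>lborel) =
      (\<integral>x. indicat_real A x * f x + indicat_real B x * f x \<partial>lborel)"
    by (intro Bochner_Integration.integral_add[symmetric] intA intB)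
  also have "\<dots> = (\<integral>x. indicat_real torus x * f x \<partial>lborel)"
    by (intro Bochner_Integration.integral_cong) (auto simp: A_def B_def indicator_def)
  also have "\<dots> = (\<integral>x. f x \<partial>TM)"
    by (rule integral_TM_lborel[OF f, symmetric])
  finally show ?thesis .
qed

text \<open>This is integration by parts on the torus. Difference quotients have integral zero by
  shift invariance, are bounded by the supremum of the derivative by the mean value theorem, and
  converge to the derivative.\<close>

lemma integral_TM_partial:
  fixes f :: "real^'n::finite \<Rightarrow> real"
  assumes "periodic f" and diff: "\<And>x. f differentiable (at x)" and cont: "continuous_on UNIV (partial j f)"
  shows "(\<integral>x. partial j f x \<partial>TM) = 0"
proof -
  have contf: "continuous_on UNIV f"
    using diff by (simp add: continuous_at_imp_continuous_on differentiable_imp_continuous_within)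
  obtain B where B: "\<And>x. \<bar>partial j f x\<bar> \<le> B"
    using periodic_continuous_bounded[OF partial_periodic[OF diff \<open>periodic f\<close>] cont] by blast
  have line: "((\<lambda>s. f (x + axis j s)) has_real_derivative partial j f (x + axis j s)) (at s)" for x s
  proof -
    have f': "(f has_derivative frechet_derivative f (at (x + axis j s))) (at (x + axis j s))"
      using diff frechet_derivative_works by blast
    define e :: "real^'n" where "e = axis j 1"
    have ax: "axis j s = s *\<^sub>R e" for s by (simp add: vec_eq_iff axis_def e_def)
    have "((\<lambda>s. x + s *\<^sub>R e) has_derivative (\<lambda>h. h *\<^sub>R e)) (at s)"
      by (auto intro!: derivative_eq_intros)
    from diff_chain_at[OF this f'[unfolded ax]]
    have "((\<lambda>s. f (x + axis j s)) has_derivative (\<lambda>h. frechet_derivative f (at (x + axis j s)) (h *\<^sub>R e))) (at s)"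
      by (simp add: o_def ax)
    moreover have "(\<lambda>h. frechet_derivative f (at (x + axis j s)) (h *\<^sub>R e)) = (*) (partial j f (x + axis j s))"
      using linear_frechet_derivative[OF diff, of "x + axis j s"]
      by (simp add: fun_eq_iff partial_def linear_cmul e_def)
    ultimately show ?thesis by (simp add: has_field_derivative_def)
  qed
  \<comment> \<open>Step sizes in the range covered by \<open>integral_TM_shift\<close>.\<close>
  define t where "t n = inverse (real (Suc n))" for n
  have t: "0 < t n" "t n \<le> 1" for n by (auto simp: t_def field_simps)
  have t0: "t \<longlonglongrightarrow> 0" unfolding t_def by (rule LIMSEQ_inverse_real_of_nat)
  let ?q = "\<lambda>n x. (f (x + axis j (t n)) - f x) / t n"
  have cont_shift: "continuous_on UNIV (\<lambda>x. f (x + axis j s))" for s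
    by (intro continuous_on_compose2[OF contf] continuous_intros) auto
  have per_shift: "periodic (\<lambda>x. f (x + axis j s))" for s
  proof -
    have "x + axis i 1 + axis j s = (x + axis j s) + axis i 1" for x i by (simp add: algebra_simps)
    then show ?thesis using \<open>periodic f\<close> unfolding periodic_def by metis
  qed
  have zero: "(\<integral>x. ?q n x \<partial>TM) = 0" for n
    using t[of n] by (simp add: Bochner_Integration.integral_diff integrable_TM_continuous assms(1) contf
        cont_shift per_shift integral_TM_shift)
  have "(\<lambda>n. \<integral>x. ?q n x \<partial>TM) \<longlonglongrightarrow> (\<integral>x. partial j f x \<partial>TM)"
  proof (rule integral_dominated_convergence[where w = "\<lambda>x. B"])
    show "partial j f \<in> borel_measurable TM"
      by (intro measurable_TM continuous_measurable_lebesgue cont)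
    show "?q n \<in> borel_measurable TM" for n
      using t[of n] by (intro measurable_TM continuous_measurable_lebesgue continuous_intros cont_shift contf) auto
    have "(\<lambda>n. ?q n x) \<longlonglongrightarrow> partial j f x" for x
    proof -
      have "((\<lambda>h. (f (x + axis j (0 + h)) - f (x + axis j 0)) / h) \<longlongrightarrow> partial j f (x + axis j 0)) (at 0)"
        using line[of x 0] unfolding DERIV_def .
      moreover have "filterlim t (at 0) sequentially"
        using t0 t by (auto simp: filterlim_at intro!: eventuallyI) (metis less_irrefl)
      moreover have "axis j 0 = (0 :: real^'n)" by (simp add: vec_eq_iff axis_def)
      ultimately show ?thesis by (auto dest: filterlim_compose)
    qed
    then show "AE x in TM. (\<lambda>n. ?q n x) \<longlonglongrightarrow> partial j f x" by simp
    have "\<bar>?q n x\<bar> \<le> B" for n x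
    proof -
      have "\<exists>z. 0 < z \<and> z < t n \<and> f (x + axis j (t n)) - f (x + axis j 0) = (t n - 0) * partial j f (x + axis j z)"
        by (rule MVT2) (use t line in auto)
      then obtain z where "f (x + axis j (t n)) - f (x + axis j 0) = (t n - 0) * partial j f (x + axis j z)" by blast
      moreover have "axis j 0 = (0 :: real^'n)" by (simp add: vec_eq_iff axis_def)
      ultimately have "?q n x = partial j f (x + axis j z)" using t[of n] by simp
      then show ?thesis using B by simp
    qed
    then show "AE x in TM. norm (?q n x) \<le> B" for n by simp
  qed simp
  then show ?thesis unfolding zero by (simp add: LIMSEQ_const_iff)
qed

lemma integral_cos_phase: "(\<integral>x. cos (phase \<xi> x) \<partial>TM) = (if \<xi> = 0 then 1 else 0)"
proof (cases "\<xi> = 0")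
  case False
  then obtain j where j: "\<xi> $ j \<noteq> 0" by (auto simp: vec_eq_iff)
  have "(\<integral>x. partial j (\<lambda>x. sin (phase \<xi> x)) x \<partial>TM) = 0"
    by (intro integral_TM_partial test_funs_periodic test_funs_differentiable test_funs_continuous
        test_funs_partial) auto
  then show ?thesis using j False by (simp add: partial_sin_phase)
qed simp

lemma integral_sin_phase: "(\<integral>x. sin (phase \<xi> x) \<partial>TM) = 0"
proof (cases "\<xi> = 0")
  case False
  then obtain j where j: "\<xi> $ j \<noteq> 0" by (auto simp: vec_eq_iff)
  have "(\<integral>x. partial j (\<lambda>x. cos (phase \<xi> x)) x \<partial>TM) = 0"
    by (intro integral_TM_partial test_funs_periodic test_funs_differentiable test_funs_continuous
        test_funs_partial) auto
  then show ?thesis using j False by (simp add: partial_cos_phase)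
qed simp

lemma integrable_test: "\<phi> \<in> test_funs \<Longrightarrow> integrable TM \<phi>"
  by (intro integrable_TM_continuous test_funs_periodic test_funs_continuous)

text \<open>A real mode at \<open>\<xi>\<close> overlaps with those at \<open>\<xi>\<close> and
  \<open>- \<xi>\<close>, with weight one half each. Symmetry of \<open>F\<close> and the hermitian
  relation merge the two halves into \<open>c \<xi>\<close>.\<close>

lemma fourier_trig_poly:
  fixes c :: "int^'n::finite \<Rightarrow> complex"
  assumes "finite F" and sym: "\<And>\<xi>. \<xi> \<in> F \<Longrightarrow> - \<xi> \<in> F" and herm: "\<And>\<xi>. c (- \<xi>) = cnj (c \<xi>)"
  shows "fourier (dist_of (trig_poly F c)) \<xi> = (if \<xi> \<in> F then c \<xi> else 0)"
proof -
  have L: "trig_poly F c \<in> Lq 1" by (intro test_funs_Lq) auto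
  have cc: "(\<integral>x. cos (phase \<eta> x) * cos (phase \<xi> x) \<partial>TM) = (1/2) * (of_bool (\<eta> = \<xi>) + of_bool (\<eta> = - \<xi>))" for \<eta> \<xi> :: "int^'n"
  proof -
    have "(\<integral>x. cos (phase \<eta> x) * cos (phase \<xi> x) \<partial>TM) =
        (\<integral>x. (1/2) * (cos (phase (\<eta> - \<xi>) x) + cos (phase (\<eta> + \<xi>) x)) \<partial>TM)"
      by (simp add: cos_times_cos phase_add_left phase_diff_left)
    also have "\<dots> = (1/2) * ((\<integral>x. cos (phase (\<eta> - \<xi>) x) \<partial>TM) + (\<integral>x. cos (phase (\<eta> + \<xi>) x) \<partial>TM))"
      by (simp add: integrable_test)
    finally show ?thesis by (simp add: integral_cos_phase eq_neg_iff_add_eq_0)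
  qed
  have ss: "(\<integral>x. sin (phase \<eta> x) * sin (phase \<xi> x) \<partial>TM) = (1/2) * (of_bool (\<eta> = \<xi>) - of_bool (\<eta> = - \<xi>))" for \<eta> \<xi> :: "int^'n"
  proof -
    have "(\<integral>x. sin (phase \<eta> x) * sin (phase \<xi> x) \<partial>TM) =
        (\<integral>x. (1/2) * (cos (phase (\<eta> - \<xi>) x) - cos (phase (\<eta> + \<xi>) x)) \<partial>TM)"
      by (simp add: sin_times_sin phase_add_left phase_diff_left)
    also have "\<dots> = (1/2) * ((\<integral>x. cos (phase (\<eta> - \<xi>) x) \<partial>TM) - (\<integral>x. cos (phase (\<eta> + \<xi>) x) \<partial>TM))"
      by (simp add: integrable_test)
    finally show ?thesis by (simp add: integral_cos_phase eq_neg_iff_add_eq_0)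
  qed
  have sc: "(\<integral>x. sin (phase \<eta> x) * cos (phase \<xi> x) \<partial>TM) = 0" for \<eta> \<xi> :: "int^'n"
  proof -
    have "(\<integral>x. sin (phase \<eta> x) * cos (phase \<xi> x) \<partial>TM) =
        (\<integral>x. (1/2) * (sin (phase (\<eta> + \<xi>) x) + sin (phase (\<eta> - \<xi>) x)) \<partial>TM)"
      by (simp add: sin_times_cos phase_add_left phase_diff_left)
    also have "\<dots> = (1/2) * ((\<integral>x. sin (phase (\<eta> + \<xi>) x) \<partial>TM) + (\<integral>x. sin (phase (\<eta> - \<xi>) x) \<partial>TM))"
      by (simp add: integrable_test)
    finally show ?thesis by (simp add: integral_sin_phase)
  qed
  have Lt: "\<phi> \<in> Lq 1" if "\<phi> \<in> test_funs" for \<phi> :: "real^'n \<Rightarrow> real" using that by (intro test_funs_Lq) auto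
  note [simp] = integrable_Lq1_test[OF Lt]
  have tp: "(\<integral>x. trig_poly F c x * \<phi> x \<partial>TM) = (\<Sum>\<eta>\<in>F. Re (c \<eta>) * (\<integral>x. cos (phase \<eta> x) * \<phi> x \<partial>TM)
      - Im (c \<eta>) * (\<integral>x. sin (phase \<eta> x) * \<phi> x \<partial>TM))" if \<phi>: "\<phi> \<in> test_funs" for \<phi>
  proof -
    have "(\<lambda>x. trig_poly F c x * \<phi> x) = (\<lambda>x. \<Sum>\<eta>\<in>F. Re (c \<eta>) * (cos (phase \<eta> x) * \<phi> x)
        - Im (c \<eta>) * (sin (phase \<eta> x) * \<phi> x))"
      by (simp add: trig_poly_def sum_distrib_right left_diff_distrib mult.assoc)
    then show ?thesis using \<phi> by (simp add: Bochner_Integration.integral_sum)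
  qed
  have sumF: "(\<Sum>\<eta>\<in>F. g \<eta> * of_bool (\<eta> = \<zeta>)) = (if \<zeta> \<in> F then g \<zeta> else 0)" for g :: "int^'n \<Rightarrow> real" and \<zeta>
    using \<open>finite F\<close> by (simp add: of_bool_def if_distrib[of "\<lambda>x. _ * x"] cong: if_cong)
  have mem: "- \<xi> \<in> F \<longleftrightarrow> \<xi> \<in> F" using sym by fastforce
  have cs: "(\<integral>x. cos (phase \<eta> x) * sin (phase \<xi> x) \<partial>TM) = 0" for \<eta> \<xi> :: "int^'n"
    using sc[of \<xi> \<eta>] by (simp add: mult.commute)
  have "(\<integral>x. trig_poly F c x * cos (phase \<xi> x) \<partial>TM) =
      (1/2) * ((\<Sum>\<eta>\<in>F. Re (c \<eta>) * of_bool (\<eta> = \<xi>)) + (\<Sum>\<eta>\<in>F. Re (c \<eta>) * of_bool (\<eta> = - \<xi>)))"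
    unfolding tp[OF cos_phase_test] cc sc sum.distrib[symmetric] sum_distrib_left
    by (intro sum.cong) (simp_all add: algebra_simps)
  also have "\<dots> = (if \<xi> \<in> F then Re (c \<xi>) else 0)"
    by (simp only: sumF mem) (simp add: herm)
  finally have 1: "(\<integral>x. trig_poly F c x * cos (phase \<xi> x) \<partial>TM) = (if \<xi> \<in> F then Re (c \<xi>) else 0)" .
  have "(\<integral>x. trig_poly F c x * sin (phase \<xi> x) \<partial>TM) =
      - (1/2) * ((\<Sum>\<eta>\<in>F. Im (c \<eta>) * of_bool (\<eta> = \<xi>)) - (\<Sum>\<eta>\<in>F. Im (c \<eta>) * of_bool (\<eta> = - \<xi>)))"
    unfolding tp[OF sin_phase_test] ss cs sum_subtractf[symmetric] sum_distrib_left
    by (intro sum.cong) (simp_all add: algebra_simps)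
  also have "\<dots> = (if \<xi> \<in> F then - Im (c \<xi>) else 0)"
    by (simp only: sumF mem) (simp add: herm)
  finally have 2: "(\<integral>x. trig_poly F c x * sin (phase \<xi> x) \<partial>TM) = (if \<xi> \<in> F then - Im (c \<xi>) else 0)" .
  show ?thesis
    by (simp add: fourier_def dapply_dist_of L 1 2 complex_eq_iff)
qed

text \<open>The product rule integrated over the torus: classical and distributional derivatives
  agree on test functions.\<close>

lemma dist_of_partial:
  assumes "\<phi> \<in> test_funs" shows "dist_of (partial j \<phi>) = ddiff j (dist_of \<phi>)"
proof (rule pdist_eqI)
  fix \<psi> :: "real^'a \<Rightarrow> real" assume \<psi>: "\<psi> \<in> test_funs"
  have L: "\<phi> \<in> Lq 1" "partial j \<phi> \<in> Lq 1" using assms by (auto intro!: test_funs_Lq test_funs_partial)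
  have prod: "((\<lambda>x. \<phi> x * \<psi> x) has_derivative (\<lambda>h. \<phi> x * frechet_derivative \<psi> (at x) h +
      frechet_derivative \<phi> (at x) h * \<psi> x)) (at x)" for x
    using test_funs_differentiable[OF assms] test_funs_differentiable[OF \<psi>]
    by (intro has_derivative_mult) (auto simp: frechet_derivative_works[symmetric])
  have p: "partial j (\<lambda>x. \<phi> x * \<psi> x) = (\<lambda>x. \<phi> x * partial j \<psi> x + partial j \<phi> x * \<psi> x)"
    by (subst partial_eqI[OF prod]) (simp add: partial_def)
  have "(\<integral>x. partial j (\<lambda>x. \<phi> x * \<psi> x) x \<partial>TM) = 0"
  proof (rule integral_TM_partial)
    show "periodic (\<lambda>x. \<phi> x * \<psi> x)"
      using test_funs_periodic[OF assms] test_funs_periodic[OF \<psi>] by (simp add: periodic_def)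
    show "(\<lambda>x. \<phi> x * \<psi> x) differentiable (at x)" for x
      using prod differentiable_def by blast
    show "continuous_on UNIV (partial j (\<lambda>x. \<phi> x * \<psi> x))"
      unfolding p by (intro continuous_intros test_funs_continuous test_funs_partial assms \<psi>)
  qed
  then have "(\<integral>x. \<phi> x * partial j \<psi> x \<partial>TM) + (\<integral>x. partial j \<phi> x * \<psi> x \<partial>TM) = 0"
    unfolding p using L \<psi> by (subst (asm) Bochner_Integration.integral_add)
      (auto intro!: integrable_Lq1_test test_funs_partial)
  then show "dapply (dist_of (partial j \<phi>)) \<psi> = dapply (ddiff j (dist_of \<phi>)) \<psi>"
    using L \<psi> by (simp add: dapply_dist_of dapply_ddiff test_funs_partial)
qed

section \<open>Integrable functions with vanishing Fourier coefficients\<close>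

text \<open>The torus as a compact subset of a Euclidean space, where the theorem of Stone and Weierstrass
  is available.\<close>

definition torus_map :: "real^'n \<Rightarrow> complex^'n" where
  "torus_map x = (\<chi> i. cis (2 * pi * x $ i))"

lemma torus_map_continuous: "continuous_on S torus_map"
  unfolding torus_map_def[abs_def] by (intro continuous_intros)

lemma torus_map_inj: "inj_on torus_map torus"
proof (rule inj_onI)
  fix x y :: "real^'n" assume x: "x \<in> torus" and y: "y \<in> torus" and eq: "torus_map x = torus_map y"
  show "x = y"
  proof (simp add: vec_eq_iff, rule)
    fix i
    have "cis (2 * pi * x $ i) = cis (2 * pi * y $ i)"
      using arg_cong[OF eq, of "\<lambda>z. z $ i"] by (simp add: torus_map_def)
    then have "cis (2 * pi * (x $ i - y $ i)) = 1"
      by (simp add: cis_divide[symmetric] right_diff_distrib)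
    then have "cos (2 * pi * (x $ i - y $ i)) = 1" by (simp add: complex_eq_iff)
    then obtain k :: int where "2 * pi * (x $ i - y $ i) = of_int k * (2 * pi)"
      by (auto simp: cos_one_2pi_int)
    then have k: "x $ i - y $ i = of_int k" by simp
    moreover have "\<bar>x $ i - y $ i\<bar> < 1" using x y by (auto simp: torus_def abs_if) (smt (verit))+
    ultimately have "k = 0" by linarith
    then show "x $ i = y $ i" using k by simp
  qed
qed

lemma phase_axis_left: "phase (axis i 1) x = 2 * pi * x $ i"
proof -
  have "(\<Sum>k\<in>UNIV. x $ k * real_of_int (axis i 1 $ k)) = (\<Sum>k\<in>UNIV. if k = i then x $ i else 0)"
    by (intro sum.cong) (auto simp: axis_def)
  then show ?thesis by (simp add: phase_def)
qed

text \<open>A real-linear functional of the embedded point is a combination of cosines and sines of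
  single coordinates; sums and products stay in \<open>trig\<close>.\<close>

lemma polynomial_torus_map_trig:
  assumes "real_polynomial_function p" shows "(\<lambda>x :: real^'n::finite. p (torus_map x)) \<in> trig"
  using assms
proof induction
  case (linear L)
  have exp: "torus_map x = (\<Sum>i\<in>UNIV. cos (2 * pi * x $ i) *\<^sub>R axis i 1 + sin (2 * pi * x $ i) *\<^sub>R axis i \<i>)"
    for x :: "real^'n"
    by (simp add: vec_eq_iff torus_map_def axis_def if_distrib[of "\<lambda>y. _ *\<^sub>R y"] if_distrib[of "\<lambda>y. y $ _"]
        sum.distrib complex_eq_iff cong: if_cong)
  have "linear L" using linear by (simp add: bounded_linear.linear)
  then have "L (torus_map x) = (\<Sum>i\<in>UNIV. L (axis i 1) * cos (phase (axis i 1) x) + L (axis i \<i>) * sin (phase (axis i 1) x))"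
    for x :: "real^'n"
    by (simp add: exp phase_axis_left linear_sum linear_add linear_cmul mult.commute)
  moreover have "(\<lambda>x :: real^'n. \<Sum>i\<in>UNIV. L (axis i 1) * cos (phase (axis i 1) x) + L (axis i \<i>) * sin (phase (axis i 1) x)) \<in> trig"
    by (intro trig_sum trig.intros)
  ultimately show ?case by simp
qed (auto intro: trig_const trig_add trig_mult)

lemma integral_zero_trig:
  assumes h: "h \<in> Lq 1" and F: "\<And>\<xi>. fourier (dist_of h) \<xi> = 0" and "f \<in> trig"
  shows "(\<integral>x. h x * f x \<partial>TM) = 0"
  using \<open>f \<in> trig\<close>
proof induction
  case (trig_cos c \<xi>)
  have "dapply (dist_of h) (\<lambda>x. cos (phase \<xi> x)) = 0" using F[of \<xi>] by (simp add: fourier_def complex_eq_iff)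
  then have "(\<integral>x. h x * cos (phase \<xi> x) \<partial>TM) = 0" using h by (simp add: dapply_dist_of)
  then show ?case by (simp add: mult.left_commute)
next
  case (trig_sin c \<xi>)
  have "dapply (dist_of h) (\<lambda>x. sin (phase \<xi> x)) = 0" using F[of \<xi>] by (simp add: fourier_def complex_eq_iff)
  then have "(\<integral>x. h x * sin (phase \<xi> x) \<partial>TM) = 0" using h by (simp add: dapply_dist_of)
  then show ?case by (simp add: mult.left_commute)
next
  case (trig_add f g)
  then show ?case using h by (simp add: distrib_left integrable_Lq1_test trig_test_funs)
qed

lemma torus_map_periodic: "torus_map (x + axis i 1) = torus_map x"
  by (auto simp: torus_map_def vec_eq_iff axis_def distrib_left cis_mult[symmetric])

lemma integrable_mult_bounded:
  fixes h f :: "'a \<Rightarrow> real"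
  assumes "integrable M h" "f \<in> borel_measurable M" "\<And>x. \<bar>f x\<bar> \<le> B"
  shows "integrable M (\<lambda>x. h x * f x)"
proof (rule Bochner_Integration.integrable_bound)
  show "integrable M (\<lambda>x. B * h x)" using assms by simp
  show "AE x in M. norm (h x * f x) \<le> norm (B * h x)"
  proof (rule AE_I2)
    fix x
    have "\<bar>f x\<bar> \<le> \<bar>B\<bar>" using assms(3)[of x] by linarith
    then show "norm (h x * f x) \<le> norm (B * h x)"
      by (simp add: abs_mult mult.commute[of "\<bar>h x\<bar>"] mult_right_mono)
  qed
qed (use assms in measurable)

text \<open>On the compact image of the cube \<open>g\<close> is uniformly close to a polynomial,
  which pulls back to an element of \<open>trig\<close> and is annihilated by \<open>h\<close>. The
  error is at most the uniform distance times the L1 norm of \<open>h\<close>.\<close>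

lemma integral_zero_continuous:
  fixes g :: "complex^'n::finite \<Rightarrow> real"
  assumes h: "h \<in> Lq 1" and F: "\<And>\<xi>. fourier (dist_of h) \<xi> = 0" and g: "continuous_on UNIV g"
  shows "(\<integral>x. h x * g (torus_map x) \<partial>TM) = 0"
proof -
  let ?S = "torus_map ` cbox (0 :: real^'n) 1"
  have S: "compact ?S" by (intro compact_continuous_image torus_map_continuous compact_cbox)
  have int: "integrable TM h" using h by (simp add: Lq1_iff)
  have cont: "continuous_on UNIV (\<lambda>x. g (torus_map x))"
    by (intro continuous_on_compose2[OF g] torus_map_continuous) auto
  have per: "periodic (\<lambda>x :: real^'n. g (torus_map x))" by (simp add: periodic_def torus_map_periodic)
  have hg: "integrable TM (\<lambda>x. h x * g (torus_map x))"
    using periodic_continuous_bounded[OF per cont]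
    by (metis integrable_mult_bounded[OF int measurable_TM[OF continuous_measurable_lebesgue[OF cont]]])
  have "\<bar>\<integral>x. h x * g (torus_map x) \<partial>TM\<bar> \<le> e * (\<integral>x. \<bar>h x\<bar> \<partial>TM)" if "e > 0" for e
  proof -
    obtain p where p: "real_polynomial_function p" "\<And>x. x \<in> ?S \<Longrightarrow> \<bar>g x - p x\<bar> < e"
      using Stone_Weierstrass_real_polynomial_function[OF S continuous_on_subset[OF g] \<open>e > 0\<close>] by blast
    have tr: "(\<lambda>x. p (torus_map x)) \<in> trig" by (rule polynomial_torus_map_trig[OF p(1)])
    have hp: "integrable TM (\<lambda>x. h x * p (torus_map x))"
      by (intro integrable_Lq1_test h trig_test_funs tr)
    have "(\<integral>x. h x * g (torus_map x) \<partial>TM) = (\<integral>x. h x * g (torus_map x) - h x * p (torus_map x) \<partial>TM)"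
      using integral_zero_trig[OF h F tr] hg hp by simp
    also have "\<bar>\<dots>\<bar> \<le> (\<integral>x. \<bar>h x * g (torus_map x) - h x * p (torus_map x)\<bar> \<partial>TM)"
      by (rule integral_abs_bound)
    also have "\<dots> \<le> (\<integral>x. e * \<bar>h x\<bar> \<partial>TM)"
    proof (rule integral_mono)
      show "integrable TM (\<lambda>x. \<bar>h x * g (torus_map x) - h x * p (torus_map x)\<bar>)" using hg hp by simp
      show "integrable TM (\<lambda>x. e * \<bar>h x\<bar>)" using int by simp
      fix x :: "real^'n" assume "x \<in> space TM"
      then have "\<bar>g (torus_map x) - p (torus_map x)\<bar> \<le> e"
        using p(2)[of "torus_map x"] torus_subset_cbox by auto
      then have "\<bar>h x\<bar> * \<bar>g (torus_map x) - p (torus_map x)\<bar> \<le> \<bar>h x\<bar> * e" by (intro mult_left_mono) auto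
      then show "\<bar>h x * g (torus_map x) - h x * p (torus_map x)\<bar> \<le> e * \<bar>h x\<bar>"
        by (simp add: right_diff_distrib[symmetric] abs_mult mult.commute)
    qed
    finally show ?thesis by simp
  qed
  from this[THEN order_trans] have *: "\<bar>\<integral>x. h x * g (torus_map x) \<partial>TM\<bar> \<le> 0 + \<epsilon>" if "\<epsilon> > 0" for \<epsilon>
  proof -
    let ?I = "\<integral>x. \<bar>h x\<bar> \<partial>TM"
    have "?I \<ge> 0" by simp
    then have "?I / (?I + 1) \<le> 1"
      using divide_le_eq_1_pos[of "?I + 1" ?I] by linarith
    \<comment> \<open>The added 1 covers the case that the L1 norm vanishes.\<close>
    then have "\<epsilon> / (?I + 1) * ?I \<le> \<epsilon>"
      using that mult_left_mono[of "?I / (?I + 1)" 1 \<epsilon>] by simp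
    then show ?thesis
      using \<open>\<And>e. 0 < e \<Longrightarrow> \<bar>\<integral>x. h x * g (torus_map x) \<partial>TM\<bar> \<le> e * (\<integral>x. \<bar>h x\<bar> \<partial>TM)\<close>[of "\<epsilon> / (?I + 1)"] that \<open>?I \<ge> 0\<close>
      by (smt (verit) divide_pos_pos)
  qed
  have "\<bar>\<integral>x. h x * g (torus_map x) \<partial>TM\<bar> \<le> 0" by (rule field_le_epsilon) (rule *)
  then show ?thesis by simp
qed

text \<open>Tent functions of the distance to the image of \<open>K\<close> decrease to its
  indicator. On the half-open torus \<open>torus_map\<close> is injective, so a point outside
  \<open>K\<close> has an image at positive distance and the tents vanish there eventually.\<close>

lemma integral_zero_compact:
  fixes h :: "real^'n::finite \<Rightarrow> real"
  assumes h: "h \<in> Lq 1" and F: "\<And>\<xi>. fourier (dist_of h) \<xi> = 0" and K: "compact K" "K \<subseteq> torus"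
  shows "(\<integral>x. h x * indicator K x \<partial>TM) = 0"
proof (cases "K = {}")
  case False
  let ?C = "torus_map ` K"
  have C: "closed ?C" "?C \<noteq> {}"
    using compact_imp_closed[OF compact_continuous_image[OF torus_map_continuous K(1)]] False by auto
  define g where "g n z = max 0 (1 - real n * infdist z ?C)" for n and z :: "complex^'n"
  have g: "continuous_on UNIV (g n)" for n
    unfolding g_def[abs_def] by (intro continuous_intros)
  have int: "integrable TM h" using h by (simp add: Lq1_iff)
  have cont: "continuous_on UNIV (\<lambda>x. g n (torus_map x))" for n
    by (intro continuous_on_compose2[OF g] torus_map_continuous) auto
  have "(\<lambda>n. \<integral>x. h x * g n (torus_map x) \<partial>TM) \<longlonglongrightarrow> (\<integral>x. h x * indicator K x \<partial>TM)"
  proof (rule integral_dominated_convergence[where w = "\<lambda>x. \<bar>h x\<bar>"])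
    show "(\<lambda>x. h x * indicator K x) \<in> borel_measurable TM"
      using int K by (auto intro!: borel_measurable_times borel_measurable_indicator simp: sets_restrict_space_iff lmeasurable_compact fmeasurableD)
    show "(\<lambda>x. h x * g n (torus_map x)) \<in> borel_measurable TM" for n
      by (rule borel_measurable_times[OF borel_measurable_integrable[OF int]
          measurable_TM[OF continuous_measurable_lebesgue[OF cont]]])
    have "(\<lambda>n. g n (torus_map x)) \<longlonglongrightarrow> indicator K x" if "x \<in> torus" for x
    proof (cases "x \<in> K")
      case True
      then show ?thesis by (simp add: g_def)
    next
      case False
      then have "torus_map x \<notin> ?C"
        using K(2) that torus_map_inj by (metis inj_on_image_mem_iff)
      then have d: "infdist (torus_map x) ?C > 0"
        using C by (metis in_closed_iff_infdist_zero infdist_nonneg order_less_le)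
      have "eventually (\<lambda>n. g n (torus_map x) = 0) sequentially"
      proof -
        obtain N :: nat where N: "1 / infdist (torus_map x) ?C < real N" using reals_Archimedean2 by blast
        have "g n (torus_map x) = 0" if "n \<ge> N" for n
        proof -
          have "1 < real N * infdist (torus_map x) ?C" using N d by (simp add: field_simps)
          also have "\<dots> \<le> real n * infdist (torus_map x) ?C" using that d by (intro mult_right_mono) auto
          finally show ?thesis by (simp add: g_def)
        qed
        then show ?thesis by (auto simp: eventually_sequentially)
      qed
      then show ?thesis using False by (simp add: tendsto_eventually)
    qed
    then show "AE x in TM. (\<lambda>n. h x * g n (torus_map x)) \<longlonglongrightarrow> h x * indicator K x"
      by (intro AE_I2 tendsto_mult) auto
    show "AE x in TM. norm (h x * g n (torus_map x)) \<le> \<bar>h x\<bar>" for n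
    proof (rule AE_I2)
      fix x
      have "\<bar>g n (torus_map x)\<bar> \<le> 1" by (simp add: g_def infdist_nonneg)
      then show "norm (h x * g n (torus_map x)) \<le> \<bar>h x\<bar>"
        by (simp add: abs_mult mult_left_le)
    qed
  qed (use int in simp)
  then show ?thesis
    unfolding integral_zero_continuous[OF h F g] by (simp add: LIMSEQ_const_iff)
qed simp

text \<open>Otherwise the set \<open>h > 0\<close> contains a compact set of positive measure, whose indicator is a
  bounded pointwise limit of continuous functions on the torus.\<close>

lemma fourier_zero_nonpos:
  fixes h :: "real^'n::finite \<Rightarrow> real"
  assumes h: "h \<in> Lq 1" and F: "\<And>\<xi>. fourier (dist_of h) \<xi> = 0"
  shows "AE x in TM. h x \<le> 0"
proof -
  have hm: "h \<in> borel_measurable lebesgue" using h by (simp add: Lq1_iff)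
  have int: "integrable TM h" using h by (simp add: Lq1_iff)
  define S where "S = {x \<in> torus. h x > 0}"
  have S: "S \<in> sets lebesgue"
  proof -
    have "S = torus \<inter> {x \<in> space lebesgue. h x > 0}" by (auto simp: S_def)
    also have "\<dots> \<in> sets lebesgue"
      using hm by (intro sets.Int torus_lebesgue) measurable
    finally show ?thesis .
  qed
  have "emeasure lebesgue S = 0"
  proof (rule ccontr)
    assume "emeasure lebesgue S \<noteq> 0"
    moreover have "emeasure lebesgue S \<le> emeasure lebesgue (torus :: (real^'n) set)"
      by (intro emeasure_mono) (auto simp: S_def)
    ultimately obtain e where e: "emeasure lebesgue S = ennreal e" "e > 0"
      unfolding emeasure_torus by (cases "emeasure lebesgue S") (auto simp: top_unique zero_less_iff_neq_zero)
    obtain K where K: "closed K" "K \<subseteq> S" "emeasure lebesgue (S - K) < ennreal e"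
      using sets_lebesgue_inner_closed[OF S \<open>e > 0\<close>] by metis
    have "bounded K" using K(2) torus_subset_cbox bounded_cbox by (metis (no_types, lifting) S_def bounded_subset mem_Collect_eq subsetI subset_trans)
    then have "compact K" using K(1) by (simp add: compact_eq_bounded_closed)
    have KT: "K \<subseteq> torus" using K(2) by (auto simp: S_def)
    have Km: "K \<in> sets lebesgue" using K(1) by auto
    have KTm: "K \<in> sets TM" using Km KT by (simp add: sets_restrict_space_iff)
    have "(\<integral>x. h x * indicator K x \<partial>TM) = 0"
      by (rule integral_zero_compact[OF h F \<open>compact K\<close> KT])
    moreover have "integrable TM (\<lambda>x. h x * indicator K x)"
      using KTm int by (rule integrable_real_mult_indicator)
    moreover have "AE x in TM. 0 \<le> h x * indicator K x"
      using K(2) by (intro AE_I2) (auto simp: S_def indicator_def)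
    ultimately have "AE x in TM. h x * indicator K x = 0"
      by (simp add: integral_nonneg_eq_0_iff_AE)
    then have "AE x in TM. x \<notin> K"
      by eventually_elim (use K(2) in \<open>auto simp: S_def indicator_def\<close>)
    then have "emeasure TM K = 0"
      using AE_iff_null_sets[OF KTm] by (simp add: null_setsD1)
    then have "emeasure lebesgue K = 0" using KT Km by (simp add: emeasure_restrict_space)
    \<comment> \<open>A null \<open>K\<close> would leave the whole mass of \<open>S\<close> in
      \<open>S - K\<close>, against the choice of \<open>K\<close>.\<close>
    then have "emeasure lebesgue S \<le> emeasure lebesgue (S - K)"
      using emeasure_subadditive[of K lebesgue "S - K"] S Km K(2)
      by (simp add: Un_absorb1)
    then show False using K(3) e by simp
  qed
  then have "AE x in lebesgue. x \<notin> S" using AE_iff_null_sets[OF S] null_setsI[OF _ S] by simp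
  then show ?thesis
    by (subst AE_restrict_space_iff) (auto simp: S_def not_less)
qed

lemma Lq1_scale: "h \<in> Lq 1 \<Longrightarrow> (\<lambda>x. c * h x) \<in> Lq 1"
  by (auto simp: Lq1_iff periodic_def intro: borel_measurable_times)

lemma Lq1_add: "h \<in> Lq 1 \<Longrightarrow> k \<in> Lq 1 \<Longrightarrow> (\<lambda>x. h x + k x) \<in> Lq 1"
  by (auto simp: Lq1_iff periodic_def intro: borel_measurable_add)

lemma dist_of_scale: "h \<in> Lq 1 \<Longrightarrow> dist_of (\<lambda>x. c * h x) = c *\<^sub>R dist_of h"
  by (rule pdist_eqI) (simp add: dapply_dist_of Lq1_scale mult.assoc)

lemma dist_of_add: "h \<in> Lq 1 \<Longrightarrow> k \<in> Lq 1 \<Longrightarrow> dist_of (\<lambda>x. h x + k x) = dist_of h + dist_of k"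
  by (rule pdist_eqI) (simp add: dapply_dist_of Lq1_add distrib_right integrable_Lq1_test)

text \<open>The one-sided result applied to \<open>h\<close> and to its negative. It is the reason
  why L2 representatives are unique up to null sets.\<close>

theorem fourier_zero_AE:
  fixes h :: "real^'n::finite \<Rightarrow> real"
  assumes h: "h \<in> Lq 1" and F: "\<And>\<xi>. fourier (dist_of h) \<xi> = 0"
  shows "AE x in TM. h x = 0"
proof -
  have "AE x in TM. (-1) * h x \<le> 0"
    by (intro fourier_zero_nonpos Lq1_scale h) (simp add: dist_of_scale[OF h, of "-1", simplified] F)
  with fourier_zero_nonpos[OF h F] show ?thesis by eventually_elim simp
qed

lemma dist_of_cong_AE:
  assumes "h \<in> Lq 1" "k \<in> Lq 1" "AE x in TM. h x = k x" shows "dist_of h = dist_of k"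
proof (rule pdist_eqI)
  fix \<phi> :: "real^'a \<Rightarrow> real" assume \<phi>: "\<phi> \<in> test_funs"
  have "(\<integral>x. h x * \<phi> x \<partial>TM) = (\<integral>x. k x * \<phi> x \<partial>TM)"
    using integrable_Lq1_test[OF assms(1) \<phi>] integrable_Lq1_test[OF assms(2) \<phi>] assms(3)
    by (intro integral_cong_AE) auto
  then show "dapply (dist_of h) \<phi> = dapply (dist_of k) \<phi>"
    using assms \<phi> by (simp add: dapply_dist_of)
qed

lemma fourier_eq_AE:
  fixes h k :: "real^'n::finite \<Rightarrow> real"
  assumes h: "h \<in> Lq 1" "k \<in> Lq 1" and F: "\<And>\<xi>. fourier (dist_of h) \<xi> = fourier (dist_of k) \<xi>"
  shows "AE x in TM. h x = k x"
proof -
  have L: "(\<lambda>x. h x + (-1) * k x) \<in> Lq 1" by (intro Lq1_add Lq1_scale h)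
  have "fourier (dist_of (\<lambda>x. h x + (-1) * k x)) \<xi> = 0" for \<xi>
    by (simp only: dist_of_add[OF h(1) Lq1_scale[OF h(2)]] dist_of_scale[OF h(2)]) (simp add: F)
  from fourier_zero_AE[OF L this] show ?thesis by eventually_elim simp
qed

section \<open>Fourier series of test functions\<close>

text \<open>Cubes are symmetric under negation, so partial sums over them keep coefficients
  hermitian, and their points are easy to count.\<close>

definition cube :: "nat \<Rightarrow> (int^'n::finite) set" where
  "cube N = {\<xi>. \<forall>i. \<bar>\<xi> $ i\<bar> \<le> int N}"

lemma cube_uminus: "\<xi> \<in> cube N \<Longrightarrow> - \<xi> \<in> cube N"
  by (simp add: cube_def)

lemma cube_mono: "M \<le> N \<Longrightarrow> cube M \<subseteq> cube N"
  unfolding cube_def by (auto intro: order_trans[OF _ of_nat_mono])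

lemma zero_in_cube [simp]: "0 \<in> cube N"
  by (simp add: cube_def)

lemma finite_cube [simp]: "finite (cube N :: (int^'n::finite) set)"
  and card_cube: "card (cube N :: (int^'n::finite) set) \<le> (2 * N + 1) ^ CARD('n)"
proof -
  let ?P = "PiE (UNIV :: 'n set) (\<lambda>_. {- int N..int N})"
  have "nat (2 * int N + 1) = 2 * N + 1" by linarith
  then have P: "finite ?P" "card ?P = (2 * N + 1) ^ CARD('n)"
    by (simp_all add: finite_PiE card_PiE)
  have inj: "inj_on vec_nth (cube N :: (int^'n) set)" by (simp add: inj_on_def vec_nth_inject)
  have sub: "vec_nth ` (cube N :: (int^'n) set) \<subseteq> ?P"
    by (auto simp: cube_def PiE_def Pi_def abs_le_iff) (smt (verit))+
  show "finite (cube N :: (int^'n) set)" using inj sub P(1) by (metis finite_imageD finite_subset)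
  show "card (cube N :: (int^'n) set) \<le> (2 * N + 1) ^ CARD('n)"
    using card_inj_on_le[OF inj sub P(1)] P(2) by simp
qed

lemma finite_subset_cube:
  fixes F :: "(int^'n::finite) set"
  assumes "finite F" obtains N where "F \<subseteq> cube N"
proof -
  define N where "N = (\<Sum>\<xi>\<in>F. \<Sum>i\<in>UNIV. nat \<bar>\<xi> $ i\<bar>)"
  have "\<bar>\<xi> $ i\<bar> \<le> int N" if "\<xi> \<in> F" for \<xi> i
  proof -
    have "nat \<bar>\<xi> $ i\<bar> \<le> (\<Sum>i\<in>UNIV. nat \<bar>\<xi> $ i\<bar>)" by (rule member_le_sum) auto
    also have "\<dots> \<le> N" unfolding N_def using assms that by (intro member_le_sum) auto
    finally show ?thesis by linarith
  qed
  then show ?thesis using that[of N] by (auto simp: cube_def)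
qed

text \<open>Turns unconditional sums into limits of sequences of partial sums over cubes.\<close>

lemma filterlim_cube: "filterlim cube (finite_subsets_at_top UNIV) sequentially"
  unfolding filterlim_finite_subsets_at_top
proof (intro allI impI)
  fix F :: "(int^'n) set" assume "finite F \<and> F \<subseteq> UNIV"
  then obtain N where "F \<subseteq> cube N" using finite_subset_cube by blast
  then show "eventually (\<lambda>N. finite (cube N) \<and> F \<subseteq> cube N \<and> cube N \<subseteq> UNIV) sequentially"
    using cube_mono by (auto intro!: eventually_sequentiallyI[of N])
qed

lemma summable_on_cubes:
  fixes f :: "int^'n::finite \<Rightarrow> real"
  assumes pos: "\<And>\<xi>. f \<xi> \<ge> 0" and bound: "\<And>N. (\<Sum>\<xi>\<in>cube N. f \<xi>) \<le> B"
  shows "f summable_on UNIV" "infsum f UNIV \<le> B"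
proof -
  have fin: "sum f F \<le> B" if "finite F" for F
  proof -
    obtain N where "F \<subseteq> cube N" using finite_subset_cube \<open>finite F\<close> by blast
    then have "sum f F \<le> sum f (cube N)" by (intro sum_mono2) (auto simp: pos)
    then show ?thesis using bound[of N] by linarith
  qed
  then show s: "f summable_on UNIV"
    by (intro nonneg_bdd_above_summable_on) (auto simp: pos bdd_above_def)
  show "infsum f UNIV \<le> B" by (intro infsum_le_finite_sums s fin)
qed

section \<open>Lattice sums of the weight\<close>

lemma weight_ge_1: "weight \<xi> \<ge> 1"
  by (simp add: weight_def sum_nonneg)

lemma weight_pos [simp]: "weight \<xi> > 0" "weight \<xi> \<ge> 0" "weight \<xi> \<noteq> 0"
  using weight_ge_1[of \<xi>] by linarith+

lemma weight_uminus [simp]: "weight (- \<xi>) = weight \<xi>"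
  by (simp add: weight_def)

lemma weight_outside_cube:
  assumes "\<xi> \<notin> cube N" shows "weight \<xi> \<ge> (real N)\<^sup>2"
proof -
  obtain i where "int N < \<bar>\<xi> $ i\<bar>" using assms by (auto simp: cube_def not_le)
  then have "real N \<le> \<bar>real_of_int (\<xi> $ i)\<bar>" by linarith
  then have "(real N)\<^sup>2 \<le> (real_of_int (\<xi> $ i))\<^sup>2" by (metis abs_le_square_iff abs_of_nat)
  also have "\<dots> \<le> (\<Sum>i\<in>UNIV. (real_of_int (\<xi> $ i))\<^sup>2)" by (rule member_le_sum) auto
  finally show ?thesis by (simp add: weight_def)
qed

text \<open>A dyadic shell has at most \<open>6 ^ n * 2 ^ (k * n)\<close> points, each of weight at least \<open>4 ^ k\<close>.\<close>

lemma shell_sum: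
  "(\<Sum>\<xi>\<in>cube (2 ^ Suc k). inverse (weight (\<xi> :: int^'n::finite)) ^ m) \<le>
    (\<Sum>\<xi>\<in>cube (2 ^ k). inverse (weight (\<xi> :: int^'n::finite)) ^ m) + 6 ^ CARD('n) * 2 ^ (k * CARD('n)) / 4 ^ (k * m)"
proof -
  let ?Q = "\<lambda>k. cube (2 ^ k) :: (int^'n) set"
  have sub: "?Q k \<subseteq> ?Q (Suc k)" by (rule cube_mono) simp
  have "(\<Sum>\<xi>\<in>?Q (Suc k). inverse (weight \<xi>) ^ m) =
      (\<Sum>\<xi>\<in>?Q k. inverse (weight \<xi>) ^ m) + (\<Sum>\<xi>\<in>?Q (Suc k) - ?Q k. inverse (weight \<xi>) ^ m)"
    by (subst sum.subset_diff[OF sub]) auto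
  also have "(\<Sum>\<xi>\<in>?Q (Suc k) - ?Q k. inverse (weight \<xi>) ^ m) \<le> of_nat (card (?Q (Suc k) - ?Q k)) * (1 / 4 ^ (k * m))"
  proof (rule sum_bounded_above)
    fix \<xi> :: "int^'n" assume "\<xi> \<in> ?Q (Suc k) - ?Q k"
    then have "4 ^ k \<le> weight \<xi>"
      using weight_outside_cube[of \<xi> "2 ^ k"] by (simp add: power2_eq_square power_mult_distrib[symmetric])
    then have "inverse (weight \<xi>) \<le> inverse (4 ^ k)" by (intro le_imp_inverse_le) auto
    then have "inverse (weight \<xi>) ^ m \<le> inverse (4 ^ k) ^ m" by (intro power_mono) (auto intro: less_imp_le)
    then show "inverse (weight \<xi>) ^ m \<le> 1 / 4 ^ (k * m)"
      by (simp add: power_mult power_inverse[symmetric] field_simps)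
  qed
  also have "of_nat (card (?Q (Suc k) - ?Q k)) * (1 / 4 ^ (k * m)) \<le> (6 ^ CARD('n) * 2 ^ (k * CARD('n))) * (1 / 4 ^ (k * m :: nat) :: real)"
  proof (rule mult_right_mono)
    have "card (?Q (Suc k) - ?Q k) \<le> card (?Q (Suc k))" by (intro card_mono) auto
    also have "\<dots> \<le> (2 * 2 ^ Suc k + 1) ^ CARD('n)" by (rule card_cube)
    \<comment> \<open>The base is 4 * 2^k + 1; the factor 6 absorbs the 1.\<close>
    also have "\<dots> \<le> (6 * 2 ^ k) ^ CARD('n)" by (intro power_mono) auto
    finally have "real (card (?Q (Suc k) - ?Q k)) \<le> real ((6 * 2 ^ k) ^ CARD('n))" by (simp only: of_nat_le_iff)
    then show "of_nat (card (?Q (Suc k) - ?Q k)) \<le> (6 ^ CARD('n) * 2 ^ (k * CARD('n)) :: real)"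
      by (simp add: power_mult_distrib power_mult)
  qed simp
  finally show ?thesis by simp
qed

text \<open>With the dimension n as exponent the shells contribute at most 6^n (1/2)^k, a geometric
  series.\<close>

lemma summable_inverse_weight_power:
  "(\<lambda>\<xi> :: int^'n::finite. inverse (weight \<xi>) ^ CARD('n)) summable_on UNIV"
proof (rule summable_on_cubes)
  let ?n = "CARD('n)"
  let ?S = "\<lambda>N. \<Sum>\<xi>\<in>cube N. inverse (weight (\<xi> :: int^'n)) ^ ?n"
  \<comment> \<open>\<open>2 - 2 * (1/2) ^ k\<close> is the sum of (1/2)^i over i < k.\<close>
  have S: "?S (2 ^ k) \<le> ?S 1 + 6 ^ ?n * (2 - 2 * (1/2) ^ k)" for k
  proof (induction k)
    case (Suc k)
    have "2 ^ (k * ?n) / (4::real) ^ (k * ?n) = (1/2) ^ (k * ?n)"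
      by (simp add: power_divide[symmetric])
    also have "\<dots> \<le> (1/2) ^ k" by (intro power_decreasing) (auto simp: Suc_le_eq)
    finally have *: "6 ^ ?n * (2 ^ (k * ?n) / (4::real) ^ (k * ?n)) \<le> 6 ^ ?n * (1/2) ^ k"
      by (intro mult_left_mono) auto
    show ?case using shell_sum[where k=k and m="?n" and 'n='n] Suc.IH * by (simp add: algebra_simps)
  qed simp
  show "?S N \<le> ?S 1 + 6 ^ ?n * 2" for N
  proof -
    have "N \<le> 2 ^ N" by (simp add: less_imp_le)
    then have "?S N \<le> ?S (2 ^ N)" by (intro sum_mono2 cube_mono) (auto intro: less_imp_le)
    also have "\<dots> \<le> ?S 1 + 6 ^ ?n * (2 - 2 * (1/2) ^ N)" by (rule S)
    also have "\<dots> \<le> ?S 1 + 6 ^ ?n * 2" by (intro add_left_mono mult_left_mono) auto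
    finally show ?thesis .
  qed
qed (auto intro: less_imp_le)

text \<open>The k-th shell contributes at most 6^n (2^n / 4)^k, and \<open>\<theta>\<close> being at
  least n bounds the ratio by r = \<open>2 powr (\<theta> - 2)\<close>. As \<open>\<theta>\<close>
  exceeds 2, r exceeds 1 and the last shell dominates; in dimension 2 this gives room for the
  logarithmic growth of the sum.\<close>

lemma sum_inverse_weight_growth:
  assumes "\<theta> > 2" "\<theta> \<ge> real CARD('n::finite)"
  obtains K where "K > 0" "\<And>k. (\<Sum>\<xi>\<in>cube (2 ^ k). inverse (weight (\<xi> :: int^'n))) \<le> K * (2 powr (\<theta> - 2)) ^ k"
proof -
  let ?n = "CARD('n)"
  let ?S = "\<lambda>N. \<Sum>\<xi>\<in>cube N. inverse (weight (\<xi> :: int^'n))"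
  define r where "r = 2 powr (\<theta> - 2)"
  have r: "r > 1" using assms by (simp add: r_def)
  \<comment> \<open>Chosen so that \<open>K * (r - 1)\<close> is at least 6^n, which closes the
    induction step; the summand \<open>?S 1\<close> starts it.\<close>
  define K where "K = ?S 1 + 6 ^ ?n / (r - 1)"
  have S1: "?S 1 \<ge> 0" by (intro sum_nonneg) (auto intro: less_imp_le)
  have K: "K * (r - 1) \<ge> 6 ^ ?n" using r S1 by (simp add: K_def distrib_right)
  have K0: "0 \<le> K * (r - 1)" using K by (rule order_trans[rotated]) simp
  have nr: "2 ^ ?n / 4 \<le> r"
  proof -
    have "2 ^ ?n / 4 = 2 powr (real ?n - 2)" by (simp add: powr_diff powr_realpow)
    also have "\<dots> \<le> r" unfolding r_def using assms by (intro powr_mono) auto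
    finally show ?thesis .
  qed
  have S: "?S (2 ^ k) \<le> K * r ^ k" for k
  proof (induction k)
    case 0
    show ?case using r by (simp add: K_def)
  next
    case (Suc k)
    have "2 ^ (k * ?n) / (4::real) ^ (k * 1) = (2 ^ ?n / 4) ^ k"
      by (simp add: power_divide power_mult[symmetric] mult.commute)
    also have "\<dots> \<le> r ^ k" using nr by (intro power_mono) auto
    finally have "6 ^ ?n * (2 ^ (k * ?n) / (4::real) ^ (k * 1)) \<le> (K * (r - 1)) * r ^ k"
      using K r K0 by (intro mult_mono) auto
    then show ?case using shell_sum[where k=k and m=1 and 'n='n] Suc.IH by (simp add: algebra_simps)
  qed
  have "K > 0" using S1 r by (simp add: K_def add_nonneg_pos)
  then show ?thesis using that S unfolding r_def by blast
qed

section \<open>Decay of Fourier coefficients\<close>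

lemma norm_fourier_le:
  assumes h: "h \<in> Lq 1" shows "cmod (fourier (dist_of h) \<xi>) \<le> 2 * (\<integral>x. \<bar>h x\<bar> \<partial>TM)"
proof -
  have int: "integrable TM h" using h by (simp add: Lq1_iff)
  have *: "\<bar>\<integral>x. h x * \<phi> x \<partial>TM\<bar> \<le> (\<integral>x. \<bar>h x\<bar> \<partial>TM)"
    if "\<phi> \<in> test_funs" "\<And>x. \<bar>\<phi> x\<bar> \<le> 1" for \<phi> :: "real^'a \<Rightarrow> real"
  proof -
    have "\<bar>\<integral>x. h x * \<phi> x \<partial>TM\<bar> \<le> (\<integral>x. \<bar>h x * \<phi> x\<bar> \<partial>TM)" by (rule integral_abs_bound)
    also have "\<dots> \<le> (\<integral>x. \<bar>h x\<bar> \<partial>TM)"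
    proof (rule integral_mono)
      show "integrable TM (\<lambda>x. \<bar>h x * \<phi> x\<bar>)" "integrable TM (\<lambda>x. \<bar>h x\<bar>)"
        using int integrable_Lq1_test[OF h that(1)] by simp_all
      show "\<bar>h x * \<phi> x\<bar> \<le> \<bar>h x\<bar>" for x
        using that(2)[of x] by (simp add: abs_mult mult_left_le)
    qed
    finally show ?thesis .
  qed
  have "\<bar>Re (fourier (dist_of h) \<xi>)\<bar> \<le> (\<integral>x. \<bar>h x\<bar> \<partial>TM)" "\<bar>Im (fourier (dist_of h) \<xi>)\<bar> \<le> (\<integral>x. \<bar>h x\<bar> \<partial>TM)"
    using h *[of "\<lambda>x. cos (phase \<xi> x)"] *[of "\<lambda>x. sin (phase \<xi> x)"] by (simp_all add: fourier_def dapply_dist_of)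
  then show ?thesis using cmod_le[of "fourier (dist_of h) \<xi>"] by linarith
qed

lemma norm_fourier_diff_le:
  assumes h: "h \<in> Lq 1" "k \<in> Lq 1"
  shows "cmod (fourier (dist_of h) \<xi> - fourier (dist_of k) \<xi>) \<le> 2 * (\<integral>x. \<bar>h x - k x\<bar> \<partial>TM)"
proof -
  have L: "(\<lambda>x. h x + (-1) * k x) \<in> Lq 1" by (intro Lq1_add Lq1_scale h)
  have "dist_of (\<lambda>x. h x + (-1) * k x) = dist_of h - dist_of k"
    by (simp only: dist_of_add[OF h(1) Lq1_scale[OF h(2)]] dist_of_scale[OF h(2)]) simp
  then show ?thesis using norm_fourier_le[OF L, of \<xi>] by simp
qed

text \<open>The differential operator with symbol \<open>weight\<close>; its powers give the decay of Fourier
  coefficients of test functions.\<close>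

definition bessel :: "(real^'n::finite \<Rightarrow> real) \<Rightarrow> real^'n \<Rightarrow> real" where
  "bessel \<phi> = (\<lambda>x. \<phi> x + (- 1 / (4 * pi\<^sup>2)) * (\<Sum>j\<in>UNIV. partial j (partial j \<phi>) x))"

lemma bessel_test: "\<phi> \<in> test_funs \<Longrightarrow> bessel \<phi> \<in> test_funs"
  unfolding bessel_def by (intro test_funs_add test_funs_scale test_funs_sum test_funs_partial)

lemma test_funs_Lq1: "\<phi> \<in> test_funs \<Longrightarrow> \<phi> \<in> Lq 1"
  by (intro test_funs_Lq) auto

lemma dist_of_sum: "(\<And>i. i \<in> I \<Longrightarrow> f i \<in> test_funs) \<Longrightarrow> dist_of (\<lambda>x. \<Sum>i\<in>I. f i x) = (\<Sum>i\<in>I. dist_of (f i))"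
proof (induction I rule: infinite_finite_induct)
  case (insert i I)
  then show ?case by (simp add: dist_of_add test_funs_Lq1 test_funs_sum)
qed (use dist_of_scale[of "\<lambda>x. 0" 0] test_funs_Lq1[OF const_test[of 0]] in simp_all)

lemma fourier_bessel:
  assumes "\<phi> \<in> test_funs"
  shows "fourier (dist_of (bessel \<phi>)) \<xi> = weight \<xi> * fourier (dist_of \<phi>) \<xi>"
proof -
  have t: "partial j (partial j \<phi>) \<in> test_funs" for j using assms by (intro test_funs_partial)
  have eq: "dist_of (bessel \<phi>) = dist_of \<phi> + (- 1 / (4 * pi\<^sup>2)) *\<^sub>R (\<Sum>j\<in>UNIV. ddiff j (ddiff j (dist_of \<phi>)))"
    unfolding bessel_def
    by (simp only: dist_of_add dist_of_scale test_funs_Lq1 test_funs_scale test_funs_sum t assms dist_of_sum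
        dist_of_partial test_funs_partial)
  show ?thesis
    unfolding eq by (simp add: fourier_ddiff weight_def scaleR_conv_of_real sum_distrib_left sum_distrib_right distrib_right sum_negf
        power2_eq_square sum_divide_distrib field_simps)
qed

text \<open>Applying \<open>bessel\<close> n times multiplies the coefficients by
  \<open>weight \<xi> ^ n\<close>, while the result still has bounded coefficients; the inverse n-th
  power of the weight is summable.\<close>

lemma summable_fourier_test:
  fixes \<phi> :: "real^'n::finite \<Rightarrow> real"
  assumes "\<phi> \<in> test_funs"
  shows "(\<lambda>\<xi>. cmod (fourier (dist_of \<phi>) \<xi>)) summable_on UNIV"
proof -
  have it: "(bessel ^^ m) \<phi> \<in> test_funs \<and>
      (\<forall>\<xi>. fourier (dist_of ((bessel ^^ m) \<phi>)) \<xi> = weight \<xi> ^ m * fourier (dist_of \<phi>) \<xi>)" for m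
    by (induction m) (auto simp: assms bessel_test fourier_bessel)
  define B where "B = 2 * (\<integral>x. \<bar>(bessel ^^ CARD('n)) \<phi> x\<bar> \<partial>TM)"
  have le: "cmod (fourier (dist_of \<phi>) \<xi>) \<le> B * inverse (weight \<xi>) ^ CARD('n)" for \<xi>
  proof -
    have "weight \<xi> ^ CARD('n) * cmod (fourier (dist_of \<phi>) \<xi>) \<le> B"
      using norm_fourier_le[OF test_funs_Lq1, of "(bessel ^^ CARD('n)) \<phi>" \<xi>] it[of "CARD('n)"]
      by (simp add: B_def norm_mult norm_power)
    then show ?thesis by (simp add: field_simps power_inverse[symmetric])
  qed
  show ?thesis
    by (rule summable_on_comparison_test[OF summable_on_cmult_right[OF summable_inverse_weight_power]]) (use le in auto)
qed

text \<open>A nonempty open subset of the box is not negligible; from the box the value 0 spreads by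
  closure and then by periodicity.\<close>

lemma continuous_AE_zero:
  fixes f :: "real^'n::finite \<Rightarrow> real"
  assumes "periodic f" and f: "continuous_on UNIV f" and AE: "AE x in TM. f x = 0"
  shows "f x = 0"
proof -
  have box: "f y = 0" if "y \<in> box 0 1" for y
  proof (rule ccontr)
    assume "f y \<noteq> 0"
    let ?O = "box 0 1 \<inter> {y. f y \<noteq> 0}"
    have "open ?O" by (intro open_Int open_box open_Collect_neq f continuous_on_const)
    moreover have "?O \<noteq> {}" using \<open>f y \<noteq> 0\<close> that by auto
    ultimately have "\<not> negligible ?O" by (rule open_not_negligible)
    moreover have "AE x in lebesgue. x \<in> torus \<longrightarrow> f x = 0"
      using AE by (subst (asm) AE_restrict_space_iff) auto
    then have "AE x in lebesgue. x \<notin> ?O"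
      by eventually_elim (use box_subset_torus in auto)
    then have "negligible ?O"
      using \<open>open ?O\<close> AE_iff_null_sets[of ?O lebesgue] by (simp add: negligible_iff_null_sets)
    ultimately show False by simp
  qed
  have "f y = 0" if "y \<in> cbox 0 1" for y
  proof -
    have "box 0 (1 :: real^'n) \<noteq> {}" by (auto simp: box_ne_empty Basis_vec_def inner_axis)
    then have "closure (box 0 (1 :: real^'n)) = cbox 0 1" by (rule closure_box)
    then show ?thesis
      using continuous_constant_on_closure[of "box 0 1" f 0 y] box that continuous_on_subset[OF f] by auto
  qed
  then have "f y = 0" if "y \<in> torus" for y using that torus_subset_cbox by blast
  then show ?thesis using periodic_frac[OF assms(1), of x] frac_torus[of x] by metis
qed

text \<open>Summable coefficients give a continuous uniform limit. Its coefficients are those of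
  \<open>\<phi>\<close>, because coefficients are continuous in the L1 norm; so the two agree almost
  everywhere and, being continuous, everywhere.\<close>

theorem fourier_series_uniform:
  fixes \<phi> :: "real^'n::finite \<Rightarrow> real"
  assumes \<phi>: "\<phi> \<in> test_funs"
  shows "uniform_limit UNIV (\<lambda>N. trig_poly (cube N) (fourier (dist_of \<phi>))) \<phi> sequentially"
proof -
  let ?c = "fourier (dist_of \<phi>)"
  let ?t = "\<lambda>\<xi> x. Re (?c \<xi>) * cos (phase \<xi> x) - Im (?c \<xi>) * sin (phase \<xi> x)"
  define \<psi> where "\<psi> x = (\<Sum>\<^sub>\<infinity>\<xi>. ?t \<xi> x)" for x
  have "uniform_limit UNIV (\<lambda>F x. \<Sum>\<xi>\<in>F. ?t \<xi> x) (\<lambda>x. \<Sum>\<^sub>\<infinity>\<xi>. ?t \<xi> x) (finite_subsets_at_top UNIV)"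
  proof (rule Weierstrass_m_test_general)
    show "(\<lambda>\<xi>. 2 * cmod (?c \<xi>)) summable_on UNIV"
      by (intro summable_on_cmult_right summable_fourier_test \<phi>)
    fix \<xi> and x :: "real^'n"
    have "\<bar>?t \<xi> x\<bar> \<le> \<bar>Re (?c \<xi>)\<bar> * \<bar>cos (phase \<xi> x)\<bar> + \<bar>Im (?c \<xi>)\<bar> * \<bar>sin (phase \<xi> x)\<bar>"
      by (simp add: abs_mult[symmetric])
    also have "\<dots> \<le> \<bar>Re (?c \<xi>)\<bar> * 1 + \<bar>Im (?c \<xi>)\<bar> * 1"
      by (intro add_mono mult_left_mono) auto
    also have "\<dots> \<le> 2 * cmod (?c \<xi>)" using abs_Re_le_cmod[of "?c \<xi>"] abs_Im_le_cmod[of "?c \<xi>"] by linarith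
    finally show "norm (?t \<xi> x) \<le> 2 * cmod (?c \<xi>)" by simp
  qed
  from filterlim_compose[OF this filterlim_cube]
  have lim: "uniform_limit UNIV (\<lambda>N. trig_poly (cube N) ?c) \<psi> sequentially"
    by (simp add: trig_poly_def[abs_def] \<psi>_def[abs_def])
  have cont: "continuous_on UNIV \<psi>"
    by (rule uniform_limit_theorem[OF _ lim])
      (auto intro!: eventuallyI test_funs_continuous trig_poly_test)
  have per: "periodic \<psi>"
    by (simp add: periodic_def \<psi>_def phase_add_axis cos_add_int_2pi sin_add_int_2pi)
  have L\<psi>: "\<psi> \<in> Lq 1"
    using per cont by (simp add: Lq1_iff integrable_TM_continuous continuous_measurable_lebesgue)
  have L\<phi>: "\<phi> \<in> Lq 1" using \<phi> by (rule test_funs_Lq1)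
  have F: "fourier (dist_of \<psi>) \<xi> = ?c \<xi>" for \<xi>
  proof -
    have "cmod (fourier (dist_of \<psi>) \<xi> - ?c \<xi>) \<le> 0 + e" if "e > 0" for e
    proof -
      have "eventually (\<lambda>N. \<forall>x\<in>UNIV. dist (trig_poly (cube N) ?c x) (\<psi> x) < e / 2) sequentially"
        using lim half_gt_zero[OF that] unfolding uniform_limit_iff by blast
      then have "eventually (\<lambda>N. (\<forall>x. dist (trig_poly (cube N) ?c x) (\<psi> x) < e / 2) \<and> \<xi> \<in> cube N) sequentially"
      proof (rule eventually_elim2)
        show "eventually (\<lambda>N. \<xi> \<in> cube N) sequentially"
          using finite_subset_cube[of "{\<xi>}"] cube_mono by (metis eventually_sequentiallyI finite.emptyI finite_insert insert_subset subsetD)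
      qed auto
      then obtain N where N: "\<And>x. \<bar>trig_poly (cube N) ?c x - \<psi> x\<bar> < e / 2" "\<xi> \<in> cube N"
        by (auto simp: dist_real_def dest!: eventually_happens)
      have "fourier (dist_of (trig_poly (cube N) ?c)) \<xi> = ?c \<xi>"
        using N(2) by (subst fourier_trig_poly) (auto simp: cube_uminus fourier_minus)
      then have "cmod (fourier (dist_of \<psi>) \<xi> - ?c \<xi>) \<le> 2 * (\<integral>x. \<bar>\<psi> x - trig_poly (cube N) ?c x\<bar> \<partial>TM)"
        using norm_fourier_diff_le[OF L\<psi> test_funs_Lq1[OF trig_poly_test], of \<xi> "cube N" ?c] by simp
      also have "(\<integral>x. \<bar>\<psi> x - trig_poly (cube N) ?c x\<bar> \<partial>TM) \<le> (\<integral>x. e / 2 \<partial>(TM :: (real^'n) measure))"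
      proof (rule integral_mono)
        show "integrable TM (\<lambda>x. \<bar>\<psi> x - trig_poly (cube N) ?c x\<bar>)"
          using L\<psi> test_funs_Lq1[OF trig_poly_test, of "cube N" ?c] by (simp add: Lq1_iff)
        show "\<bar>\<psi> x - trig_poly (cube N) ?c x\<bar> \<le> e / 2" for x using N(1)[of x] by linarith
      qed simp
      finally show ?thesis by simp
    qed
    then have "cmod (fourier (dist_of \<psi>) \<xi> - ?c \<xi>) \<le> 0" by (rule field_le_epsilon)
    then show ?thesis by simp
  qed
  have "AE x in TM. \<psi> x = \<phi> x" by (rule fourier_eq_AE[OF L\<psi> L\<phi> F])
  then have AE0: "AE x in TM. \<psi> x - \<phi> x = 0" by eventually_elim simp
  have "\<psi> x - \<phi> x = 0" for x :: "real^'n"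
  proof (rule continuous_AE_zero[where f = "\<lambda>x. \<psi> x - \<phi> x", OF _ _ AE0])
    show "periodic (\<lambda>x. \<psi> x - \<phi> x)" using per test_funs_periodic[OF \<phi>] by (simp add: periodic_def)
    show "continuous_on UNIV (\<lambda>x. \<psi> x - \<phi> x)"
      by (rule continuous_on_diff[OF cont test_funs_continuous[OF \<phi>]])
  qed
  then have "\<psi> = \<phi>" by auto
  then show ?thesis using lim by simp
qed

text \<open>Differentiation commutes with Fourier partial sums, so these converge uniformly with all
  derivatives, the sense in which distributions are continuous.\<close>

lemma partials_trig_poly:
  assumes "\<phi> \<in> test_funs"
  shows "partials js (trig_poly F (fourier (dist_of \<phi>))) = trig_poly F (fourier (dist_of (partials js \<phi>)))"
  using assms
proof (induction js arbitrary: \<phi>)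
  case (Cons j js)
  have "partial j (trig_poly F (fourier (dist_of \<phi>))) = trig_poly F (fourier (dist_of (partial j \<phi>)))"
    unfolding partial_trig_poly dist_of_partial[OF Cons.prems] fourier_ddiff[abs_def] by (rule refl)
  then show ?case using Cons by (simp add: test_funs_partial)
qed simp

text \<open>The difference \<open>D\<close> vanishes on every trigonometric polynomial. It is
  controlled by finitely many derivatives, in which the partial sums approximate
  \<open>\<phi>\<close>.\<close>

theorem fourier_inject:
  fixes S T :: "'n::finite pdist"
  assumes "\<And>\<xi>. fourier S \<xi> = fourier T \<xi>" shows "S = T"
proof (rule pdist_eqI)
  fix \<phi> :: "real^'n \<Rightarrow> real" assume \<phi>: "\<phi> \<in> test_funs"
  define D where "D = S - T"
  have D0: "fourier D \<xi> = 0" for \<xi> using assms by (simp add: D_def)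
  obtain N C where bd: "\<And>\<phi> M. \<phi> \<in> test_funs \<Longrightarrow>
      (\<forall>js x. length js \<le> N \<longrightarrow> \<bar>partials js \<phi> x\<bar> \<le> M) \<Longrightarrow> \<bar>dapply D \<phi>\<bar> \<le> C * M"
    using is_pdist_bound[of "dapply D"] dapply[of D] by auto metis
  have "\<bar>dapply D \<phi>\<bar> \<le> 0 + e" if "e > 0" for e
  proof -
    \<comment> \<open>The order constant \<open>C\<close> may be zero or negative, hence the
      absolute value and the added 1.\<close>
    define \<delta> where "\<delta> = e / (\<bar>C\<bar> + 1)"
    have \<delta>: "\<delta> > 0" "C * \<delta> \<le> e"
    proof -
      show "\<delta> > 0" using that by (simp add: \<delta>_def)
      then have "C * \<delta> \<le> (\<bar>C\<bar> + 1) * \<delta>" by (intro mult_right_mono) auto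
      then show "C * \<delta> \<le> e" by (simp add: \<delta>_def)
    qed
    let ?J = "{js :: 'n list. length js \<le> N}"
    have "finite ?J" using finite_lists_length_le[of "UNIV :: 'n set" N] by simp
    moreover have "eventually (\<lambda>M. \<forall>x. dist (trig_poly (cube M) (fourier (dist_of (partials js \<phi>))) x) (partials js \<phi> x) < \<delta>) sequentially" for js
      using fourier_series_uniform[OF test_funs_partials[OF \<phi>, of js]] \<delta>(1) unfolding uniform_limit_iff by simp
    ultimately have "eventually (\<lambda>M. \<forall>js\<in>?J. \<forall>x. dist (trig_poly (cube M) (fourier (dist_of (partials js \<phi>))) x) (partials js \<phi> x) < \<delta>) sequentially"
      by (intro eventually_ball_finite) auto
    then obtain M where M: "\<And>js x. length js \<le> N \<Longrightarrow> \<bar>trig_poly (cube M) (fourier (dist_of (partials js \<phi>))) x - partials js \<phi> x\<bar> < \<delta>"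
      by (auto simp: dist_real_def dest!: eventually_happens)
    let ?p = "trig_poly (cube M) (fourier (dist_of \<phi>))"
    have "\<bar>dapply D (\<lambda>x. \<phi> x + (-1) * ?p x)\<bar> \<le> C * \<delta>"
    proof (rule bd)
      show "(\<lambda>x. \<phi> x + (-1) * ?p x) \<in> test_funs" by (intro test_funs_add test_funs_scale \<phi> trig_poly_test)
      have "partials js (\<lambda>x. \<phi> x + (-1) * ?p x) = (\<lambda>x. partials js \<phi> x + (-1) * trig_poly (cube M) (fourier (dist_of (partials js \<phi>))) x)" for js
        by (simp only: partials_add[OF \<phi> test_funs_scale[OF trig_poly_test]] partials_scale[OF trig_poly_test] partials_trig_poly[OF \<phi>])
      then show "\<forall>js x. length js \<le> N \<longrightarrow> \<bar>partials js (\<lambda>x. \<phi> x + (-1) * ?p x) x\<bar> \<le> \<delta>"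
        using M by (auto simp: abs_minus_commute less_imp_le)
    qed
    moreover have "dapply D (\<lambda>x. \<phi> x + (-1) * ?p x) = dapply D \<phi>"
      by (simp only: dapply_add[OF \<phi> test_funs_scale[OF trig_poly_test]] dapply_scale[OF trig_poly_test])
        (simp add: dapply_trig_poly D0)
    ultimately show ?thesis using \<delta> by simp
  qed
  then have "\<bar>dapply D \<phi>\<bar> \<le> 0" by (rule field_le_epsilon)
  then show "dapply S \<phi> = dapply T \<phi>" by (simp add: D_def)
qed

section \<open>Square-integrable functions\<close>

text \<open>Parseval for finite sums, by evaluating the distribution of the polynomial on the
  polynomial itself.\<close>

lemma integral_trig_poly_sq:
  fixes c :: "int^'n::finite \<Rightarrow> complex"
  assumes "finite F" "\<And>\<xi>. \<xi> \<in> F \<Longrightarrow> - \<xi> \<in> F" "\<And>\<xi>. c (- \<xi>) = cnj (c \<xi>)"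
  shows "(\<integral>x. (trig_poly F c x)\<^sup>2 \<partial>TM) = (\<Sum>\<xi>\<in>F. (cmod (c \<xi>))\<^sup>2)"
proof -
  have "(\<integral>x. (trig_poly F c x)\<^sup>2 \<partial>TM) = dapply (dist_of (trig_poly F c)) (trig_poly F c)"
    by (simp add: dapply_dist_of test_funs_Lq1 power2_eq_square)
  also have "\<dots> = Re (\<Sum>\<xi>\<in>F. c \<xi> * cnj (c \<xi>))"
  proof -
    have "fourier (dist_of (trig_poly F c)) \<xi> = (if \<xi> \<in> F then c \<xi> else 0)" for \<xi>
      by (rule fourier_trig_poly) (use assms in auto)
    then show ?thesis
      unfolding dapply_trig_poly fourier_minus by (intro arg_cong[of _ _ Re] sum.cong) auto
  qed
  also have "\<dots> = (\<Sum>\<xi>\<in>F. (cmod (c \<xi>))\<^sup>2)"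
    by (simp add: complex_norm_square[symmetric] Re_sum)
  finally show ?thesis .
qed

lemma integrable_trig_poly_sq: "integrable TM (\<lambda>x. (trig_poly F c x)\<^sup>2)"
  using integrable_test[OF trig_test_funs[OF trig_mult[OF trig_poly_trig trig_poly_trig]], of F c F c]
  by (simp add: power2_eq_square)

lemma trig_poly_diff:
  "finite F \<Longrightarrow> G \<subseteq> F \<Longrightarrow> trig_poly F c x - trig_poly G c x = trig_poly (F - G) c x"
  by (simp add: trig_poly_def sum_diff)

text \<open>The torus has measure 1, and the variance of \<bar>f\<bar> is nonnegative:
  \<open>m\<close> is its mean.\<close>

lemma integral_abs_sq_le:
  fixes f :: "real^'n::finite \<Rightarrow> real"
  assumes f: "f \<in> borel_measurable TM" and f2: "integrable TM (\<lambda>x. (f x)\<^sup>2)"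
  shows "integrable TM f" "(\<integral>x. \<bar>f x\<bar> \<partial>TM)\<^sup>2 \<le> (\<integral>x. (f x)\<^sup>2 \<partial>TM)"
proof -
  show int: "integrable TM f"
  proof (rule Bochner_Integration.integrable_bound)
    show "integrable TM (\<lambda>x. 1 + (f x)\<^sup>2)" using f2 by simp
    have "\<bar>y\<bar> \<le> 1 + y\<^sup>2" for y :: real
      using zero_le_power2[of "\<bar>y\<bar> - 1"] by (simp add: power2_eq_square algebra_simps)
    then show "AE x in TM. norm (f x) \<le> norm (1 + (f x)\<^sup>2)" by simp
  qed (rule f)
  define m where "m = (\<integral>x. \<bar>f x\<bar> \<partial>TM)"
  have "0 \<le> (\<integral>x. (\<bar>f x\<bar> - m)\<^sup>2 \<partial>TM)" by simp
  also have "(\<lambda>x. (\<bar>f x\<bar> - m)\<^sup>2) = (\<lambda>x. (f x)\<^sup>2 - (2 * m) * \<bar>f x\<bar> + m\<^sup>2)"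
    by (simp add: power2_diff algebra_simps)
  also have "(\<integral>x. (f x)\<^sup>2 - (2 * m) * \<bar>f x\<bar> + m\<^sup>2 \<partial>TM) = (\<integral>x. (f x)\<^sup>2 \<partial>TM) - 2 * m * m + m\<^sup>2"
    using int f2 by (simp add: m_def)
  finally show "(\<integral>x. \<bar>f x\<bar> \<partial>TM)\<^sup>2 \<le> (\<integral>x. (f x)\<^sup>2 \<partial>TM)" by (simp add: m_def power2_eq_square)
qed

text \<open>Fatou's lemma for squares. It supplies both integrability and the norm bound for
  almost-everywhere limits.\<close>

lemma fatou_sq:
  fixes u :: "nat \<Rightarrow> 'a \<Rightarrow> real"
  assumes [measurable]: "\<And>k. u k \<in> borel_measurable M" "v \<in> borel_measurable M"
    and lim: "AE x in M. (\<lambda>k. u k x) \<longlonglongrightarrow> v x"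
    and int: "\<And>k. integrable M (\<lambda>x. (u k x)\<^sup>2)" and B: "\<And>k. (\<integral>x. (u k x)\<^sup>2 \<partial>M) \<le> B"
  shows "integrable M (\<lambda>x. (v x)\<^sup>2)" "(\<integral>x. (v x)\<^sup>2 \<partial>M) \<le> B"
proof -
  have "B \<ge> 0" using B[of 0] by (rule order_trans[rotated]) simp
  have "(\<integral>\<^sup>+x. ennreal ((v x)\<^sup>2) \<partial>M) = (\<integral>\<^sup>+x. liminf (\<lambda>k. ennreal ((u k x)\<^sup>2)) \<partial>M)"
  proof (rule nn_integral_cong_AE)
    show "AE x in M. ennreal ((v x)\<^sup>2) = liminf (\<lambda>k. ennreal ((u k x)\<^sup>2))"
      using lim
    proof eventually_elim
      case (elim x)
      have "(\<lambda>k. ennreal ((u k x)\<^sup>2)) \<longlonglongrightarrow> ennreal ((v x)\<^sup>2)"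
        by (intro tendsto_ennrealI tendsto_power elim)
      then show ?case by (intro lim_imp_Liminf[symmetric]) auto
    qed
  qed
  also have "\<dots> \<le> liminf (\<lambda>k. \<integral>\<^sup>+x. ennreal ((u k x)\<^sup>2) \<partial>M)"
    by (rule nn_integral_liminf) measurable
  also have "\<dots> \<le> limsup (\<lambda>k. \<integral>\<^sup>+x. ennreal ((u k x)\<^sup>2) \<partial>M)"
    by (rule Liminf_le_Limsup) simp
  also have "\<dots> \<le> ennreal B"
    using B int by (intro Limsup_bounded always_eventually allI) (simp add: nn_integral_eq_integral ennreal_leI)
  finally have le: "(\<integral>\<^sup>+x. ennreal ((v x)\<^sup>2) \<partial>M) \<le> ennreal B" .
  show *: "integrable M (\<lambda>x. (v x)\<^sup>2)"
    by (rule integrableI_bounded) (use le in \<open>auto intro: le_less_trans\<close>)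
  show "(\<integral>x. (v x)\<^sup>2 \<partial>M) \<le> B"
    using le * \<open>B \<ge> 0\<close> by (simp add: nn_integral_eq_integral)
qed

text \<open>Along a rapidly converging subsequence the increments of the partial sums have summable
  L1 norms, so the subsequence converges almost everywhere. Fatou puts the limit into L2 and bounds
  its distance to the partial sums, which identifies its coefficients.\<close>

theorem riesz_fischer:
  fixes c :: "int^'n::finite \<Rightarrow> complex"
  assumes herm: "\<And>\<xi>. c (- \<xi>) = cnj (c \<xi>)" and sum: "(\<lambda>\<xi>. (cmod (c \<xi>))\<^sup>2) summable_on UNIV"
  shows "\<exists>h\<in>Lq 2. (\<forall>\<xi>. fourier (dist_of h) \<xi> = c \<xi>) \<and> (\<integral>x. (h x)\<^sup>2 \<partial>TM) \<le> (\<Sum>\<^sub>\<infinity>\<xi>. (cmod (c \<xi>))\<^sup>2)"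
proof -
  define s where "s = (\<Sum>\<^sub>\<infinity>\<xi>. (cmod (c \<xi>))\<^sup>2)"
  define a where "a N = (\<Sum>\<xi>\<in>cube N. (cmod (c \<xi>))\<^sup>2)" for N
  define S where "S N = trig_poly (cube N) c" for N
  have "((\<lambda>F. \<Sum>\<xi>\<in>F. (cmod (c \<xi>))\<^sup>2) \<longlongrightarrow> s) (finite_subsets_at_top UNIV)"
    using has_sum_infsum[OF sum] unfolding has_sum_def s_def .
  from filterlim_compose[OF this filterlim_cube] have a: "a \<longlonglongrightarrow> s" by (simp add: a_def[abs_def])
  have a_le: "a N \<le> s" for N unfolding a_def s_def by (intro finite_sum_le_infsum sum) auto
  have "\<exists>M. \<forall>n\<ge>M. s - a n < (1/4) ^ k" for k
  proof -
    have "\<exists>M. \<forall>n\<ge>M. norm (a n - s) < (1/4) ^ k" by (rule LIMSEQ_D[OF a]) simp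
    then show ?thesis unfolding real_norm_def by (metis abs_minus_commute abs_le_D1 abs_ge_self order_le_less_trans)
  qed
  then obtain m where m: "\<And>k n. n \<ge> m k \<Longrightarrow> s - a n < (1/4) ^ k" by metis
  \<comment> \<open>Monotone, beyond every \<open>m k\<close>, and at least \<open>k\<close>, so
    that each frequency is eventually inside the cube.\<close>
  define r where "r k = k + (\<Sum>i\<le>k. m i)" for k
  have r_ge: "k \<le> r k" "m k \<le> r k" for k
    unfolding r_def using member_le_sum[of k "{..k}" m] by auto
  have r_mono: "r i \<le> r j" if "i \<le> j" for i j
    unfolding r_def using that by (intro add_mono sum_mono2) auto
  have S_diff: "integrable TM (\<lambda>x. (S N x - S M x)\<^sup>2)" "(\<integral>x. (S N x - S M x)\<^sup>2 \<partial>TM) = a N - a M" if "M \<le> N" for M N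
  proof -
    have "(\<lambda>x. S N x - S M x) = trig_poly (cube N - cube M) c"
      using that by (simp add: S_def trig_poly_diff cube_mono fun_eq_iff)
    then have eq: "(\<lambda>x. (S N x - S M x)\<^sup>2) = (\<lambda>x. (trig_poly (cube N - cube M) c x)\<^sup>2)" by (simp add: fun_eq_iff)
    show "integrable TM (\<lambda>x. (S N x - S M x)\<^sup>2)" unfolding eq by (rule integrable_trig_poly_sq)
    have neg: "- \<xi> \<in> cube N - cube M" if "\<xi> \<in> cube N - cube M" for \<xi> :: "int^'n"
      using that cube_uminus[of "- \<xi>" M] by (auto intro: cube_uminus)
    show "(\<integral>x. (S N x - S M x)\<^sup>2 \<partial>TM) = a N - a M"
    proof -
      have "(\<integral>x. (S N x - S M x)\<^sup>2 \<partial>TM) = (\<Sum>\<xi>\<in>cube N - cube M. (cmod (c \<xi>))\<^sup>2)"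
        unfolding eq by (rule integral_trig_poly_sq) (use neg herm in auto)
      then show ?thesis using that by (simp add: a_def sum_diff cube_mono)
    qed
  qed
  have S_meas: "S N \<in> borel_measurable lebesgue" for N
    unfolding S_def by (intro continuous_measurable_lebesgue test_funs_continuous trig_poly_test)
  have S_per: "periodic (S N)" for N unfolding S_def by (intro test_funs_periodic trig_poly_test)
  note S_TM [measurable] = measurable_TM[OF S_meas]
  define g where "g k x = S (r (Suc k)) x - S (r k) x" for k x
  have g_int: "integrable TM (g k)" "(\<integral>x. \<bar>g k x\<bar> \<partial>TM) \<le> (1/2) ^ k" for k
  proof -
    have g2: "integrable TM (\<lambda>x. (g k x)\<^sup>2)" "(\<integral>x. (g k x)\<^sup>2 \<partial>TM) = a (r (Suc k)) - a (r k)"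
      unfolding g_def using r_mono[of k "Suc k"] by (simp_all add: S_diff)
    have gm: "g k \<in> borel_measurable TM" unfolding g_def[abs_def] by measurable
    show "integrable TM (g k)" by (rule integral_abs_sq_le[OF gm g2(1)])
    have "(\<integral>x. \<bar>g k x\<bar> \<partial>TM)\<^sup>2 \<le> a (r (Suc k)) - a (r k)"
      using integral_abs_sq_le(2)[OF gm g2(1)] g2(2) by simp
    also have "\<dots> \<le> (1/4) ^ k" using a_le[of "r (Suc k)"] m[OF r_ge(2), of k] by linarith
    also have "\<dots> = ((1/2) ^ k)\<^sup>2" by (simp add: power2_eq_square power_mult_distrib[symmetric])
    finally show "(\<integral>x. \<bar>g k x\<bar> \<partial>TM) \<le> (1/2) ^ k" by (rule power2_le_imp_le) simp
  qed
  have "(\<integral>\<^sup>+x. (\<Sum>k. ennreal \<bar>g k x\<bar>) \<partial>TM) = (\<Sum>k. \<integral>\<^sup>+x. ennreal \<bar>g k x\<bar> \<partial>TM)"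
    by (rule nn_integral_suminf) (simp add: g_def)
  also have "\<dots> \<le> (\<Sum>k. ennreal ((1/2) ^ k))"
    using g_int by (intro suminf_le) (auto simp: nn_integral_eq_integral ennreal_leI)
  also have "\<dots> = ennreal (\<Sum>k. (1/2) ^ k)"
    by (rule suminf_ennreal_eq[OF _ summable_sums]) (auto intro: summable_geometric)
  also have "\<dots> < \<infinity>" by simp
  finally have "(\<integral>\<^sup>+x. (\<Sum>k. ennreal \<bar>g k x\<bar>) \<partial>TM) \<noteq> \<infinity>" by simp
  then have "AE x in TM. (\<Sum>k. ennreal \<bar>g k x\<bar>) \<noteq> \<infinity>"
    by (intro nn_integral_PInf_AE) (simp_all add: g_def)
  then have conv: "AE x in TM. convergent (\<lambda>k. S (r k) x)"
  proof eventually_elim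
    case (elim x)
    then have "summable (\<lambda>k. \<bar>g k x\<bar>)" by (intro summable_suminf_not_top) auto
    then have "summable (\<lambda>k. g k x)" by (rule summable_rabs_cancel)
    then have "convergent (\<lambda>n. S (r 0) x + (\<Sum>k<n. g k x))"
      by (intro convergent_add convergent_const) (simp add: summable_iff_convergent)
    moreover have "S (r 0) x + (\<Sum>k<n. g k x) = S (r n) x" for n
      using sum_lessThan_telescope[of "\<lambda>k. S (r k) x" n] by (simp add: g_def)
    ultimately show ?case by simp
  qed
  \<comment> \<open>Defined at every point, also where the sequence diverges; equal sequences have
    equal \<open>lim\<close>, so \<open>f\<close> is periodic everywhere and not just almost
    everywhere.\<close>
  define f where "f x = lim (\<lambda>k. S (r k) x)" for x
  have f_lim: "AE x in TM. (\<lambda>k. S (r k) x) \<longlonglongrightarrow> f x"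
    using conv by eventually_elim (simp add: f_def convergent_LIMSEQ_iff)
  have f_meas: "f \<in> borel_measurable lebesgue"
    unfolding f_def[abs_def] by (rule borel_measurable_lim_metric) (rule S_meas)
  have f_per: "periodic f" using S_per by (simp add: periodic_def f_def)
  note [measurable] = measurable_TM[OF f_meas]
  have S2: "integrable TM (\<lambda>x. (S N x)\<^sup>2)" "(\<integral>x. (S N x)\<^sup>2 \<partial>TM) \<le> s" for N
    using a_le[of N] unfolding S_def
    by (auto simp: integrable_trig_poly_sq integral_trig_poly_sq cube_uminus herm a_def)
  have f2: "integrable TM (\<lambda>x. (f x)\<^sup>2)" "(\<integral>x. (f x)\<^sup>2 \<partial>TM) \<le> s"
    by (rule fatou_sq[OF _ _ f_lim S2]; measurable)+
  have fL: "f \<in> Lq 2" using f2 f_meas f_per by (simp add: Lq2_iff)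
  then have fL1: "f \<in> Lq 1" by (rule Lq_mono) auto
  have fS: "integrable TM (\<lambda>x. (f x - S (r k) x)\<^sup>2)" "(\<integral>x. (f x - S (r k) x)\<^sup>2 \<partial>TM) \<le> (1/4) ^ k" for k
  proof -
    have l: "AE x in TM. (\<lambda>j. S (r (j + k)) x - S (r k) x) \<longlonglongrightarrow> f x - S (r k) x"
      using f_lim by eventually_elim (intro tendsto_diff tendsto_const LIMSEQ_ignore_initial_segment)
    have b: "(\<integral>x. (S (r (j + k)) x - S (r k) x)\<^sup>2 \<partial>TM) \<le> (1/4) ^ k" for j
      using a_le[of "r (j + k)"] m[OF r_ge(2), of k] by (simp add: S_diff(2) r_mono)
    have m: "(\<lambda>x. S (r (j + k)) x - S (r k) x) \<in> borel_measurable TM"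
      "(\<lambda>x. f x - S (r k) x) \<in> borel_measurable TM" for j by measurable
    have i: "integrable TM (\<lambda>x. (S (r (j + k)) x - S (r k) x)\<^sup>2)" for j
      by (rule S_diff(1)[OF r_mono]) simp
    show "integrable TM (\<lambda>x. (f x - S (r k) x)\<^sup>2)"
      by (rule fatou_sq(1)[OF m l i b])
    show "(\<integral>x. (f x - S (r k) x)\<^sup>2 \<partial>TM) \<le> (1/4) ^ k"
      by (rule fatou_sq(2)[OF m l i b])
  qed
  have "fourier (dist_of f) \<xi> = c \<xi>" for \<xi>
  proof -
    have bound: "cmod (fourier (dist_of f) \<xi> - fourier (dist_of (S (r k))) \<xi>) \<le> 2 * (1/2) ^ k" for k
    proof -
      have "(\<integral>x. \<bar>f x - S (r k) x\<bar> \<partial>TM)\<^sup>2 \<le> (\<integral>x. (f x - S (r k) x)\<^sup>2 \<partial>TM)"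
        by (rule integral_abs_sq_le(2)[OF _ fS(1)]) measurable
      also have "\<dots> \<le> (1/4) ^ k" by (rule fS)
      also have "\<dots> = ((1/2) ^ k)\<^sup>2" by (simp add: power2_eq_square power_mult_distrib[symmetric])
      finally have "(\<integral>x. \<bar>f x - S (r k) x\<bar> \<partial>TM) \<le> (1/2) ^ k" by (rule power2_le_imp_le) simp
      then show ?thesis
        using norm_fourier_diff_le[OF fL1 test_funs_Lq1[OF trig_poly_test], of \<xi> "cube (r k)" c] by (simp add: S_def)
    qed
    obtain N where N: "{\<xi>} \<subseteq> cube N" using finite_subset_cube[of "{\<xi>}"] by auto
    have close: "cmod (fourier (dist_of f) \<xi> - c \<xi>) \<le> 2 * (1/2) ^ k" if "k \<ge> N" for k
    proof -
      have "\<xi> \<in> cube (r k)" using N cube_mono[of N "r k"] r_ge(1)[of k] that by auto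
      then show ?thesis using bound[of k] unfolding S_def by (subst (asm) fourier_trig_poly) (auto simp: cube_uminus herm)
    qed
    have lim0: "(\<lambda>k. 2 * (1/2) ^ k :: real) \<longlonglongrightarrow> 2 * 0"
      by (intro tendsto_mult tendsto_const LIMSEQ_realpow_zero) auto
    have "cmod (fourier (dist_of f) \<xi> - c \<xi>) \<le> 2 * 0"
      using close by (intro LIMSEQ_le_const[OF lim0]) blast
    then show ?thesis by simp
  qed
  then show ?thesis using fL f2(2) unfolding s_def by blast
qed

text \<open>\<open>riesz_fischer\<close> provides some representative and
  \<open>fourier_inject\<close> identifies its distribution. The norm bound passes to the chosen one
  because representatives agree almost everywhere.\<close>

lemma L2_rep_Lq: "D \<in> Hs 0 \<Longrightarrow> L2_rep D \<in> Lq 2"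
  and dist_of_L2_rep: "D \<in> Hs 0 \<Longrightarrow> dist_of (L2_rep D) = D"
  and L2_rep_norm: "D \<in> Hs 0 \<Longrightarrow> (\<integral>x. (L2_rep D x)\<^sup>2 \<partial>TM) \<le> (L2_norm D)\<^sup>2"
proof -
  assume D: "D \<in> Hs 0"
  then have "(\<lambda>\<xi>. (cmod (fourier D \<xi>))\<^sup>2) summable_on UNIV" by (simp add: Hs_def)
  from riesz_fischer[OF fourier_minus this] obtain h where
    h: "h \<in> Lq 2" "\<And>\<xi>. fourier (dist_of h) \<xi> = fourier D \<xi>"
    "(\<integral>x. (h x)\<^sup>2 \<partial>TM) \<le> (\<Sum>\<^sub>\<infinity>\<xi>. (cmod (fourier D \<xi>))\<^sup>2)" by blast
  have hD: "dist_of h = D" by (rule fourier_inject) (rule h)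
  then have "L2_rep D \<in> Lq 2 \<and> dist_of (L2_rep D) = D"
    unfolding L2_rep_def using h(1) by (intro someI[of "\<lambda>h. h \<in> Lq 2 \<and> dist_of h = D"]) simp
  then show 1: "L2_rep D \<in> Lq 2" and 2: "dist_of (L2_rep D) = D" by simp_all
  have "AE x in TM. L2_rep D x = h x"
    by (rule fourier_eq_AE) (use 1 2 h hD in \<open>auto intro: Lq_mono\<close>)
  then have "(\<integral>x. (L2_rep D x)\<^sup>2 \<partial>TM) = (\<integral>x. (h x)\<^sup>2 \<partial>TM)"
    using 1 h(1) by (intro integral_cong_AE) (auto simp: Lq2_iff intro!: borel_measurable_integrable elim!: eventually_mono)
  also have "\<dots> \<le> (L2_norm D)\<^sup>2"
    using h(3) by (simp add: Hs_norm_def infsum_nonneg)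
  finally show "(\<integral>x. (L2_rep D x)\<^sup>2 \<partial>TM) \<le> (L2_norm D)\<^sup>2" .
qed

lemma dist_of_eq_AE: "h \<in> Lq 1 \<Longrightarrow> k \<in> Lq 1 \<Longrightarrow> dist_of h = dist_of k \<Longrightarrow> AE x in TM. h x = k x"
  by (rule fourier_eq_AE) auto

section \<open>Multipliers\<close>

lemma trig_poly_term_le: "\<bar>Re z * cos t - Im z * sin t\<bar> \<le> cmod z"
proof -
  have "Re z * cos t - Im z * sin t = Re (z * cis t)" by simp
  then show ?thesis using abs_Re_le_cmod[of "z * cis t"] by (simp add: norm_mult)
qed

text \<open>Cauchy-Schwarz after splitting each term by the root of the weight; this is the
  pointwise bound for low frequencies.\<close>

lemma trig_poly_sq_le:
  "(trig_poly F c x)\<^sup>2 \<le> (\<Sum>\<xi>\<in>F. inverse (weight \<xi>)) * (\<Sum>\<xi>\<in>F. weight \<xi> * (cmod (c \<xi>))\<^sup>2)"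
proof -
  have "\<bar>trig_poly F c x\<bar> \<le> (\<Sum>\<xi>\<in>F. cmod (c \<xi>))"
    unfolding trig_poly_def by (intro order_trans[OF sum_abs] sum_mono trig_poly_term_le)
  also have "\<dots> = (\<Sum>\<xi>\<in>F. sqrt (inverse (weight \<xi>)) * (sqrt (weight \<xi>) * cmod (c \<xi>)))"
    by (intro sum.cong) (simp_all add: real_sqrt_inverse)
  finally have "(trig_poly F c x)\<^sup>2 \<le> (\<Sum>\<xi>\<in>F. sqrt (inverse (weight \<xi>)) * (sqrt (weight \<xi>) * cmod (c \<xi>)))\<^sup>2"
    using power_mono[OF _ abs_ge_zero, of "trig_poly F c x" _ 2] by (simp only: power2_abs)
  also have "\<dots> \<le> (\<Sum>\<xi>\<in>F. (sqrt (inverse (weight \<xi>)))\<^sup>2) * (\<Sum>\<xi>\<in>F. (sqrt (weight \<xi>) * cmod (c \<xi>))\<^sup>2)"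
    by (rule Cauchy_Schwarz_ineq_sum)
  also have "\<dots> = (\<Sum>\<xi>\<in>F. inverse (weight \<xi>)) * (\<Sum>\<xi>\<in>F. weight \<xi> * (cmod (c \<xi>))\<^sup>2)"
    by (simp add: power_mult_distrib)
  finally show ?thesis .
qed

text \<open>The largest power dominates a geometric sum. With \<open>w\<close> the weight of a
  frequency, it sums the factors of all levels at which that frequency counts as high.\<close>

lemma sum_powers_4_le:
  fixes w :: real
  assumes "finite A" "\<And>k. k \<in> A \<Longrightarrow> 4 ^ k \<le> w" "w \<ge> 0"
  shows "(\<Sum>k\<in>A. 4 ^ k) \<le> 2 * w"
proof (cases "A = {}")
  case False
  have geo: "(\<Sum>k\<le>n. 4 ^ k :: real) \<le> 2 * 4 ^ n" for n
  proof (induction n)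
    case (Suc n)
    moreover have "0 \<le> (4 :: real) ^ n" by simp
    ultimately show ?case unfolding sum.atMost_Suc power_Suc by linarith
  qed simp
  have "(\<Sum>k\<in>A. 4 ^ k :: real) \<le> (\<Sum>k\<le>Max A. 4 ^ k)"
    using assms(1) by (intro sum_mono2) auto
  also have "\<dots> \<le> 2 * 4 ^ Max A" by (rule geo)
  also have "\<dots> \<le> 2 * w" using assms(2)[OF Max_in[OF assms(1) False]] by simp
  finally show ?thesis .
qed (use assms in auto)

lemma dyadic_bracket:
  fixes u :: real
  assumes "u \<ge> 1" obtains k :: nat where "2 ^ k \<le> u" "u < 2 ^ Suc k"
proof -
  obtain m where m: "u < 2 ^ m" using real_arch_pow[of 2 u] by auto
  define l where "l = (LEAST m. u < 2 ^ m)"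
  have l: "u < 2 ^ l" unfolding l_def by (rule LeastI[of _ m]) (rule m)
  obtain k where k: "l = Suc k" using l assms by (cases l) auto
  have "\<not> u < 2 ^ k" using not_less_Least[of k "\<lambda>m. u < 2 ^ m"] k unfolding l_def by simp
  then show ?thesis using that[of k] l k by simp
qed

text \<open>In place of a Sobolev embedding, the level sets of \<open>w\<close> are matched with frequency
  cut-offs: where \<open>\<bar>w\<bar> \<approx> 2 ^ k\<close>, the frequencies up to \<open>2 ^ k\<close> are bounded pointwise and the rest is estimated in mean square.\<close>

theorem multiplier_bound:
  fixes w :: "real^'n::finite \<Rightarrow> real"
  assumes \<theta>: "\<theta> > 2" "\<theta> \<ge> real CARD('n)" and w: "w \<in> Lq \<theta>"
  obtains M where "M > 0"
    "\<forall>N c. (\<forall>\<xi>. c (- \<xi>) = cnj (c \<xi>)) \<longrightarrow> integrable TM (\<lambda>x. (w x * trig_poly (cube N) c x)\<^sup>2) \<and>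
        (\<integral>x. (w x * trig_poly (cube N) c x)\<^sup>2 \<partial>TM)
        \<le> M * (\<Sum>\<xi>\<in>cube N. weight \<xi> * (cmod (c \<xi>))\<^sup>2)"
proof -
  obtain K where K: "K > 0" "\<And>k. (\<Sum>\<xi>\<in>cube (2 ^ k). inverse (weight (\<xi> :: int^'n))) \<le> K * (2 powr (\<theta> - 2)) ^ k"
    using sum_inverse_weight_growth[OF \<theta>] by blast
  define I where "I = (\<integral>x. \<bar>w x\<bar> powr \<theta> \<partial>TM)"
  \<comment> \<open>1 from the set where \<open>w\<close> is small, 16 from the high frequencies,
    \<open>8 * K * I\<close> from the low ones.\<close>
  define M where "M = 17 + 8 * K * I"
  have w_int: "integrable TM (\<lambda>x. \<bar>w x\<bar> powr \<theta>)" using w by (simp add: Lq_iff)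
  have "w \<in> Lq 2" using Lq_mono[OF w, of 2] \<theta> by simp
  then have w2: "integrable TM (\<lambda>x. (w x)\<^sup>2)" by (simp add: Lq2_iff)
  have "I \<ge> 0" by (simp add: I_def)
  then have M: "M > 0" using K(1) by (simp add: M_def add_pos_nonneg)
  have int: "integrable TM (\<lambda>x. (w x * trig_poly (cube N) c x)\<^sup>2)" for N and c :: "int^'n \<Rightarrow> complex"
  proof -
    obtain B where "\<And>x. \<bar>trig_poly (cube N) c x * trig_poly (cube N) c x\<bar> \<le> B"
      using test_funs_bounded[OF trig_test_funs[OF trig_mult[OF trig_poly_trig trig_poly_trig]]] by blast
    then have "integrable TM (\<lambda>x. (w x)\<^sup>2 * (trig_poly (cube N) c x * trig_poly (cube N) c x))"
      by (intro integrable_mult_bounded[OF w2] measurable_TM continuous_measurable_lebesgue continuous_intros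
          test_funs_continuous trig_poly_test)
    then show ?thesis by (simp add: power2_eq_square mult_ac)
  qed
  have bound: "(\<integral>x. (w x * trig_poly (cube N) c x)\<^sup>2 \<partial>TM) \<le> M * (\<Sum>\<xi>\<in>cube N. weight \<xi> * (cmod (c \<xi>))\<^sup>2)"
    if herm: "\<And>\<xi>. c (- \<xi>) = cnj (c \<xi>)" for N and c :: "int^'n \<Rightarrow> complex"
  proof -
    define W where "W = (\<Sum>\<xi>\<in>cube N. weight \<xi> * (cmod (c \<xi>))\<^sup>2)"
    define v where "v = trig_poly (cube N) c"
    define hi where "hi k = trig_poly (cube N - cube (2 ^ k)) c" for k :: nat
    have "W \<ge> 0" by (simp add: W_def sum_nonneg)
    \<comment> \<open>The summands majorize, in turn, the set where \<bar>w\<bar> < 1, the low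
      frequencies and the high frequencies. Summing the high parts over all levels removes the
      dependence of the level on \<open>x\<close>, so that the bound can be integrated.\<close>
    have pw: "(w x * v x)\<^sup>2 \<le> (v x)\<^sup>2 + 8 * K * W * \<bar>w x\<bar> powr \<theta> + (\<Sum>k<N. 8 * 4 ^ k * (hi k x)\<^sup>2)" for x
    proof (cases "\<bar>w x\<bar> < 1")
      case True
      have "(w x * v x)\<^sup>2 \<le> 1 * (v x)\<^sup>2"
        unfolding power_mult_distrib using True by (intro mult_right_mono) (simp_all add: abs_square_le_1 less_imp_le)
      moreover have "0 \<le> 8 * K * W * \<bar>w x\<bar> powr \<theta>" using K(1) \<open>W \<ge> 0\<close> by simp
      moreover have "0 \<le> (\<Sum>k<N. 8 * 4 ^ k * (hi k x)\<^sup>2)" by (intro sum_nonneg) auto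
      ultimately show ?thesis by linarith
    next
      case False
      then obtain k where k: "2 ^ k \<le> \<bar>w x\<bar>" "\<bar>w x\<bar> < 2 ^ Suc k" using dyadic_bracket[of "\<bar>w x\<bar>"] by auto
      define lo where "lo = trig_poly (cube N \<inter> cube (2 ^ k)) c x"
      have v: "v x = lo + hi k x"
      proof -
        have "v x - lo = trig_poly (cube N - (cube N \<inter> cube (2 ^ k))) c x"
          unfolding v_def lo_def by (rule trig_poly_diff) auto
        moreover have "cube N - (cube N \<inter> cube (2 ^ k)) = cube N - (cube (2 ^ k) :: (int^'n) set)" by blast
        ultimately show ?thesis by (simp add: hi_def)
      qed
      have "(w x)\<^sup>2 \<le> (2 ^ Suc k)\<^sup>2" using k(2) by (intro abs_le_square_iff[THEN iffD1]) simp
      also have "\<dots> = 4 * 4 ^ k" by (simp add: power2_eq_square power_mult_distrib[symmetric])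
      finally have w4: "(w x)\<^sup>2 \<le> 4 * 4 ^ k" .
      have "(v x)\<^sup>2 \<le> 2 * lo\<^sup>2 + 2 * (hi k x)\<^sup>2"
        using zero_le_power2[of "lo - hi k x"] unfolding v by (simp add: power2_eq_square algebra_simps)
      then have "(w x * v x)\<^sup>2 \<le> (4 * 4 ^ k) * (2 * lo\<^sup>2 + 2 * (hi k x)\<^sup>2)"
        unfolding power_mult_distrib using w4 by (intro mult_mono) auto
      also have "\<dots> = 8 * (4 ^ k * lo\<^sup>2) + 8 * 4 ^ k * (hi k x)\<^sup>2" by (simp add: algebra_simps)
      finally have 1: "(w x * v x)\<^sup>2 \<le> 8 * (4 ^ k * lo\<^sup>2) + 8 * 4 ^ k * (hi k x)\<^sup>2" .
      have "lo\<^sup>2 \<le> (K * (2 powr (\<theta> - 2)) ^ k) * W"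
      proof -
        have "lo\<^sup>2 \<le> (\<Sum>\<xi>\<in>cube N \<inter> cube (2 ^ k). inverse (weight (\<xi> :: int^'n))) * (\<Sum>\<xi>\<in>cube N \<inter> cube (2 ^ k). weight \<xi> * (cmod (c \<xi>))\<^sup>2)"
          unfolding lo_def by (rule trig_poly_sq_le)
        also have "\<dots> \<le> (\<Sum>\<xi>\<in>cube (2 ^ k). inverse (weight (\<xi> :: int^'n))) * W"
          unfolding W_def by (intro mult_mono sum_mono2 sum_nonneg) auto
        also have "\<dots> \<le> (K * (2 powr (\<theta> - 2)) ^ k) * W" by (intro mult_right_mono K \<open>W \<ge> 0\<close>)
        finally show ?thesis .
      qed
      \<comment> \<open>The factor 4^k from the square of \<open>w\<close> and the growth of the
        lattice sum combine to \<open>(2 ^ k) powr \<theta>\<close>, which is at most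
        \<open>\<bar>w x\<bar> powr \<theta>\<close> on this level set.\<close>
      then have "4 ^ k * lo\<^sup>2 \<le> 4 ^ k * ((K * (2 powr (\<theta> - 2)) ^ k) * W)" by (intro mult_left_mono) auto
      also have "\<dots> = K * W * (4 * 2 powr (\<theta> - 2)) ^ k" by (simp add: power_mult_distrib mult_ac)
      also have "4 * 2 powr (\<theta> - 2) = 2 powr \<theta>" by (simp add: powr_diff)
      also have "(2 powr \<theta>) ^ k = (2 ^ k) powr \<theta>"
        by (simp add: powr_realpow[symmetric] powr_powr mult.commute)
      also have "K * W * (2 ^ k) powr \<theta> \<le> K * W * \<bar>w x\<bar> powr \<theta>"
        using k(1) \<theta> K(1) \<open>W \<ge> 0\<close> by (intro mult_left_mono powr_mono2) auto
      finally have 2: "4 ^ k * lo\<^sup>2 \<le> K * W * \<bar>w x\<bar> powr \<theta>" .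
      have 3: "8 * 4 ^ k * (hi k x)\<^sup>2 \<le> (\<Sum>k<N. 8 * 4 ^ k * (hi k x)\<^sup>2)"
      proof (cases "k < N")
        case True
        then show ?thesis by (intro member_le_sum) auto
      next
        case False
        \<comment> \<open>Beyond level \<open>N\<close> the cut-off already contains all frequencies
          of \<open>v\<close>.\<close>
        then have "N \<le> 2 ^ k" by (meson less_exp less_imp_le not_less order_trans)
        then have empty: "cube N - cube (2 ^ k) = ({} :: (int^'n) set)" using cube_mono by blast
        have "hi k x = 0" unfolding hi_def trig_poly_def empty by simp
        then show ?thesis by (simp add: sum_nonneg)
      qed
      show ?thesis using 1 2 3 zero_le_power2[of "v x"] by linarith
    qed
    have sym: "- \<xi> \<in> cube N - cube (2 ^ k)" if "\<xi> \<in> cube N - cube (2 ^ k)" for \<xi> :: "int^'n" and k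
      using that cube_uminus[of "- \<xi>" "2 ^ k"] by (auto intro: cube_uminus)
    have hi_int: "integrable TM (\<lambda>x. (hi k x)\<^sup>2)"
      "(\<integral>x. (hi k x)\<^sup>2 \<partial>TM) = (\<Sum>\<xi>\<in>cube N - cube (2 ^ k). (cmod (c \<xi>))\<^sup>2)" for k
      unfolding hi_def by (rule integrable_trig_poly_sq, rule integral_trig_poly_sq) (use herm sym in auto)
    have v_int: "integrable TM (\<lambda>x. (v x)\<^sup>2)" "(\<integral>x. (v x)\<^sup>2 \<partial>TM) = (\<Sum>\<xi>\<in>cube N. (cmod (c \<xi>))\<^sup>2)"
      unfolding v_def by (rule integrable_trig_poly_sq, rule integral_trig_poly_sq) (use herm cube_uminus in auto)
    have "(\<integral>x. (w x * v x)\<^sup>2 \<partial>TM) \<le> (\<integral>x. (v x)\<^sup>2 + 8 * K * W * \<bar>w x\<bar> powr \<theta> + (\<Sum>k<N. 8 * 4 ^ k * (hi k x)\<^sup>2) \<partial>TM)"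
      using int[of N c] v_int hi_int w_int pw unfolding v_def[symmetric] by (intro integral_mono) auto
    also have "\<dots> = (\<Sum>\<xi>\<in>cube N. (cmod (c \<xi>))\<^sup>2) + 8 * K * W * I +
        (\<Sum>k<N. 8 * 4 ^ k * (\<Sum>\<xi>\<in>cube N - cube (2 ^ k). (cmod (c \<xi>))\<^sup>2))"
      using v_int hi_int w_int by (simp add: I_def)
    also have "(\<Sum>k<N. 8 * 4 ^ k * (\<Sum>\<xi>\<in>cube N - cube (2 ^ k). (cmod (c \<xi>))\<^sup>2)) \<le> 16 * W"
    proof -
      \<comment> \<open>Exchange of the sums: a frequency is high only at levels \<open>k\<close>
        with 4^k at most its weight, so its factors add up to at most twice the weight.\<close>
      have "(\<Sum>k<N. 8 * 4 ^ k * (\<Sum>\<xi>\<in>cube N - cube (2 ^ k). (cmod (c \<xi>))\<^sup>2)) =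
          (\<Sum>k<N. \<Sum>\<xi>\<in>cube N. 8 * (cmod (c \<xi>))\<^sup>2 * (if \<xi> \<notin> cube (2 ^ k) then 4 ^ k else 0))"
      proof (rule sum.cong[OF refl])
        fix k
        have "(\<Sum>\<xi>\<in>cube N. 8 * (cmod (c \<xi>))\<^sup>2 * (if \<xi> \<notin> cube (2 ^ k) then 4 ^ k else 0)) =
            (\<Sum>\<xi>\<in>cube N - cube (2 ^ k). 8 * (cmod (c \<xi>))\<^sup>2 * 4 ^ k)"
          by (rule sum.mono_neutral_cong_right) auto
        then show "8 * 4 ^ k * (\<Sum>\<xi>\<in>cube N - cube (2 ^ k). (cmod (c \<xi>))\<^sup>2) =
            (\<Sum>\<xi>\<in>cube N. 8 * (cmod (c \<xi>))\<^sup>2 * (if \<xi> \<notin> cube (2 ^ k) then 4 ^ k else 0))"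
          by (simp add: sum_distrib_left mult_ac)
      qed
      also have "\<dots> = (\<Sum>\<xi>\<in>cube N. 8 * (cmod (c \<xi>))\<^sup>2 * (\<Sum>k<N. if \<xi> \<notin> cube (2 ^ k) then 4 ^ k else 0))"
        by (subst sum.swap) (simp add: sum_distrib_left)
      also have "\<dots> \<le> (\<Sum>\<xi>\<in>cube N. 8 * (cmod (c \<xi>))\<^sup>2 * (2 * weight \<xi>))"
      proof (intro sum_mono mult_left_mono)
        fix \<xi> :: "int^'n"
        have "(\<Sum>k<N. if \<xi> \<notin> cube (2 ^ k) then 4 ^ k else 0) = (\<Sum>k\<in>{k\<in>{..<N}. \<xi> \<notin> cube (2 ^ k)}. 4 ^ k :: real)"
          by (rule sum.inter_filter[symmetric]) simp
        also have "\<dots> \<le> 2 * weight \<xi>"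
        proof (rule sum_powers_4_le)
          show "4 ^ k \<le> weight \<xi>" if "k \<in> {k\<in>{..<N}. \<xi> \<notin> cube (2 ^ k)}" for k
            using that weight_outside_cube[of \<xi> "2 ^ k"] by (simp add: power2_eq_square power_mult_distrib[symmetric])
        qed auto
        finally show "(\<Sum>k<N. if \<xi> \<notin> cube (2 ^ k) then 4 ^ k else 0) \<le> 2 * weight \<xi>" .
      qed auto
      also have "\<dots> = 16 * W" unfolding W_def sum_distrib_left by (intro sum.cong) auto
      finally show ?thesis .
    qed
    also have "(\<Sum>\<xi>\<in>cube N. (cmod (c \<xi>))\<^sup>2) \<le> W"
    proof -
      have "1 * (cmod (c \<xi>))\<^sup>2 \<le> weight \<xi> * (cmod (c \<xi>))\<^sup>2" for \<xi>
        by (intro mult_right_mono weight_ge_1) auto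
      then show ?thesis unfolding W_def by (intro sum_mono) simp
    qed
    finally have "(\<integral>x. (w x * v x)\<^sup>2 \<partial>TM) \<le> W + 8 * K * W * I + 16 * W" by simp
    then show ?thesis unfolding M_def W_def v_def by (simp add: algebra_simps)
  qed
  show ?thesis by (rule that[OF M]) (use int bound in auto)
qed

lemma Lq_mult:
  assumes "w \<in> Lq 2" "h \<in> Lq 2" shows "(\<lambda>x. w x * h x) \<in> Lq 1"
proof -
  have m: "w \<in> borel_measurable lebesgue" "h \<in> borel_measurable lebesgue" using assms by (auto simp: Lq2_iff)
  have "integrable TM (\<lambda>x. w x * h x)"
  proof (rule Bochner_Integration.integrable_bound)
    show "integrable TM (\<lambda>x. (w x)\<^sup>2 + (h x)\<^sup>2)" using assms by (simp add: Lq2_iff)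
    have ab: "\<bar>a * b\<bar> \<le> a\<^sup>2 + b\<^sup>2" for a b :: real
    proof -
      have "2 * (\<bar>a\<bar> * \<bar>b\<bar>) \<le> a\<^sup>2 + b\<^sup>2"
        using sum_squares_bound[of "\<bar>a\<bar>" "\<bar>b\<bar>"] by (simp add: mult.assoc)
      moreover have "0 \<le> \<bar>a\<bar> * \<bar>b\<bar>" by simp
      ultimately show ?thesis unfolding abs_mult by linarith
    qed
    show "AE x in TM. norm (w x * h x) \<le> norm ((w x)\<^sup>2 + (h x)\<^sup>2)"
      unfolding real_norm_def by (intro AE_I2 order_trans[OF ab abs_ge_self])
    show "(\<lambda>x. w x * h x) \<in> borel_measurable TM" using measurable_TM[OF m(1)] measurable_TM[OF m(2)] by simp
  qed
  then show ?thesis using assms m by (auto simp: Lq1_iff Lq2_iff periodic_def intro: borel_measurable_times)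
qed

text \<open>By duality with the preceding bound, tested on the trigonometric polynomial with the
  coefficients \<open>fourier (fmult w D) \<xi> / weight \<xi>\<close>.\<close>

lemma fmult_bound:
  fixes w :: "real^'n::finite \<Rightarrow> real"
  assumes \<theta>: "\<theta> > 2" "\<theta> \<ge> real CARD('n)" and w: "w \<in> Lq \<theta>"
  obtains M where "M > 0" "\<And>D. D \<in> Hs 0 \<Longrightarrow> fmult w D \<in> Hs (-1)"
    "\<And>D. D \<in> Hs 0 \<Longrightarrow> Hs_norm (-1) (fmult w D) \<le> M * L2_norm D"
proof -
  obtain M where M: "M > 0"
    and M_all: "\<forall>N c. (\<forall>\<xi>. c (- \<xi>) = cnj (c \<xi>)) \<longrightarrow>
        integrable TM (\<lambda>x. (w x * trig_poly (cube N) c x)\<^sup>2) \<and>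
        (\<integral>x. (w x * trig_poly (cube N) c x)\<^sup>2 \<partial>TM) \<le> M * (\<Sum>\<xi>\<in>cube N. weight \<xi> * (cmod (c \<xi>))\<^sup>2)"
    by (rule multiplier_bound[OF assms])
  have w2: "w \<in> Lq 2" using Lq_mono[OF w, of 2] \<theta> by simp
  have fin: "(\<Sum>\<xi>\<in>cube N. weight \<xi> powr (-1) * (cmod (fourier (fmult w D) \<xi>))\<^sup>2) \<le> M * (L2_norm D)\<^sup>2"
    if D: "D \<in> Hs 0" for D N
  proof -
    let ?h = "L2_rep D" and ?G = "fourier (fmult w D)"
    define c where "c \<xi> = ?G \<xi> / weight \<xi>" for \<xi>
    define v where "v = trig_poly (cube N) c"
    have herm: "c (- \<xi>) = cnj (c \<xi>)" for \<xi> by (simp add: c_def fourier_minus)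
    define Q where "Q = (\<Sum>\<xi>\<in>cube N. (cmod (?G \<xi>))\<^sup>2 / weight \<xi>)"
    have h: "?h \<in> Lq 2" by (rule L2_rep_Lq[OF D])
    have wh: "(\<lambda>x. w x * ?h x) \<in> Lq 1" by (rule Lq_mult[OF w2 h])
    have "(\<integral>x. (w x * ?h x) * v x \<partial>TM) = dapply (fmult w D) v"
      unfolding fmult_def v_def by (rule dapply_dist_of[symmetric, OF wh trig_poly_test])
    also have "\<dots> = Re (\<Sum>\<xi>\<in>cube N. c \<xi> * cnj (?G \<xi>))"
      unfolding v_def dapply_trig_poly fourier_minus ..
    also have "\<dots> = Q"
      by (simp add: Q_def c_def complex_norm_square[symmetric] Re_sum)
    finally have 1: "(\<integral>x. (w x * ?h x) * v x \<partial>TM) = Q" .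
    have vint: "integrable TM (\<lambda>x. (w x * v x)\<^sup>2)" using M_all herm unfolding v_def by blast
    have "(\<integral>x. (w x * v x)\<^sup>2 \<partial>TM) \<le> M * (\<Sum>\<xi>\<in>cube N. weight \<xi> * (cmod (c \<xi>))\<^sup>2)"
      using M_all herm unfolding v_def by blast
    also have "(\<Sum>\<xi>\<in>cube N. weight \<xi> * (cmod (c \<xi>))\<^sup>2) = Q"
      unfolding Q_def by (intro sum.cong) (simp_all add: c_def norm_divide power_divide power2_eq_square)
    finally have 2: "(\<integral>x. (w x * v x)\<^sup>2 \<partial>TM) \<le> M * Q" .
    have hint: "integrable TM (\<lambda>x. (?h x)\<^sup>2)" using h by (simp add: Lq2_iff)
    \<comment> \<open>Young's inequality with parameter \<open>M\<close>. It leaves one half of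
      \<open>Q\<close> on the right, which can be absorbed because \<open>Q\<close> is a finite
      sum.\<close>
    have "Q \<le> (\<integral>x. (1/2) * (M * (?h x)\<^sup>2 + (w x * v x)\<^sup>2 / M) \<partial>TM)"
      unfolding 1[symmetric]
    proof (rule integral_mono)
      show "integrable TM (\<lambda>x. (w x * ?h x) * v x)"
        unfolding v_def by (intro integrable_Lq1_test wh trig_poly_test)
      show "integrable TM (\<lambda>x. (1/2) * (M * (?h x)\<^sup>2 + (w x * v x)\<^sup>2 / M))" using hint vint by simp
      show "(w x * ?h x) * v x \<le> (1/2) * (M * (?h x)\<^sup>2 + (w x * v x)\<^sup>2 / M)" for x
      proof -
        have "0 \<le> (M * ?h x - w x * v x)\<^sup>2 / M" using M by simp
        also have "\<dots> = M * (?h x)\<^sup>2 + (w x * v x)\<^sup>2 / M - 2 * ((w x * ?h x) * v x)"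
          using M by (simp add: field_simps power2_eq_square)
        finally have "2 * ((w x * ?h x) * v x) \<le> M * (?h x)\<^sup>2 + (w x * v x)\<^sup>2 / M"
          unfolding diff_ge_0_iff_ge .
        moreover have "2 * a \<le> b \<Longrightarrow> a \<le> (1/2) * b" for a b :: real by simp
        ultimately show ?thesis by blast
      qed
    qed
    also have "\<dots> = (1/2) * (M * (\<integral>x. (?h x)\<^sup>2 \<partial>TM) + (\<integral>x. (w x * v x)\<^sup>2 \<partial>TM) / M)"
      using hint vint by simp
    also have "\<dots> \<le> (1/2) * (M * (L2_norm D)\<^sup>2 + (M * Q) / M)"
      using M 2 L2_rep_norm[OF D] by (intro mult_left_mono add_mono divide_right_mono) auto
    finally have "Q \<le> M * (L2_norm D)\<^sup>2" using M by simp
    moreover have "(\<Sum>\<xi>\<in>cube N. weight \<xi> powr (-1) * (cmod (?G \<xi>))\<^sup>2) = Q"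
      unfolding Q_def by (intro sum.cong) (simp_all add: powr_minus field_simps)
    ultimately show ?thesis by simp
  qed
  show ?thesis
  proof (rule that[of "sqrt M"])
    show "sqrt M > 0" using M by simp
    fix D :: "'n pdist" assume D: "D \<in> Hs 0"
    show "fmult w D \<in> Hs (-1)"
      unfolding Hs_def mem_Collect_eq by (rule summable_on_cubes(1)[OF _ fin[OF D]]) simp
    have "(\<Sum>\<^sub>\<infinity>\<xi>. weight \<xi> powr (-1) * (cmod (fourier (fmult w D) \<xi>))\<^sup>2) \<le> M * (L2_norm D)\<^sup>2"
      by (rule summable_on_cubes(2)[OF _ fin[OF D]]) simp
    then have "Hs_norm (-1) (fmult w D) \<le> sqrt (M * (L2_norm D)\<^sup>2)"
      unfolding Hs_norm_def by (rule real_sqrt_le_mono)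
    then show "Hs_norm (-1) (fmult w D) \<le> sqrt M * L2_norm D"
      by (simp add: real_sqrt_mult Hs_norm_def infsum_nonneg)
  qed
qed

section \<open>Linearity of multiplication\<close>

lemma Hs_add: "g \<in> Hs s \<Longrightarrow> h \<in> Hs s \<Longrightarrow> g + h \<in> Hs s"
proof -
  assume "g \<in> Hs s" "h \<in> Hs s"
  then have "(\<lambda>\<xi>. (norm ((weight \<xi> powr (s/2)) *\<^sub>R fourier g \<xi> + (weight \<xi> powr (s/2)) *\<^sub>R fourier h \<xi>))\<^sup>2) summable_on UNIV"
    by (intro square_summable_add) (simp_all add: Hs_def power_mult_distrib powr_power)
  then show ?thesis
    by (simp add: Hs_def power_mult_distrib powr_power scaleR_right_distrib[symmetric])
qed

lemma Hs_scale: "g \<in> Hs s \<Longrightarrow> c *\<^sub>R g \<in> Hs s"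
  using summable_on_cmult_right[of "\<lambda>\<xi>. weight \<xi> powr s * (cmod (fourier g \<xi>))\<^sup>2" UNIV "c\<^sup>2"]
  by (simp add: Hs_def power_mult_distrib mult_ac)

text \<open>The choice inside \<open>L2_rep\<close> is immaterial. This gives linearity of
  \<open>fmult\<close> and lets products with trigonometric polynomials be computed with the
  polynomial itself.\<close>

lemma fmult_cong_AE:
  assumes "w \<in> Lq 2" "D \<in> Hs 0" "h \<in> Lq 2" "dist_of h = D"
  shows "fmult w D = dist_of (\<lambda>x. w x * h x)"
proof -
  have "AE x in TM. L2_rep D x = h x"
  proof (rule dist_of_eq_AE)
    show "L2_rep D \<in> Lq 1" by (rule Lq_mono[OF L2_rep_Lq[OF assms(2)]]) auto
    show "h \<in> Lq 1" by (rule Lq_mono[OF assms(3)]) auto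
    show "dist_of (L2_rep D) = dist_of h" by (simp add: assms dist_of_L2_rep)
  qed
  then have "AE x in TM. w x * L2_rep D x = w x * h x" by eventually_elim simp
  then show ?thesis unfolding fmult_def
    by (intro dist_of_cong_AE Lq_mult assms L2_rep_Lq)
qed

lemma Lq2_add: "h \<in> Lq 2 \<Longrightarrow> k \<in> Lq 2 \<Longrightarrow> (\<lambda>x. h x + k x) \<in> Lq 2"
proof -
  assume hk: "h \<in> Lq 2" "k \<in> Lq 2"
  have "integrable TM (\<lambda>x. (h x)\<^sup>2 + 2 * (h x * k x) + (k x)\<^sup>2)"
    using Lq_mult[OF hk] hk by (simp add: Lq1_iff Lq2_iff)
  then show ?thesis using hk
    by (auto simp: Lq2_iff periodic_def power2_sum mult_ac add_ac intro: borel_measurable_add)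
qed

lemma Lq2_scale: "h \<in> Lq 2 \<Longrightarrow> (\<lambda>x. c * h x) \<in> Lq 2"
  by (auto simp: Lq2_iff periodic_def power_mult_distrib intro: borel_measurable_times)

lemma fmult_add:
  assumes w: "w \<in> Lq 2" and D: "D \<in> Hs 0" "E \<in> Hs 0"
  shows "fmult w (D + E) = fmult w D + fmult w E"
proof -
  note L = L2_rep_Lq[OF D(1)] L2_rep_Lq[OF D(2)]
  have L1: "L2_rep D \<in> Lq 1" "L2_rep E \<in> Lq 1" using L by (auto intro: Lq_mono)
  have "fmult w (D + E) = dist_of (\<lambda>x. w x * (L2_rep D x + L2_rep E x))"
    by (rule fmult_cong_AE) (simp_all add: w Hs_add D Lq2_add L dist_of_add L1 dist_of_L2_rep)
  also have "\<dots> = fmult w D + fmult w E"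
    unfolding fmult_def distrib_left by (intro dist_of_add Lq_mult w L)
  finally show ?thesis .
qed

lemma fmult_scale:
  assumes w: "w \<in> Lq 2" and D: "D \<in> Hs 0"
  shows "fmult w (c *\<^sub>R D) = c *\<^sub>R fmult w D"
proof -
  note L = L2_rep_Lq[OF D]
  have L1: "L2_rep D \<in> Lq 1" using L by (auto intro: Lq_mono)
  have "fmult w (c *\<^sub>R D) = dist_of (\<lambda>x. w x * (c * L2_rep D x))"
    by (rule fmult_cong_AE) (simp_all add: w Hs_scale D Lq2_scale L dist_of_scale L1 dist_of_L2_rep)
  also have "\<dots> = dist_of (\<lambda>x. c * (w x * L2_rep D x))" by (simp add: mult_ac)
  also have "\<dots> = c *\<^sub>R fmult w D"
    unfolding fmult_def by (intro dist_of_scale Lq_mult w L)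
  finally show ?thesis .
qed

section \<open>Sobolev spaces as square-summable families\<close>

lemma weight_powr_half_sq: "(weight \<xi> powr (s/2))\<^sup>2 = weight \<xi> powr s"
  by (simp add: power2_eq_square powr_add[symmetric])

lemma weight_zero [simp]: "weight 0 = 1"
  by (simp add: weight_def)

lemma infsum_finite_sum:
  fixes f :: "'k \<Rightarrow> 'i \<Rightarrow> 'b::{topological_comm_monoid_add, t2_space}"
  assumes "\<And>k. k \<in> K \<Longrightarrow> f k summable_on A"
  shows "(\<lambda>i. \<Sum>k\<in>K. f k i) summable_on A" "(\<Sum>\<^sub>\<infinity>i\<in>A. \<Sum>k\<in>K. f k i) = (\<Sum>k\<in>K. \<Sum>\<^sub>\<infinity>i\<in>A. f k i)"
  using assms
proof (induction K rule: infinite_finite_induct)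
  case (insert x F)
  { case 1 then show ?case using insert by (simp add: summable_on_add) }
  { case 2 then show ?case using insert by (simp add: infsum_add) }
qed auto

text \<open>In these coordinates the duality pairing of the spaces of orders \<open>- s\<close> and \<open>s\<close> becomes the
  inner product, and the Riesz isomorphism between them becomes the identity.\<close>

definition sembed :: "real \<Rightarrow> 'n::finite pdist \<Rightarrow> (int^'n, complex) ell2" where
  "sembed s g = Abs_ell2 (\<lambda>\<xi>. (weight \<xi> powr (s/2)) *\<^sub>R fourier g \<xi>)"

lemma sembed_nth:
  "g \<in> Hs s \<Longrightarrow> ell2_nth (sembed s g) \<xi> = (weight \<xi> powr (s/2)) *\<^sub>R fourier g \<xi>"
  unfolding sembed_def by (subst ell2_nth_Abs) (simp_all add: Hs_def power_mult_distrib weight_powr_half_sq)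

lemma norm_sembed: "g \<in> Hs s \<Longrightarrow> norm (sembed s g) = Hs_norm s g"
proof -
  assume g: "g \<in> Hs s"
  have "(norm (sembed s g))\<^sup>2 = (\<Sum>\<^sub>\<infinity>\<xi>. weight \<xi> powr s * (cmod (fourier g \<xi>))\<^sup>2)"
    by (simp add: norm_ell2_sq sembed_nth[OF g] power_mult_distrib weight_powr_half_sq)
  then show ?thesis unfolding Hs_norm_def by (intro real_sqrt_unique[symmetric]) simp_all
qed

lemma sembed_add: "g \<in> Hs s \<Longrightarrow> h \<in> Hs s \<Longrightarrow> sembed s (g + h) = sembed s g + sembed s h"
  by (rule ell2_eqI) (simp add: sembed_nth Hs_add scaleR_right_distrib)

lemma sembed_scale: "g \<in> Hs s \<Longrightarrow> sembed s (c *\<^sub>R g) = c *\<^sub>R sembed s g"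
  by (rule ell2_eqI) (simp add: sembed_nth Hs_scale)

lemma Hs_zero: "0 \<in> Hs s"
  by (simp add: Hs_def)

lemma Hs_uminus: "g \<in> Hs s \<Longrightarrow> - g \<in> Hs s"
  using Hs_scale[of g s "-1"] by simp

lemma Hs_diff: "g \<in> Hs s \<Longrightarrow> h \<in> Hs s \<Longrightarrow> g - h \<in> Hs s"
  using Hs_add[of g s "- h"] Hs_uminus[of h s] by simp

lemma Hs_sum: "(\<And>i. i \<in> I \<Longrightarrow> g i \<in> Hs s) \<Longrightarrow> (\<Sum>i\<in>I. g i) \<in> Hs s"
  by (induction I rule: infinite_finite_induct) (auto simp: Hs_zero Hs_add)

lemma sembed_uminus: "g \<in> Hs s \<Longrightarrow> sembed s (- g) = - sembed s g"
  using sembed_scale[of g s "-1"] by simp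

lemma sembed_diff: "g \<in> Hs s \<Longrightarrow> h \<in> Hs s \<Longrightarrow> sembed s (g - h) = sembed s g - sembed s h"
  using sembed_add[of g s "- h"] by (simp add: Hs_uminus sembed_uminus)

lemma Hs_norm_nonneg [simp]: "Hs_norm s g \<ge> 0"
  by (simp add: Hs_norm_def infsum_nonneg)

lemma Hs_norm_triangle: "g \<in> Hs s \<Longrightarrow> h \<in> Hs s \<Longrightarrow> Hs_norm s (g + h) \<le> Hs_norm s g + Hs_norm s h"
  using norm_triangle_ineq[of "sembed s g" "sembed s h"]
  by (simp add: sembed_add[symmetric] norm_sembed Hs_add)

lemma Hs_norm_zero [simp]: "Hs_norm s 0 = 0"
  by (simp add: Hs_norm_def)

lemma Hs_norm_sum:
  "(\<And>i. i \<in> I \<Longrightarrow> g i \<in> Hs s) \<Longrightarrow> Hs_norm s (\<Sum>i\<in>I. g i) \<le> (\<Sum>i\<in>I. Hs_norm s (g i))"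
proof (induction I rule: infinite_finite_induct)
  case (insert x F)
  then have "Hs_norm s (g x + sum g F) \<le> Hs_norm s (g x) + Hs_norm s (sum g F)"
    by (intro Hs_norm_triangle Hs_sum) auto
  then show ?case using insert by force
qed auto

lemma norm_fourier_le_Hs_norm:
  assumes "g \<in> Hs s" shows "weight \<xi> powr (s/2) * cmod (fourier g \<xi>) \<le> Hs_norm s g"
  using norm_ell2_nth_le[of "sembed s g" \<xi>] assms by (simp add: sembed_nth norm_sembed)

text \<open>The common source of the bounds for Fourier multipliers. The comparison family may take
  values in any inner product space, so a component can be compared with a whole vector
  field.\<close>

lemma Hs_dominated:
  fixes x :: "(int^'n::finite, 'b::real_inner) ell2"
  assumes "K \<ge> 0" and le: "\<And>\<xi>. weight \<xi> powr (s/2) * cmod (fourier g \<xi>) \<le> K * norm (ell2_nth x \<xi>)"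
  shows "g \<in> Hs s" "Hs_norm s g \<le> K * norm x"
proof -
  have le2: "weight \<xi> powr s * (cmod (fourier g \<xi>))\<^sup>2 \<le> K\<^sup>2 * (norm (ell2_nth x \<xi>))\<^sup>2" for \<xi>
    using power_mono[OF le[of \<xi>], of 2] by (simp add: power_mult_distrib weight_powr_half_sq)
  have sm: "(\<lambda>\<xi>. K\<^sup>2 * (norm (ell2_nth x \<xi>))\<^sup>2) summable_on UNIV"
    by (intro summable_on_cmult_right ell2_summable)
  show g: "g \<in> Hs s" unfolding Hs_def mem_Collect_eq
    by (rule summable_on_comparison_test[OF sm]) (use le2 in auto)
  have "(\<Sum>\<^sub>\<infinity>\<xi>. weight \<xi> powr s * (cmod (fourier g \<xi>))\<^sup>2) \<le> (\<Sum>\<^sub>\<infinity>\<xi>. K\<^sup>2 * (norm (ell2_nth x \<xi>))\<^sup>2)"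
    using g by (intro infsum_mono sm le2) (simp add: Hs_def)
  also have "\<dots> = (K * norm x)\<^sup>2"
    by (simp add: infsum_cmult_right' norm_ell2_sq power_mult_distrib)
  finally show "Hs_norm s g \<le> K * norm x"
    using \<open>K \<ge> 0\<close> by (simp add: Hs_norm_def real_le_lsqrt)
qed

text \<open>The two weights cancel, and \<open>fourier h (- \<xi>)\<close> is a conjugate, so the
  real part of the product is the inner product of the complex plane. Absolute summability allows
  the real part to be taken termwise.\<close>

lemma pairing_eq_inner:
  assumes g: "g \<in> Hs (- s)" and h: "h \<in> Hs s"
  shows "pairing g h = sembed (- s) g \<bullet> sembed s h"
proof -
  have w: "(weight \<xi> powr (- s / 2)) * (weight \<xi> powr (s/2)) = 1" for \<xi>
    by (simp add: powr_add[symmetric])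
  have t: "ell2_nth (sembed (- s) g) \<xi> \<bullet> ell2_nth (sembed s h) \<xi> = Re (fourier g \<xi> * fourier h (- \<xi>))" for \<xi>
  proof -
    have "ell2_nth (sembed (- s) g) \<xi> \<bullet> ell2_nth (sembed s h) \<xi> =
        ((weight \<xi> powr (- s / 2)) * (weight \<xi> powr (s/2))) * (fourier g \<xi> \<bullet> fourier h \<xi>)"
      by (simp add: sembed_nth[OF g] sembed_nth[OF h])
    then show ?thesis unfolding w by (simp add: fourier_minus inner_complex_def)
  qed
  have "(\<lambda>\<xi>. norm (ell2_nth (sembed (- s) g) \<xi>) \<bullet> norm (ell2_nth (sembed s h) \<xi>)) summable_on UNIV"
    by (rule square_summable_inner) (simp_all add: ell2_summable)
  moreover have "norm (ell2_nth (sembed (- s) g) \<xi>) \<bullet> norm (ell2_nth (sembed s h) \<xi>) = norm (fourier g \<xi> * fourier h (- \<xi>))" for \<xi>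
  proof -
    have "norm (ell2_nth (sembed (- s) g) \<xi>) * norm (ell2_nth (sembed s h) \<xi>) =
        ((weight \<xi> powr (- s / 2)) * (weight \<xi> powr (s/2))) * (cmod (fourier g \<xi>) * cmod (fourier h \<xi>))"
      by (simp add: sembed_nth[OF g] sembed_nth[OF h])
    then show ?thesis unfolding w by (simp add: fourier_minus norm_mult)
  qed
  ultimately have "(\<lambda>\<xi>. fourier g \<xi> * fourier h (- \<xi>)) summable_on UNIV"
    by (simp add: abs_summable_summable)
  then show ?thesis
    unfolding pairing_def inner_ell2_eq t by (rule infsum_Re[symmetric])
qed

lemma pairing_add_left: "g \<in> Hs (- s) \<Longrightarrow> g' \<in> Hs (- s) \<Longrightarrow> h \<in> Hs s \<Longrightarrow> pairing (g + g') h = pairing g h + pairing g' h"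
  by (simp add: pairing_eq_inner[where s = s] Hs_add sembed_add inner_add_left)

lemma pairing_add_right: "g \<in> Hs (- s) \<Longrightarrow> h \<in> Hs s \<Longrightarrow> h' \<in> Hs s \<Longrightarrow> pairing g (h + h') = pairing g h + pairing g h'"
  by (simp add: pairing_eq_inner[where s = s] Hs_add sembed_add inner_add_right)

lemma pairing_scale_right: "g \<in> Hs (- s) \<Longrightarrow> h \<in> Hs s \<Longrightarrow> pairing g (c *\<^sub>R h) = c * pairing g h"
  by (simp add: pairing_eq_inner[where s = s] Hs_scale sembed_scale)

lemma pairing_zero_left [simp]: "pairing 0 h = 0"
  by (simp add: pairing_def)

lemma pairing_uminus_left: "pairing (- g) h = - pairing g h"
  by (simp add: pairing_def infsum_uminus)

lemma pairing_sum_left: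
  "(\<And>i. i \<in> I \<Longrightarrow> g i \<in> Hs (- s)) \<Longrightarrow> h \<in> Hs s \<Longrightarrow> pairing (\<Sum>i\<in>I. g i) h = (\<Sum>i\<in>I. pairing (g i) h)"
  by (induction I rule: infinite_finite_induct) (auto simp: pairing_add_left[where s=s] Hs_sum)

text \<open>The symbol of a derivative is odd in the frequency, and the second factor is evaluated
  at \<open>- \<xi>\<close>; the two sums agree term by term.\<close>

lemma pairing_ddiff: "pairing D (ddiff j v) = - pairing (ddiff j D) v"
proof -
  have "(\<Sum>\<^sub>\<infinity>\<xi>. fourier D \<xi> * fourier (ddiff j v) (- \<xi>)) = (\<Sum>\<^sub>\<infinity>\<xi>. - (fourier (ddiff j D) \<xi> * fourier v (- \<xi>)))"
    by (intro infsum_cong) (simp add: fourier_ddiff)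
  then show ?thesis by (simp add: pairing_def infsum_uminus)
qed

section \<open>Vector fields in coordinates\<close>

definition vembed :: "real \<Rightarrow> 'n::finite vdist \<Rightarrow> (int^'n, complex^'n) ell2" where
  "vembed s u = Abs_ell2 (\<lambda>\<xi>. \<chi> k. (weight \<xi> powr (s/2)) *\<^sub>R fourier (u $ k) \<xi>)"

lemma norm_vec_sq: "(norm (x :: 'b::real_inner ^ 'n))\<^sup>2 = (\<Sum>k\<in>UNIV. (norm (x $ k))\<^sup>2)"
  by (simp add: power2_norm_eq_inner inner_vec_def)

lemma vembed_nth:
  assumes "\<And>k. u $ k \<in> Hs s"
  shows "ell2_nth (vembed s u) \<xi> $ k = (weight \<xi> powr (s/2)) *\<^sub>R fourier (u $ k) \<xi>"
  unfolding vembed_def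
proof (subst ell2_nth_Abs)
  show "(\<lambda>\<xi>. (norm (\<chi> k. (weight \<xi> powr (s/2)) *\<^sub>R fourier (u $ k) \<xi>))\<^sup>2) summable_on UNIV"
    unfolding norm_vec_sq using assms
    by (intro infsum_finite_sum) (simp_all add: Hs_def power_mult_distrib weight_powr_half_sq)
qed simp

lemma vembed_sembed: "(\<And>k. u $ k \<in> Hs s) \<Longrightarrow> ell2_nth (vembed s u) \<xi> $ k = ell2_nth (sembed s (u $ k)) \<xi>"
  by (simp add: vembed_nth sembed_nth)

lemma inner_vembed:
  assumes "\<And>k. u $ k \<in> Hs s" "\<And>k. v $ k \<in> Hs t"
  shows "vembed s u \<bullet> vembed t v = (\<Sum>k\<in>UNIV. sembed s (u $ k) \<bullet> sembed t (v $ k))"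
  unfolding inner_ell2_eq inner_vec_def vembed_sembed[OF assms(1)] vembed_sembed[OF assms(2)]
  by (rule infsum_finite_sum(2)) (intro square_summable_inner ell2_summable)

lemma vHs_dotD: "u \<in> vHs_dot s \<Longrightarrow> u $ k \<in> Hs s" "u \<in> vHs_dot s \<Longrightarrow> fourier (u $ k) 0 = 0"
  by (auto simp: vHs_dot_def Hs_dot_def)

lemma norm_vembed: "u \<in> vHs_dot s \<Longrightarrow> norm (vembed s u) = vHs_norm s u"
  by (simp add: norm_eq_sqrt_inner inner_vembed vHs_dotD vHs_norm_def norm_sembed[symmetric] power2_norm_eq_inner)

lemma vpairing_eq_inner: "f \<in> vHs_dot (- s) \<Longrightarrow> v \<in> vHs_dot s \<Longrightarrow> vpairing f v = vembed (- s) f \<bullet> vembed s v"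
  by (simp add: vpairing_def inner_vembed vHs_dotD pairing_eq_inner[where s = s])

lemma vHs_norm_nonneg [simp]: "vHs_norm s u \<ge> 0"
  by (simp add: vHs_norm_def sum_nonneg)

lemma vpairing_le: "f \<in> vHs_dot (- s) \<Longrightarrow> v \<in> vHs_dot s \<Longrightarrow> \<bar>vpairing f v\<bar> \<le> vHs_norm (- s) f * vHs_norm s v"
  using Cauchy_Schwarz_ineq2[of "vembed (- s) f" "vembed s v"] by (simp add: vpairing_eq_inner norm_vembed)

lemma Hs_dot_simps:
  "0 \<in> Hs_dot s" "g \<in> Hs_dot s \<Longrightarrow> h \<in> Hs_dot s \<Longrightarrow> g + h \<in> Hs_dot s"
  "g \<in> Hs_dot s \<Longrightarrow> h \<in> Hs_dot s \<Longrightarrow> g - h \<in> Hs_dot s"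
  "g \<in> Hs_dot s \<Longrightarrow> c *\<^sub>R g \<in> Hs_dot s" "g \<in> Hs_dot s \<Longrightarrow> - g \<in> Hs_dot s"
  by (auto simp: Hs_dot_def Hs_zero Hs_add Hs_diff Hs_scale Hs_uminus)

lemma vHs_dot_simps:
  "0 \<in> vHs_dot s" "u \<in> vHs_dot s \<Longrightarrow> v \<in> vHs_dot s \<Longrightarrow> u + v \<in> vHs_dot s"
  "u \<in> vHs_dot s \<Longrightarrow> v \<in> vHs_dot s \<Longrightarrow> u - v \<in> vHs_dot s"
  "u \<in> vHs_dot s \<Longrightarrow> c *\<^sub>R u \<in> vHs_dot s" "u \<in> vHs_dot s \<Longrightarrow> - u \<in> vHs_dot s"
  by (auto simp: vHs_dot_def Hs_dot_simps)

lemma vembed_add: "u \<in> vHs_dot s \<Longrightarrow> v \<in> vHs_dot s \<Longrightarrow> vembed s (u + v) = vembed s u + vembed s v"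
  by (rule ell2_eqI) (simp add: vec_eq_iff vembed_nth vHs_dotD vHs_dot_simps Hs_add scaleR_right_distrib)

lemma vembed_scale: "u \<in> vHs_dot s \<Longrightarrow> vembed s (c *\<^sub>R u) = c *\<^sub>R vembed s u"
  by (rule ell2_eqI) (simp add: vec_eq_iff vembed_nth vHs_dotD vHs_dot_simps Hs_scale)

lemma vembed_uminus: "u \<in> vHs_dot s \<Longrightarrow> vembed s (- u) = - vembed s u"
  using vembed_scale[of u s "-1"] by simp

lemma vembed_diff: "u \<in> vHs_dot s \<Longrightarrow> v \<in> vHs_dot s \<Longrightarrow> vembed s (u - v) = vembed s u - vembed s v"
  using vembed_add[of u s "- v"] by (simp add: vHs_dot_simps vembed_uminus)

lemma vHs_norm_triangle: "u \<in> vHs_dot s \<Longrightarrow> v \<in> vHs_dot s \<Longrightarrow> vHs_norm s (u + v) \<le> vHs_norm s u + vHs_norm s v"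
  using norm_triangle_ineq[of "vembed s u" "vembed s v"]
  by (simp add: vembed_add[symmetric] norm_vembed vHs_dot_simps)

lemma vHs_norm_triangle_diff: "u \<in> vHs_dot s \<Longrightarrow> v \<in> vHs_dot s \<Longrightarrow> vHs_norm s (u - v) \<le> vHs_norm s u + vHs_norm s v"
  using norm_triangle_ineq4[of "vembed s u" "vembed s v"]
  by (simp add: vembed_diff[symmetric] norm_vembed vHs_dot_simps)

lemma vembed_eq_zero: "u \<in> vHs_dot s \<Longrightarrow> vembed s u = 0 \<Longrightarrow> u = 0"
proof -
  assume u: "u \<in> vHs_dot s" and z: "vembed s u = 0"
  have "fourier (u $ k) \<xi> = 0" for k \<xi>
    using arg_cong[OF z, of "\<lambda>x. ell2_nth x \<xi> $ k"] u by (simp add: vembed_nth vHs_dotD)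
  then have "u $ k = 0" for k by (intro fourier_inject) simp
  then show ?thesis by (simp add: vec_eq_iff)
qed

lemma vHs_norm_eq_zero: "u \<in> vHs_dot s \<Longrightarrow> vHs_norm s u = 0 \<Longrightarrow> u = 0"
  using vembed_eq_zero[of u s] norm_vembed[of u s] by simp

lemma Hs_norm_le_vHs_norm: "Hs_norm s (u $ k) \<le> vHs_norm s u"
proof -
  have "(Hs_norm s (u $ k))\<^sup>2 \<le> (\<Sum>k\<in>UNIV. (Hs_norm s (u $ k))\<^sup>2)"
    by (rule member_le_sum) auto
  then show ?thesis unfolding vHs_norm_def by (rule real_le_rsqrt)
qed

lemma vHs_norm_le_sum: "vHs_norm s u \<le> (\<Sum>k\<in>UNIV. Hs_norm s (u $ k))"
  using L2_set_le_sum[of UNIV "\<lambda>k. Hs_norm s (u $ k)"] by (simp add: vHs_norm_def L2_set_def)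

section \<open>First-order operators between Sobolev spaces\<close>

definition nrm2 :: "int^'n::finite \<Rightarrow> real" where
  "nrm2 \<xi> = (\<Sum>i\<in>UNIV. (real_of_int (\<xi> $ i))\<^sup>2)"

lemma weight_nrm2: "weight \<xi> = 1 + nrm2 \<xi>"
  by (simp add: weight_def nrm2_def)

lemma nrm2_nonneg [simp]: "nrm2 \<xi> \<ge> 0"
  by (simp add: nrm2_def sum_nonneg)

lemma nrm2_uminus [simp]: "nrm2 (- \<xi>) = nrm2 \<xi>"
  by (simp add: nrm2_def)

lemma nrm2_eq_0: "nrm2 \<xi> = 0 \<longleftrightarrow> \<xi> = 0"
  by (simp add: nrm2_def sum_nonneg_eq_0_iff vec_eq_iff)

lemma nrm2_ge_1: "\<xi> \<noteq> 0 \<Longrightarrow> nrm2 \<xi> \<ge> 1"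
proof -
  assume "\<xi> \<noteq> 0"
  then obtain i where i: "\<xi> $ i \<noteq> 0" by (auto simp: vec_eq_iff)
  have "1 \<le> \<bar>real_of_int (\<xi> $ i)\<bar>" using i by linarith
  then have "1\<^sup>2 \<le> \<bar>real_of_int (\<xi> $ i)\<bar>\<^sup>2" by (rule power_mono) simp
  also have "\<bar>real_of_int (\<xi> $ i)\<bar>\<^sup>2 \<le> nrm2 \<xi>" unfolding nrm2_def power2_abs by (rule member_le_sum) auto
  finally show ?thesis by simp
qed

text \<open>The Poincare inequality for mean-zero fields, in the form that a nonzero integer vector
  has norm at least 1. The factor 2 here fixes the constant C/pi^2 of the theorem.\<close>

lemma weight_le_nrm2: "\<xi> \<noteq> 0 \<Longrightarrow> weight \<xi> \<le> 2 * nrm2 \<xi>"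
  using nrm2_ge_1[of \<xi>] by (simp add: weight_nrm2)

lemma abs_component_le: "\<bar>real_of_int (\<xi> $ i)\<bar> \<le> weight \<xi> powr (1/2)"
proof -
  have "(real_of_int (\<xi> $ i))\<^sup>2 \<le> nrm2 \<xi>" unfolding nrm2_def by (rule member_le_sum) auto
  then have "\<bar>real_of_int (\<xi> $ i)\<bar>\<^sup>2 \<le> weight \<xi>" by (simp add: weight_nrm2)
  then show ?thesis by (simp add: powr_half_sqrt real_le_rsqrt)
qed

lemma norm_nth_vembed: "u \<in> vHs_dot s \<Longrightarrow> weight \<xi> powr (s/2) * cmod (fourier (u $ k) \<xi>) \<le> norm (ell2_nth (vembed s u) \<xi>)"
  using Finite_Cartesian_Product.norm_nth_le[of "ell2_nth (vembed s u) \<xi>" k] by (simp add: vembed_nth vHs_dotD)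

lemma ddiff_L2:
  assumes "u \<in> vHs_dot 1"
  shows "ddiff j (u $ k) \<in> Hs 0" "L2_norm (ddiff j (u $ k)) \<le> 2 * pi * vHs_norm 1 u"
proof -
  have "weight \<xi> powr (0/2) * cmod (fourier (ddiff j (u $ k)) \<xi>) \<le> 2 * pi * norm (ell2_nth (vembed 1 u) \<xi>)" for \<xi>
  proof -
    have "cmod (fourier (ddiff j (u $ k)) \<xi>) = 2 * pi * (\<bar>real_of_int (\<xi> $ j)\<bar> * cmod (fourier (u $ k) \<xi>))"
      by (simp add: fourier_ddiff norm_mult)
    also have "\<dots> \<le> 2 * pi * (weight \<xi> powr (1/2) * cmod (fourier (u $ k) \<xi>))"
      by (intro mult_left_mono mult_right_mono abs_component_le) auto
    also have "\<dots> \<le> 2 * pi * norm (ell2_nth (vembed 1 u) \<xi>)"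
      by (intro mult_left_mono norm_nth_vembed assms) auto
    finally show ?thesis by simp
  qed
  from Hs_dominated[OF _ this] show "ddiff j (u $ k) \<in> Hs 0" "L2_norm (ddiff j (u $ k)) \<le> 2 * pi * vHs_norm 1 u"
    by (simp_all add: norm_vembed assms)
qed

lemma fourier_ddiff_zero [simp]: "fourier (ddiff j T) 0 = 0"
  by (simp add: fourier_ddiff)

lemma dvg_L2_dot:
  assumes u: "u \<in> vHs_dot 1"
  shows "dvg u \<in> L2_dot" "L2_norm (dvg u) \<le> 2 * pi * CARD('n) * vHs_norm 1 (u :: 'n::finite vdist)"
proof -
  show "dvg u \<in> L2_dot"
    unfolding dvg_def Hs_dot_def by (auto intro!: Hs_sum ddiff_L2[OF u])
  have "L2_norm (dvg u) \<le> (\<Sum>j\<in>UNIV. L2_norm (ddiff j (u $ j)))"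
    unfolding dvg_def by (intro Hs_norm_sum ddiff_L2[OF u])
  also have "\<dots> \<le> (\<Sum>j\<in>(UNIV :: 'n set). 2 * pi * vHs_norm 1 u)"
    by (intro sum_mono ddiff_L2[OF u])
  finally show "L2_norm (dvg u) \<le> 2 * pi * CARD('n) * vHs_norm 1 u" by (simp add: mult_ac)
qed

lemma ddiff_Hs_minus:
  assumes "p \<in> Hs 0"
  shows "ddiff j p \<in> Hs (-1)" "Hs_norm (-1) (ddiff j p) \<le> 2 * pi * L2_norm p"
proof -
  have "weight \<xi> powr (-1/2) * cmod (fourier (ddiff j p) \<xi>) \<le> 2 * pi * norm (ell2_nth (sembed 0 p) \<xi>)" for \<xi>
  proof -
    have "weight \<xi> powr (-1/2) * cmod (fourier (ddiff j p) \<xi>) =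
        2 * pi * (weight \<xi> powr (-1/2) * \<bar>real_of_int (\<xi> $ j)\<bar> * cmod (fourier p \<xi>))"
      by (simp add: fourier_ddiff norm_mult)
    also have "\<dots> \<le> 2 * pi * (weight \<xi> powr (-1/2) * weight \<xi> powr (1/2) * cmod (fourier p \<xi>))"
      by (intro mult_left_mono mult_right_mono abs_component_le) auto
    also have "weight \<xi> powr (-1/2) * weight \<xi> powr (1/2) = 1" by (simp add: powr_add[symmetric])
    finally show ?thesis by (simp add: sembed_nth[OF assms])
  qed
  from Hs_dominated[OF _ this] show "ddiff j p \<in> Hs (-1)" "Hs_norm (-1) (ddiff j p) \<le> 2 * pi * L2_norm p"
    by (simp_all add: norm_sembed assms)
qed

lemma grad_vHs_dot:
  assumes "p \<in> L2_dot"
  shows "grad p \<in> vHs_dot (-1)" "vHs_norm (-1) (grad p :: 'n::finite vdist) \<le> CARD('n) * (2 * pi * L2_norm p)"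
proof -
  have p: "p \<in> Hs 0" using assms by (simp add: Hs_dot_def)
  show "grad p \<in> vHs_dot (-1)"
    by (simp add: grad_def vHs_dot_def Hs_dot_def ddiff_Hs_minus[OF p])
  have "vHs_norm (-1) (grad p) \<le> (\<Sum>k\<in>(UNIV :: 'n set). 2 * pi * L2_norm p)"
    by (rule order_trans[OF vHs_norm_le_sum], rule sum_mono) (simp add: grad_def ddiff_Hs_minus[OF p])
  then show "vHs_norm (-1) (grad p) \<le> CARD('n) * (2 * pi * L2_norm p)" by simp
qed

text \<open>Mean value zero removes the frequency 0; elsewhere the squared symbol (2 pi)^2
  \<open>nrm2 \<xi>\<close> exceeds the weight, so the gradient controls \<open>p\<close> with
  constant 1.\<close>

lemma pressure_bound:
  fixes p :: "'n::finite pdist"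
  assumes "p \<in> L2_dot" shows "L2_norm p \<le> vHs_norm (-1) (grad p)"
proof -
  let ?x = "vembed (-1) (grad p)"
  note G = grad_vHs_dot(1)[OF assms]
  have "weight \<xi> powr (0/2) * cmod (fourier p \<xi>) \<le> 1 * norm (ell2_nth ?x \<xi>)" for \<xi>
  proof (cases "\<xi> = 0")
    case True
    then show ?thesis using assms by (simp add: Hs_dot_def)
  next
    case False
    have "(norm (ell2_nth ?x \<xi>))\<^sup>2 = (\<Sum>k\<in>UNIV. weight \<xi> powr (-1) * ((2 * pi)\<^sup>2 * (real_of_int (\<xi> $ k))\<^sup>2 * (cmod (fourier p \<xi>))\<^sup>2))"
      unfolding norm_vec_sq vembed_nth[OF vHs_dotD(1)[OF G]]
      by (simp add: power_mult_distrib weight_powr_half_sq[of _ "-1", simplified]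
          grad_def fourier_ddiff norm_mult)
    also have "\<dots> = weight \<xi> powr (-1) * ((2 * pi)\<^sup>2 * nrm2 \<xi> * (cmod (fourier p \<xi>))\<^sup>2)"
      unfolding nrm2_def by (simp add: sum_distrib_left sum_distrib_right)
    finally have nx: "(norm (ell2_nth ?x \<xi>))\<^sup>2 = weight \<xi> powr (-1) * ((2 * pi)\<^sup>2 * nrm2 \<xi> * (cmod (fourier p \<xi>))\<^sup>2)" .
    have "(cmod (fourier p \<xi>))\<^sup>2 \<le> (norm (ell2_nth ?x \<xi>))\<^sup>2"
    proof -
      have "weight \<xi> \<le> 2 * nrm2 \<xi>" by (rule weight_le_nrm2[OF False])
      also have "\<dots> \<le> (2 * pi)\<^sup>2 * nrm2 \<xi>"
      proof (rule mult_right_mono)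
        have "(2 * 2)\<^sup>2 \<le> (2 * pi)\<^sup>2" using pi_ge_two by (intro power_mono) auto
        then show "2 \<le> (2 * pi)\<^sup>2" by simp
      qed simp
      finally have "1 \<le> weight \<xi> powr (-1) * ((2 * pi)\<^sup>2 * nrm2 \<xi>)"
        by (simp add: powr_minus field_simps)
      then have "1 * (cmod (fourier p \<xi>))\<^sup>2 \<le> (weight \<xi> powr (-1) * ((2 * pi)\<^sup>2 * nrm2 \<xi>)) * (cmod (fourier p \<xi>))\<^sup>2"
        by (rule mult_right_mono) simp
      then show ?thesis unfolding nx by (simp add: mult_ac)
    qed
    then have "cmod (fourier p \<xi>) \<le> norm (ell2_nth ?x \<xi>)" by (rule power2_le_imp_le) simp
    then show ?thesis by simp
  qed
  from Hs_dominated(2)[OF _ this] show ?thesis by (simp add: norm_vembed G)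
qed

section \<open>Convection\<close>

lemma convection_bound:
  fixes U :: "real^'n::finite \<Rightarrow> real^'n"
  assumes \<theta>: "\<theta> > 2" "\<theta> \<ge> real CARD('n)" and U: "\<And>j. (\<lambda>x. U x $ j) \<in> Lq \<theta>"
  obtains M where "M > 0" "\<And>u k. u \<in> vHs_dot 1 \<Longrightarrow> convection U u $ k \<in> Hs (-1)"
    "\<And>u. u \<in> vHs_dot 1 \<Longrightarrow> vHs_norm (-1) (convection U u) \<le> M * vHs_norm 1 u"
proof -
  have "\<exists>m>0. \<forall>D\<in>Hs 0. fmult (\<lambda>x. U x $ j) D \<in> Hs (-1) \<and>
      Hs_norm (-1) (fmult (\<lambda>x. U x $ j) D) \<le> m * L2_norm D" for j
    by (rule fmult_bound[OF \<theta> U[of j]]) blast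
  then obtain m where m: "\<And>j. m j > 0" "\<And>j D. D \<in> Hs 0 \<Longrightarrow> fmult (\<lambda>x. U x $ j) D \<in> Hs (-1)"
    "\<And>j D. D \<in> Hs 0 \<Longrightarrow> Hs_norm (-1) (fmult (\<lambda>x. U x $ j) D) \<le> m j * L2_norm D"
    by metis
  define M where "M = (\<Sum>k\<in>(UNIV :: 'n set). \<Sum>j\<in>UNIV. m j * (2 * pi))"
  show ?thesis
  proof (rule that[of M])
    show "M > 0" unfolding M_def by (intro sum_pos) (simp_all add: m)
    fix u :: "'n vdist" assume u: "u \<in> vHs_dot 1"
    have f: "fmult (\<lambda>x. U x $ j) (ddiff j (u $ k)) \<in> Hs (-1)" for j k
      by (intro m ddiff_L2[OF u])
    show "convection U u $ k \<in> Hs (-1)" for k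
      by (simp add: convection_def) (intro Hs_sum f)
    have "Hs_norm (-1) (convection U u $ k) \<le> (\<Sum>j\<in>UNIV. m j * (2 * pi)) * vHs_norm 1 u" for k
    proof -
      have "Hs_norm (-1) (convection U u $ k) \<le> (\<Sum>j\<in>UNIV. Hs_norm (-1) (fmult (\<lambda>x. U x $ j) (ddiff j (u $ k))))"
        by (simp add: convection_def) (intro Hs_norm_sum f)
      also have "\<dots> \<le> (\<Sum>j\<in>UNIV. m j * (2 * pi * vHs_norm 1 u))"
        by (intro sum_mono order_trans[OF m(3)] mult_left_mono ddiff_L2[OF u] less_imp_le[OF m(1)])
      also have "\<dots> = (\<Sum>j\<in>UNIV. m j * (2 * pi)) * vHs_norm 1 u"
        by (simp add: sum_distrib_right mult.assoc)
      finally show ?thesis .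
    qed
    then have "(\<Sum>k\<in>UNIV. Hs_norm (-1) (convection U u $ k)) \<le> (\<Sum>k\<in>(UNIV :: 'n set). (\<Sum>j\<in>UNIV. m j * (2 * pi)) * vHs_norm 1 u)"
      by (intro sum_mono)
    then show "vHs_norm (-1) (convection U u) \<le> M * vHs_norm 1 u"
      using vHs_norm_le_sum[of "-1" "convection U u"] unfolding M_def sum_distrib_right by linarith
  qed
qed

lemma ddiff_add: "ddiff j (S + T) = ddiff j S + ddiff j T"
  by (rule pdist_eqI) (simp add: dapply_ddiff)

lemma ddiff_scale: "ddiff j (c *\<^sub>R T) = c *\<^sub>R ddiff j T"
  by (rule pdist_eqI) (simp add: dapply_ddiff)

lemma ddiff_zero [simp]: "ddiff j 0 = 0"
  by (rule pdist_eqI) (simp add: dapply_ddiff)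

lemma ddiff_sum: "ddiff j (\<Sum>i\<in>I. T i) = (\<Sum>i\<in>I. ddiff j (T i))"
  by (induction I rule: infinite_finite_induct) (auto simp: ddiff_add)

lemma convection_add:
  assumes "\<And>j. (\<lambda>x. U x $ j) \<in> Lq 2" "u \<in> vHs_dot 1" "v \<in> vHs_dot 1"
  shows "convection U (u + v) = convection U u + convection U v"
  by (simp add: convection_def vec_eq_iff ddiff_add fmult_add assms ddiff_L2 sum.distrib)

lemma convection_scale:
  assumes "\<And>j. (\<lambda>x. U x $ j) \<in> Lq 2" "u \<in> vHs_dot 1"
  shows "convection U (c *\<^sub>R u) = c *\<^sub>R convection U u"
  by (simp add: convection_def vec_eq_iff ddiff_scale fmult_scale assms ddiff_L2 scaleR_sum_right)

text \<open>Realized by genuine trigonometric polynomials, for which convection is an explicit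
  integral against a smooth function.\<close>

definition trunc :: "nat \<Rightarrow> 'n::finite vdist \<Rightarrow> 'n vdist" where
  "trunc N u = (\<chi> k. dist_of (trig_poly (cube N) (fourier (u $ k))))"

lemma fourier_trunc: "fourier (trunc N u $ k) \<xi> = (if \<xi> \<in> cube N then fourier (u $ k) \<xi> else 0)"
  unfolding trunc_def vec_lambda_beta by (rule fourier_trig_poly) (auto simp: cube_uminus fourier_minus)

lemma trunc_vHs_dot: "trunc N u \<in> vHs_dot s" if "u \<in> vHs_dot s"
proof -
  have "trunc N u $ k \<in> Hs s" for k
    by (rule Hs_dominated(1)[of 1 _ _ "sembed s (u $ k)"])
      (simp_all add: fourier_trunc sembed_nth vHs_dotD[OF that])
  then show ?thesis using vHs_dotD[OF that] by (simp add: vHs_dot_def Hs_dot_def fourier_trunc)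
qed

text \<open>The squared norm of a tail is the full sum minus the partial sum over the cube.\<close>

lemma tail_tendsto_zero:
  fixes x :: "(int^'n::finite, 'b::real_inner) ell2"
  assumes "\<And>N \<xi>. ell2_nth (y N) \<xi> = (if \<xi> \<in> cube N then 0 else ell2_nth x \<xi>)"
  shows "(\<lambda>N. norm (y N)) \<longlonglongrightarrow> 0"
proof -
  let ?f = "\<lambda>\<xi>. (norm (ell2_nth x \<xi>))\<^sup>2"
  have eq: "(norm (y N))\<^sup>2 = infsum ?f UNIV - sum ?f (cube N)" for N
  proof -
    have "(norm (y N))\<^sup>2 = infsum ?f (UNIV - cube N)"
      unfolding norm_ell2_sq assms by (rule infsum_cong_neutral) auto
    also have "\<dots> = infsum ?f UNIV - infsum ?f (cube N)"
      by (rule infsum_Diff) (auto simp: ell2_summable intro: summable_on_finite)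
    finally show ?thesis by simp
  qed
  have "((\<lambda>F. sum ?f F) \<longlongrightarrow> infsum ?f UNIV) (finite_subsets_at_top UNIV)"
    using has_sum_infsum[OF ell2_summable] unfolding has_sum_def .
  from filterlim_compose[OF this filterlim_cube]
  have "(\<lambda>N. (norm (y N))\<^sup>2) \<longlonglongrightarrow> infsum ?f UNIV - infsum ?f UNIV"
    unfolding eq by (intro tendsto_diff tendsto_const)
  then have "(\<lambda>N. sqrt ((norm (y N))\<^sup>2)) \<longlonglongrightarrow> sqrt 0" by (intro tendsto_real_sqrt) simp
  then show ?thesis by simp
qed

lemma trunc_tendsto:
  assumes u: "u \<in> vHs_dot 1" shows "(\<lambda>N. vHs_norm 1 (u - trunc N u)) \<longlonglongrightarrow> 0"
proof -
  have "ell2_nth (vembed 1 (u - trunc N u)) \<xi> = (if \<xi> \<in> cube N then 0 else ell2_nth (vembed 1 u) \<xi>)" for N \<xi>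
    using u trunc_vHs_dot[OF u, of N]
    by (simp add: vec_eq_iff vembed_nth vHs_dotD vHs_dot_simps Hs_diff fourier_trunc)
  then have "(\<lambda>N. norm (vembed 1 (u - trunc N u))) \<longlonglongrightarrow> 0" by (rule tail_tendsto_zero)
  then show ?thesis by (simp add: norm_vembed vHs_dot_simps u trunc_vHs_dot)
qed

lemma dapply_convection_trunc:
  fixes U :: "real^'n::finite \<Rightarrow> real^'n"
  assumes U: "\<And>j. (\<lambda>x. U x $ j) \<in> Lq 2" and u: "u \<in> vHs_dot 1" and \<psi>: "\<psi> \<in> test_funs"
  shows "dapply (convection U (trunc N u) $ k) \<psi> =
    (\<Sum>j\<in>UNIV. \<integral>x. U x $ j * (partial j (trig_poly (cube N) (fourier (u $ k))) x * \<psi> x) \<partial>TM)"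
proof -
  let ?\<phi> = "trig_poly (cube N) (fourier (u $ k))"
  have "dapply (convection U (trunc N u) $ k) \<psi> = (\<Sum>j\<in>UNIV. dapply (fmult (\<lambda>x. U x $ j) (ddiff j (dist_of ?\<phi>))) \<psi>)"
    by (simp add: convection_def trunc_def dapply_sum_left)
  also have "\<dots> = (\<Sum>j\<in>UNIV. \<integral>x. U x $ j * (partial j ?\<phi> x * \<psi> x) \<partial>TM)"
  proof (rule sum.cong[OF refl])
    fix j
    have L: "partial j ?\<phi> \<in> Lq 2" by (intro test_funs_Lq test_funs_partial trig_poly_test) simp
    have "ddiff j (trunc N u $ k) \<in> Hs 0" by (rule ddiff_L2(1)[OF trunc_vHs_dot[OF u]])
    then have "fmult (\<lambda>x. U x $ j) (ddiff j (dist_of ?\<phi>)) = dist_of (\<lambda>x. U x $ j * partial j ?\<phi> x)"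
      by (intro fmult_cong_AE U L) (simp_all add: trunc_def dist_of_partial)
    then show "dapply (fmult (\<lambda>x. U x $ j) (ddiff j (dist_of ?\<phi>))) \<psi> = (\<integral>x. U x $ j * (partial j ?\<phi> x * \<psi> x) \<partial>TM)"
      by (simp add: dapply_dist_of Lq_mult U L \<psi> mult.assoc)
  qed
  finally show ?thesis .
qed

text \<open>The distributional divergence tested with \<open>\<phi>\<close>: the only form in which
  \<open>div U = 0\<close> is used.\<close>

lemma integral_solenoidal:
  fixes U :: "real^'n::finite \<Rightarrow> real^'n"
  assumes U: "\<And>j. (\<lambda>x. U x $ j) \<in> Lq 1" and div: "dvg (\<chi> j. dist_of (\<lambda>x. U x $ j)) = 0" and \<phi>: "\<phi> \<in> test_funs"
  shows "(\<Sum>j\<in>UNIV. \<integral>x. U x $ j * partial j \<phi> x \<partial>TM) = 0"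
proof -
  have "dapply (dvg (\<chi> j. dist_of (\<lambda>x. U x $ j))) \<phi> = - (\<Sum>j\<in>UNIV. \<integral>x. U x $ j * partial j \<phi> x \<partial>TM)"
    by (simp add: dvg_def dapply_sum_left dapply_ddiff \<phi> dapply_dist_of U test_funs_partial sum_negf)
  then show ?thesis by (simp add: div)
qed

lemma partial_sq:
  assumes "\<phi> \<in> test_funs" shows "partial j (\<lambda>x. \<phi> x * \<phi> x) = (\<lambda>x. 2 * (partial j \<phi> x * \<phi> x))"
proof -
  have D: "((\<lambda>x. \<phi> x * \<phi> x) has_derivative (\<lambda>h. \<phi> x * frechet_derivative \<phi> (at x) h +
      frechet_derivative \<phi> (at x) h * \<phi> x)) (at x)" for x
    using test_funs_differentiable[OF assms]
    by (intro has_derivative_mult) (auto simp: frechet_derivative_works[symmetric])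
  show ?thesis unfolding partial_eqI[OF D] by (simp add: partial_def fun_eq_iff)
qed

text \<open>Replaces the pairing by evaluation on a test function, where the integral formula for
  convection applies.\<close>

lemma pairing_trig_poly:
  assumes herm: "\<And>\<xi>. c (- \<xi>) = cnj (c \<xi>)"
  shows "pairing G (dist_of (trig_poly (cube N) c)) = dapply G (trig_poly (cube N) c)"
proof -
  have f: "fourier (dist_of (trig_poly (cube N) c)) \<xi> = (if \<xi> \<in> cube N then c \<xi> else 0)" for \<xi>
    by (rule fourier_trig_poly) (auto simp: cube_uminus herm)
  have mem: "- \<xi> \<in> cube N \<longleftrightarrow> \<xi> \<in> cube N" for \<xi> :: "int^'a" using cube_uminus[of "- \<xi>"] cube_uminus by auto
  have "(\<Sum>\<^sub>\<infinity>\<xi>. fourier G \<xi> * fourier (dist_of (trig_poly (cube N) c)) (- \<xi>)) =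
      (\<Sum>\<^sub>\<infinity>\<xi>\<in>cube N. fourier G \<xi> * c (- \<xi>))"
    unfolding f mem by (rule infsum_cong_neutral) auto
  also have "\<dots> = (\<Sum>\<xi>\<in>cube N. fourier G \<xi> * c (- \<xi>))" by simp
  also have "\<dots> = (\<Sum>\<xi>\<in>cube N. c \<xi> * fourier G (- \<xi>))"
    by (rule sum.reindex_bij_witness[of _ uminus uminus]) (auto simp: mem mult.commute)
  finally show ?thesis unfolding pairing_def dapply_trig_poly by simp
qed

text \<open>Both claims are integrations by parts for trigonometric polynomials \<open>u\<close>, with the test
  functions \<open>u\<^sub>k\<close> and \<open>u\<^sub>k\<^sup>2\<close> in \<open>div U = 0\<close>; they extend by density.\<close>

lemma convection_solenoidal:
  fixes U :: "real^'n::finite \<Rightarrow> real^'n"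
  assumes \<theta>: "\<theta> > 2" "\<theta> \<ge> real CARD('n)" and U: "U \<in> Lq_sol \<theta>" and u: "u \<in> vHs_dot 1"
  shows "convection U u \<in> vHs_dot (-1)" "vpairing (convection U u) u = 0"
proof -
  have UL: "(\<lambda>x. U x $ j) \<in> Lq \<theta>" for j using U by (simp add: Lq_sol_def)
  have U2: "(\<lambda>x. U x $ j) \<in> Lq 2" for j using Lq_mono[OF UL[of j], of 2] \<theta> by simp
  have U1: "(\<lambda>x. U x $ j) \<in> Lq 1" for j using Lq_mono[OF U2[of j], of 1] by simp
  have div: "dvg (\<chi> j. dist_of (\<lambda>x. U x $ j)) = 0" using U by (simp add: Lq_sol_def)
  obtain M where M: "M > 0" and Hs: "\<And>u k. u \<in> vHs_dot 1 \<Longrightarrow> convection U u $ k \<in> Hs (-1)"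
    and bd: "\<And>u. u \<in> vHs_dot 1 \<Longrightarrow> vHs_norm (-1) (convection U u) \<le> M * vHs_norm 1 u"
    using convection_bound[OF \<theta> UL] by blast
  let ?t = "\<lambda>N. trunc N u"
  have t: "?t N \<in> vHs_dot 1" for N by (rule trunc_vHs_dot[OF u])
  have d: "u - ?t N \<in> vHs_dot 1" for N by (intro vHs_dot_simps u t)
  have split: "convection U u = convection U (?t N) + convection U (u - ?t N)" for N
    using convection_add[OF U2 t d, of N N] by simp
  have zero_t: "fourier (convection U (?t N) $ k) 0 = 0" for N k
  proof -
    have "dapply (convection U (?t N) $ k) (\<lambda>x. 1) = 0"
      using integral_solenoidal[OF U1 div trig_poly_test] by (simp add: dapply_convection_trunc[OF U2 u])
    moreover have "dapply (convection U (?t N) $ k) (\<lambda>x. 0) = 0"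
      using dapply_scale[of "\<lambda>x. 0" _ 0] by simp
    ultimately show ?thesis by (simp add: fourier_def complex_eq_iff)
  qed
  have "fourier (convection U u $ k) 0 = 0" for k
  proof -
    have "cmod (fourier (convection U u $ k) 0) \<le> M * vHs_norm 1 (u - ?t N)" for N
    proof -
      have "fourier (convection U u $ k) 0 = fourier (convection U (u - ?t N) $ k) 0"
        by (simp add: split[of N] zero_t)
      also have "cmod \<dots> \<le> Hs_norm (-1) (convection U (u - ?t N) $ k)"
        using norm_fourier_le_Hs_norm[OF Hs[OF d[of N]], of 0 k] by simp
      also have "\<dots> \<le> M * vHs_norm 1 (u - ?t N)"
        using Hs_norm_le_vHs_norm bd[OF d] by (rule order_trans)
      finally show ?thesis .
    qed
    moreover have "(\<lambda>N. M * vHs_norm 1 (u - ?t N)) \<longlonglongrightarrow> M * 0"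
      by (intro tendsto_mult tendsto_const trunc_tendsto u)
    ultimately have "cmod (fourier (convection U u $ k) 0) \<le> M * 0"
      by (intro LIMSEQ_le_const) auto
    then show ?thesis by simp
  qed
  then show cu: "convection U u \<in> vHs_dot (-1)"
    using Hs[OF u] by (simp add: vHs_dot_def Hs_dot_def)
  have ct: "convection U (?t N) \<in> vHs_dot (-1)" for N
    using Hs[OF t] zero_t by (simp add: vHs_dot_def Hs_dot_def)
  have cd: "convection U (u - ?t N) \<in> vHs_dot (-1)" for N
    using vHs_dot_simps(3)[OF cu ct[of N]] split[of N] by simp
  have tt: "vpairing (convection U (?t N)) (?t N) = 0" for N
  proof -
    have "pairing (convection U (?t N) $ k) (?t N $ k) = 0" for k
    proof -
      let ?\<phi> = "trig_poly (cube N) (fourier (u $ k))"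
      have sq: "(\<lambda>x. ?\<phi> x * ?\<phi> x) \<in> test_funs" by (intro trig_test_funs trig_mult trig_poly_trig)
      have "pairing (convection U (?t N) $ k) (?t N $ k) = dapply (convection U (?t N) $ k) ?\<phi>"
        by (subst (2) trunc_def) (simp add: pairing_trig_poly fourier_minus)
      also have "\<dots> = (\<Sum>j\<in>UNIV. \<integral>x. U x $ j * (partial j ?\<phi> x * ?\<phi> x) \<partial>TM)"
        by (rule dapply_convection_trunc[OF U2 u trig_poly_test])
      also have "2 * \<dots> = (\<Sum>j\<in>UNIV. \<integral>x. U x $ j * partial j (\<lambda>x. ?\<phi> x * ?\<phi> x) x \<partial>TM)"
        by (simp add: partial_sq sum_distrib_left mult.left_commute)
      also have "\<dots> = 0" by (rule integral_solenoidal[OF U1 div sq])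
      finally show ?thesis by simp
    qed
    then show ?thesis by (simp add: vpairing_def)
  qed
  \<comment> \<open>The form is expanded around the truncation, where it vanishes; every remaining
    term contains the remainder \<open>u - trunc N u\<close>, whose norm tends to 0.\<close>
  have "\<bar>vpairing (convection U u) u\<bar> \<le> 2 * M * vHs_norm 1 u * vHs_norm 1 (u - ?t N) + M * vHs_norm 1 (u - ?t N) * vHs_norm 1 (u - ?t N)" for N
  proof -
    let ?d = "u - ?t N"
    have e: "vembed (-1) (convection U u) = vembed (-1) (convection U (?t N)) + vembed (-1) (convection U ?d)"
      "vembed 1 u = vembed 1 (?t N) + vembed 1 ?d"
      using vembed_add[OF ct cd, of N N] vembed_add[OF t d, of N N] split[of N] by simp_all
    have "vpairing (convection U u) u = vembed (-1) (convection U u) \<bullet> vembed 1 u"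
      by (rule vpairing_eq_inner) (use cu u in auto)
    also have "\<dots> = vembed (-1) (convection U (?t N)) \<bullet> vembed 1 (?t N) +
        vembed (-1) (convection U ?d) \<bullet> vembed 1 (?t N) + vembed (-1) (convection U u) \<bullet> vembed 1 ?d"
      by (simp add: e inner_add_left inner_add_right)
    also have "vembed (-1) (convection U (?t N)) \<bullet> vembed 1 (?t N) = 0"
      using tt[of N] vpairing_eq_inner[of "convection U (?t N)" 1 "?t N"] ct t by simp
    also have "vembed (-1) (convection U ?d) \<bullet> vembed 1 (?t N) = vembed (-1) (convection U ?d) \<bullet> vembed 1 u - vembed (-1) (convection U ?d) \<bullet> vembed 1 ?d"
      by (simp add: e inner_add_right)
    finally have "\<bar>vpairing (convection U u) u\<bar> \<le> \<bar>vembed (-1) (convection U ?d) \<bullet> vembed 1 u\<bar> +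
        \<bar>vembed (-1) (convection U ?d) \<bullet> vembed 1 ?d\<bar> + \<bar>vembed (-1) (convection U u) \<bullet> vembed 1 ?d\<bar>" by linarith
    also have "\<dots> \<le> (M * vHs_norm 1 ?d) * vHs_norm 1 u + (M * vHs_norm 1 ?d) * vHs_norm 1 ?d + (M * vHs_norm 1 u) * vHs_norm 1 ?d"
    proof -
      have "\<bar>vembed (-1) (convection U a) \<bullet> vembed 1 b\<bar> \<le> (M * vHs_norm 1 a) * vHs_norm 1 b"
        if "a \<in> vHs_dot 1" "convection U a \<in> vHs_dot (-1)" "b \<in> vHs_dot 1" for a b
      proof -
        have "\<bar>vembed (-1) (convection U a) \<bullet> vembed 1 b\<bar> \<le> norm (vembed (-1) (convection U a)) * norm (vembed 1 b)"
          by (rule Cauchy_Schwarz_ineq2)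
        also have "\<dots> \<le> (M * vHs_norm 1 a) * vHs_norm 1 b"
          unfolding norm_vembed[OF that(2)] norm_vembed[OF that(3)] by (intro mult_right_mono bd that) auto
        finally show ?thesis .
      qed
      then show ?thesis using u d cd cu by (intro add_mono) auto
    qed
    finally show ?thesis by (simp add: algebra_simps)
  qed
  moreover have "(\<lambda>N. 2 * M * vHs_norm 1 u * vHs_norm 1 (u - ?t N) + M * vHs_norm 1 (u - ?t N) * vHs_norm 1 (u - ?t N)) \<longlonglongrightarrow>
      2 * M * vHs_norm 1 u * 0 + M * 0 * 0"
    by (intro tendsto_intros trunc_tendsto u)
  ultimately have "\<bar>vpairing (convection U u) u\<bar> \<le> 2 * M * vHs_norm 1 u * 0 + M * 0 * 0"
    by (intro LIMSEQ_le_const) auto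
  then show "vpairing (convection U u) u = 0" by simp
qed

section \<open>The elliptic part\<close>

lemma tensor_norm_ge: "\<bar>A k j \<alpha> \<beta>\<bar> \<le> tensor_norm A"
  unfolding tensor_norm_def
  by (rule Max_ge) (auto intro!: image_eqI[of _ _ "(k, j, \<alpha>, \<beta>)"])

lemma tensor_norm_nonneg: "tensor_norm A \<ge> 0"
  using tensor_norm_ge[of A undefined undefined undefined undefined] by linarith

lemma Hs_norm_scale: "g \<in> Hs s \<Longrightarrow> Hs_norm s (c *\<^sub>R g) = \<bar>c\<bar> * Hs_norm s g"
  by (simp add: norm_sembed[symmetric] Hs_scale sembed_scale)

lemma strain_L2:
  assumes u: "u \<in> vHs_dot 1"
  shows "strain u j \<beta> \<in> Hs 0" "L2_norm (strain u j \<beta>) \<le> 2 * pi * vHs_norm 1 u"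
proof -
  show "strain u j \<beta> \<in> Hs 0" unfolding strain_def by (intro Hs_scale Hs_add ddiff_L2[OF u])
  have "L2_norm (strain u j \<beta>) = (1/2) * L2_norm (ddiff j (u $ \<beta>) + ddiff \<beta> (u $ j))"
    unfolding strain_def by (subst Hs_norm_scale) (auto intro!: Hs_add ddiff_L2[OF u])
  also have "\<dots> \<le> (1/2) * (L2_norm (ddiff j (u $ \<beta>)) + L2_norm (ddiff \<beta> (u $ j)))"
    by (intro mult_left_mono Hs_norm_triangle ddiff_L2[OF u]) auto
  also have "\<dots> \<le> (1/2) * (2 * pi * vHs_norm 1 u + 2 * pi * vHs_norm 1 u)"
    by (intro mult_left_mono add_mono ddiff_L2[OF u]) auto
  finally show "L2_norm (strain u j \<beta>) \<le> 2 * pi * vHs_norm 1 u" by simp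
qed

lemma stress_L2:
  assumes u: "u \<in> vHs_dot 1"
  shows "stress A u k \<alpha> \<in> Hs 0"
    "L2_norm (stress A u k \<alpha>) \<le> CARD('n) * CARD('n) * tensor_norm A * (2 * pi * vHs_norm 1 (u :: 'n::finite vdist))"
proof -
  show "stress A u k \<alpha> \<in> Hs 0" unfolding stress_def by (intro Hs_sum Hs_scale strain_L2[OF u])
  have "L2_norm (stress A u k \<alpha>) \<le> (\<Sum>j\<in>UNIV. L2_norm (\<Sum>\<beta>\<in>UNIV. A k j \<alpha> \<beta> *\<^sub>R strain u j \<beta>))"
    unfolding stress_def by (intro Hs_norm_sum Hs_sum Hs_scale strain_L2[OF u])
  also have "\<dots> \<le> (\<Sum>j\<in>UNIV. \<Sum>\<beta>\<in>UNIV. L2_norm (A k j \<alpha> \<beta> *\<^sub>R strain u j \<beta>))"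
    by (intro sum_mono Hs_norm_sum Hs_scale strain_L2[OF u])
  also have "\<dots> \<le> (\<Sum>j\<in>(UNIV :: 'n set). \<Sum>\<beta>\<in>(UNIV :: 'n set). tensor_norm A * (2 * pi * vHs_norm 1 u))"
    unfolding Hs_norm_scale[OF strain_L2(1)[OF u]]
    by (intro sum_mono mult_mono tensor_norm_ge strain_L2[OF u]) (auto simp: tensor_norm_nonneg)
  finally show "L2_norm (stress A u k \<alpha>) \<le> CARD('n) * CARD('n) * tensor_norm A * (2 * pi * vHs_norm 1 u)"
    by (simp add: mult_ac)
qed

text \<open>The fourth power counts the four summation indices, each handled by the triangle
  inequality; the square of 2 pi stems from the two derivatives. The constant reappears in
  \<open>op_const\<close>.\<close>

lemma lop_vHs_dot:
  assumes u: "u \<in> vHs_dot 1"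
  shows "lop A u \<in> vHs_dot (-1)"
    "vHs_norm (-1) (lop A u) \<le> real CARD('n) ^ 4 * (2 * pi)\<^sup>2 * tensor_norm A * vHs_norm 1 (u :: 'n::finite vdist)"
proof -
  show "lop A u \<in> vHs_dot (-1)"
    by (auto simp: vHs_dot_def Hs_dot_def lop_def intro!: Hs_sum ddiff_Hs_minus stress_L2[OF u])
  have "Hs_norm (-1) (lop A u $ k) \<le> real CARD('n) ^ 3 * (2 * pi)\<^sup>2 * tensor_norm A * vHs_norm 1 u" for k
  proof -
    have "Hs_norm (-1) (lop A u $ k) \<le> (\<Sum>\<alpha>\<in>UNIV. Hs_norm (-1) (ddiff \<alpha> (stress A u k \<alpha>)))"
      unfolding lop_def vec_lambda_beta by (intro Hs_norm_sum ddiff_Hs_minus stress_L2[OF u])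
    also have "\<dots> \<le> (\<Sum>\<alpha>\<in>(UNIV :: 'n set). 2 * pi * (CARD('n) * CARD('n) * tensor_norm A * (2 * pi * vHs_norm 1 u)))"
      by (intro sum_mono order_trans[OF ddiff_Hs_minus(2)] stress_L2[OF u] mult_left_mono) auto
    finally show ?thesis by (simp add: power2_eq_square power3_eq_cube mult_ac)
  qed
  then have "(\<Sum>k\<in>UNIV. Hs_norm (-1) (lop A u $ k)) \<le> (\<Sum>k\<in>(UNIV :: 'n set). real CARD('n) ^ 3 * (2 * pi)\<^sup>2 * tensor_norm A * vHs_norm 1 u)"
    by (intro sum_mono)
  also have "\<dots> = real CARD('n) ^ 4 * (2 * pi)\<^sup>2 * tensor_norm A * vHs_norm 1 u"
    by (simp add: eval_nat_numeral mult_ac)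
  finally show "vHs_norm (-1) (lop A u) \<le> real CARD('n) ^ 4 * (2 * pi)\<^sup>2 * tensor_norm A * vHs_norm 1 u"
    using vHs_norm_le_sum[of "-1" "lop A u"] by linarith
qed

text \<open>The tensor symmetry makes the stress symmetric in its two indices. The two halves of the
  strain of \<open>v\<close> then contribute equally, and one integration by parts moves the
  derivative to the stress.\<close>

lemma pairing_stress_strain:
  assumes A: "tensor_symmetric A" and u: "u \<in> vHs_dot 1" and v: "v \<in> vHs_dot 1"
  shows "(\<Sum>i\<in>UNIV. \<Sum>\<alpha>\<in>UNIV. pairing (stress A u i \<alpha>) (strain v i \<alpha>)) = vpairing (- lop A u) v"
proof -
  let ?s = "stress A u"
  have sym: "?s i \<alpha> = ?s \<alpha> i" for i \<alpha>
    using A unfolding stress_def tensor_symmetric_def by (intro sum.cong refl) metis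
  have s: "?s i \<alpha> \<in> Hs 0" for i \<alpha> by (rule stress_L2[OF u])
  have "pairing (?s i \<alpha>) (strain v i \<alpha>) =
      (1/2) * (- pairing (ddiff i (?s i \<alpha>)) (v $ \<alpha>) - pairing (ddiff \<alpha> (?s i \<alpha>)) (v $ i))" for i \<alpha>
  proof -
    have "pairing (?s i \<alpha>) (strain v i \<alpha>) = (1/2) * (pairing (?s i \<alpha>) (ddiff i (v $ \<alpha>)) + pairing (?s i \<alpha>) (ddiff \<alpha> (v $ i)))"
      unfolding strain_def using s[of i \<alpha>] ddiff_L2[OF v]
      by (simp only: pairing_scale_right[where s = 0] pairing_add_right[where s = 0] Hs_add minus_zero)
    then show ?thesis by (simp add: pairing_ddiff)
  qed
  then have "(\<Sum>i\<in>UNIV. \<Sum>\<alpha>\<in>UNIV. pairing (?s i \<alpha>) (strain v i \<alpha>)) =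
      (1/2) * ((\<Sum>i\<in>UNIV. \<Sum>\<alpha>\<in>UNIV. - pairing (ddiff i (?s \<alpha> i)) (v $ \<alpha>)) + (\<Sum>i\<in>UNIV. \<Sum>\<alpha>\<in>UNIV. - pairing (ddiff \<alpha> (?s i \<alpha>)) (v $ i)))"
    by (simp add: sum.distrib[symmetric] sum_distrib_left sym[symmetric])
       (intro sum.cong refl, simp add: sym)
  also have "(\<Sum>i\<in>UNIV. \<Sum>\<alpha>\<in>UNIV. - pairing (ddiff i (?s \<alpha> i)) (v $ \<alpha>)) = (\<Sum>i\<in>UNIV. \<Sum>\<alpha>\<in>UNIV. - pairing (ddiff \<alpha> (?s i \<alpha>)) (v $ i))"
    by (rule sum.swap)
  also have "(1/2) * ((\<Sum>i\<in>UNIV. \<Sum>\<alpha>\<in>UNIV. - pairing (ddiff \<alpha> (?s i \<alpha>)) (v $ i)) + (\<Sum>i\<in>UNIV. \<Sum>\<alpha>\<in>UNIV. - pairing (ddiff \<alpha> (?s i \<alpha>)) (v $ i))) =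
      (\<Sum>i\<in>UNIV. - (\<Sum>\<alpha>\<in>UNIV. pairing (ddiff \<alpha> (?s i \<alpha>)) (v $ i)))"
    by (simp add: sum_negf)
  also have "\<dots> = vpairing (- lop A u) v"
    unfolding vpairing_def
  proof (rule sum.cong[OF refl])
    fix i
    have "pairing (\<Sum>\<alpha>\<in>UNIV. ddiff \<alpha> (?s i \<alpha>)) (v $ i) = (\<Sum>\<alpha>\<in>UNIV. pairing (ddiff \<alpha> (?s i \<alpha>)) (v $ i))"
      by (rule pairing_sum_left[where s = 1]) (auto intro!: ddiff_Hs_minus s vHs_dotD[OF v])
    then show "- (\<Sum>\<alpha>\<in>UNIV. pairing (ddiff \<alpha> (?s i \<alpha>)) (v $ i)) = pairing ((- lop A u) $ i) (v $ i)"
      by (simp add: lop_def pairing_uminus_left)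
  qed
  finally show ?thesis .
qed

text \<open>Korn's identity for solenoidal fields at a single frequency.\<close>

lemma symmetrized_gradient_sq:
  fixes a :: "'n::finite \<Rightarrow> real" and z :: "'n \<Rightarrow> complex"
  assumes "(\<Sum>j\<in>UNIV. a j *\<^sub>R z j) = 0"
  shows "(\<Sum>j\<in>UNIV. \<Sum>b\<in>UNIV. (cmod (a j *\<^sub>R z b + a b *\<^sub>R z j))\<^sup>2) =
    2 * (\<Sum>j\<in>UNIV. (a j)\<^sup>2) * (\<Sum>b\<in>UNIV. (cmod (z b))\<^sup>2)"
proof -
  have e: "(cmod (a j *\<^sub>R z b + a b *\<^sub>R z j))\<^sup>2 =
      ((a j)\<^sup>2 * (cmod (z b))\<^sup>2 + (a b)\<^sup>2 * (cmod (z j))\<^sup>2) + 2 * ((a j *\<^sub>R z j) \<bullet> (a b *\<^sub>R z b))" for j b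
    unfolding power2_norm_eq_inner
    by (simp add: inner_add_left inner_add_right inner_commute power2_eq_square algebra_simps)
  \<comment> \<open>Regrouped in this way the cross terms form the square of the divergence
    symbol.\<close>
  have 1: "(\<Sum>j\<in>UNIV. \<Sum>b\<in>UNIV. (a j *\<^sub>R z j) \<bullet> (a b *\<^sub>R z b)) = 0"
    using assms by (simp only: inner_sum_right[symmetric] inner_sum_left[symmetric]) simp
  have 2: "(\<Sum>j\<in>UNIV. \<Sum>b\<in>UNIV. (a j)\<^sup>2 * (cmod (z b))\<^sup>2) = (\<Sum>j\<in>UNIV. (a j)\<^sup>2) * (\<Sum>b\<in>UNIV. (cmod (z b))\<^sup>2)"
    by (rule sum_product[symmetric])
  have 3: "(\<Sum>j\<in>UNIV. \<Sum>b\<in>UNIV. (a b)\<^sup>2 * (cmod (z j))\<^sup>2) = (\<Sum>j\<in>UNIV. (a j)\<^sup>2) * (\<Sum>b\<in>UNIV. (cmod (z b))\<^sup>2)"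
    by (subst sum.swap) (rule 2)
  have "(\<Sum>j\<in>UNIV. \<Sum>b\<in>UNIV. (cmod (a j *\<^sub>R z b + a b *\<^sub>R z j))\<^sup>2) =
      (\<Sum>j\<in>UNIV. \<Sum>b\<in>UNIV. (a j)\<^sup>2 * (cmod (z b))\<^sup>2) + (\<Sum>j\<in>UNIV. \<Sum>b\<in>UNIV. (a b)\<^sup>2 * (cmod (z j))\<^sup>2) +
      2 * (\<Sum>j\<in>UNIV. \<Sum>b\<in>UNIV. (a j *\<^sub>R z j) \<bullet> (a b *\<^sub>R z b))"
    unfolding e sum.distrib by (simp only: sum_distrib_left)
  then show ?thesis unfolding 1 2 3 by simp
qed

text \<open>Real and imaginary parts of \<open>E\<close> are each symmetric and trace-free, and the
  real inner product of complex numbers has no mixed terms, so the real condition is used twice and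
  added.\<close>

lemma elliptic_complex:
  fixes E :: "'n::finite \<Rightarrow> 'n \<Rightarrow> complex"
  assumes A: "relaxed_elliptic A C" and sym: "\<And>i j. E i j = E j i" and tr: "(\<Sum>i\<in>UNIV. E i i) = 0"
  shows "C * (\<Sum>i\<in>UNIV. \<Sum>\<alpha>\<in>UNIV. (\<Sum>j\<in>UNIV. \<Sum>\<beta>\<in>UNIV. A i j \<alpha> \<beta> *\<^sub>R E j \<beta>) \<bullet> E i \<alpha>)
    \<ge> (\<Sum>i\<in>UNIV. \<Sum>\<alpha>\<in>UNIV. (cmod (E i \<alpha>))\<^sup>2)"
proof -
  have real: "C * (\<Sum>i\<in>UNIV. \<Sum>\<alpha>\<in>UNIV. \<Sum>j\<in>UNIV. \<Sum>\<beta>\<in>UNIV. A i j \<alpha> \<beta> * (f (E j \<beta>) * f (E i \<alpha>)))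
      \<ge> (\<Sum>i\<in>UNIV. \<Sum>\<alpha>\<in>UNIV. f (E i \<alpha>) * f (E i \<alpha>))" if f: "linear f" for f :: "complex \<Rightarrow> real"
  proof -
    define \<zeta> :: "real^'n^'n" where "\<zeta> = (\<chi> i \<alpha>. f (E i \<alpha>))"
    have "transpose \<zeta> = \<zeta>" by (simp add: transpose_def \<zeta>_def vec_eq_iff sym)
    moreover have "trace \<zeta> = 0"
      using linear_sum[OF f, of "\<lambda>i. E i i" UNIV] by (simp add: trace_def \<zeta>_def tr linear_0[OF f])
    ultimately have "C * (\<Sum>k\<in>UNIV. \<Sum>j\<in>UNIV. \<Sum>\<alpha>\<in>UNIV. \<Sum>\<beta>\<in>UNIV. A k j \<alpha> \<beta> * \<zeta> $ k $ \<alpha> * \<zeta> $ j $ \<beta>)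
        \<ge> (\<Sum>k\<in>UNIV. \<Sum>\<alpha>\<in>UNIV. \<zeta> $ k $ \<alpha> * \<zeta> $ k $ \<alpha>)"
      using A unfolding relaxed_elliptic_def by blast
    moreover have "(\<Sum>j\<in>UNIV. \<Sum>\<alpha>\<in>UNIV. \<Sum>\<beta>\<in>UNIV. A k j \<alpha> \<beta> * \<zeta> $ k $ \<alpha> * \<zeta> $ j $ \<beta>) =
        (\<Sum>\<alpha>\<in>UNIV. \<Sum>j\<in>UNIV. \<Sum>\<beta>\<in>UNIV. A k j \<alpha> \<beta> * (f (E j \<beta>) * f (E k \<alpha>)))" for k
      by (subst sum.swap) (simp add: \<zeta>_def mult_ac)
    ultimately show ?thesis by (simp add: \<zeta>_def)
  qed
  have "(\<Sum>i\<in>UNIV. \<Sum>\<alpha>\<in>UNIV. (\<Sum>j\<in>UNIV. \<Sum>\<beta>\<in>UNIV. A i j \<alpha> \<beta> *\<^sub>R E j \<beta>) \<bullet> E i \<alpha>) =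
      (\<Sum>i\<in>UNIV. \<Sum>\<alpha>\<in>UNIV. \<Sum>j\<in>UNIV. \<Sum>\<beta>\<in>UNIV. A i j \<alpha> \<beta> * (Re (E j \<beta>) * Re (E i \<alpha>))) +
      (\<Sum>i\<in>UNIV. \<Sum>\<alpha>\<in>UNIV. \<Sum>j\<in>UNIV. \<Sum>\<beta>\<in>UNIV. A i j \<alpha> \<beta> * (Im (E j \<beta>) * Im (E i \<alpha>)))"
    unfolding inner_sum_left sum.distrib[symmetric]
    by (intro sum.cong refl) (simp add: inner_complex_def algebra_simps)
  moreover have "(\<Sum>i\<in>UNIV. \<Sum>\<alpha>\<in>UNIV. (cmod (E i \<alpha>))\<^sup>2) =
      (\<Sum>i\<in>UNIV. \<Sum>\<alpha>\<in>UNIV. Re (E i \<alpha>) * Re (E i \<alpha>)) + (\<Sum>i\<in>UNIV. \<Sum>\<alpha>\<in>UNIV. Im (E i \<alpha>) * Im (E i \<alpha>))"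
    unfolding sum.distrib[symmetric] by (simp add: cmod_power2 flip: power2_eq_square)
  moreover have "linear Re" "linear Im" by (auto intro: linearI)
  ultimately show ?thesis using real[of Re] real[of Im] by (simp add: distrib_left)
qed

text \<open>Ellipticity is applied at each frequency to the coefficient of the strain. By
  \<open>symmetrized_gradient_sq\<close> its square is 2 pi^2 \<open>nrm2 \<xi>\<close> times that
  of the velocity coefficient, and \<open>weight_le_nrm2\<close> turns this into pi^2 times the
  weighted square.\<close>

lemma elliptic_energy:
  assumes A: "tensor_symmetric A" "relaxed_elliptic A C" and u: "u \<in> vHs_dot 1" and div: "dvg u = 0"
  shows "pi\<^sup>2 * (vHs_norm 1 u)\<^sup>2 \<le> C * vpairing (- lop A u) u"
proof -
  define E where "E \<xi> j \<beta> = fourier (strain u j \<beta>) \<xi>" for \<xi> j \<beta>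
  define x where "x = vembed 1 u"
  let ?e = "\<lambda>\<xi>. \<Sum>i\<in>UNIV. \<Sum>\<alpha>\<in>UNIV. fourier (stress A u i \<alpha>) \<xi> \<bullet> E \<xi> i \<alpha>"
  have st: "stress A u i \<alpha> \<in> Hs 0" "strain u i \<alpha> \<in> Hs 0" for i \<alpha>
    by (rule stress_L2[OF u] strain_L2[OF u])+
  have sq: "(\<lambda>\<xi>. (norm (fourier g \<xi>))\<^sup>2) summable_on UNIV" if "g \<in> Hs 0" for g :: "'a pdist"
    using that by (simp add: Hs_def)
  have t: "(\<lambda>\<xi>. fourier (stress A u i \<alpha>) \<xi> \<bullet> E \<xi> i \<alpha>) summable_on UNIV" for i \<alpha>
    unfolding E_def by (intro square_summable_inner sq st)
  have pair: "pairing (stress A u i \<alpha>) (strain u i \<alpha>) = (\<Sum>\<^sub>\<infinity>\<xi>. fourier (stress A u i \<alpha>) \<xi> \<bullet> E \<xi> i \<alpha>)" for i \<alpha>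
    using st[of i \<alpha>] by (simp add: pairing_eq_inner[where s = 0] inner_ell2_eq sembed_nth E_def)
  have e_sum: "?e summable_on UNIV" by (intro infsum_finite_sum t)
  have "vpairing (- lop A u) u = (\<Sum>i\<in>UNIV. \<Sum>\<alpha>\<in>UNIV. pairing (stress A u i \<alpha>) (strain u i \<alpha>))"
    by (rule pairing_stress_strain[OF A(1) u u, symmetric])
  also have "\<dots> = (\<Sum>\<^sub>\<infinity>\<xi>. ?e \<xi>)"
    unfolding pair by (simp add: infsum_finite_sum t)
  finally have eq: "vpairing (- lop A u) u = (\<Sum>\<^sub>\<infinity>\<xi>. ?e \<xi>)" .
  have pw: "pi\<^sup>2 * (norm (ell2_nth x \<xi>))\<^sup>2 \<le> C * ?e \<xi>" for \<xi>
  proof -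
    let ?z = "\<lambda>k. fourier (u $ k) \<xi>" and ?a = "\<lambda>j. real_of_int (\<xi> $ j)"
    have E: "E \<xi> j \<beta> = (pi * \<i>) * (?a j *\<^sub>R ?z \<beta> + ?a \<beta> *\<^sub>R ?z j)" for j \<beta>
      by (simp add: E_def strain_def fourier_ddiff scaleR_conv_of_real algebra_simps)
    have "(2 * pi * \<i>) * (\<Sum>j\<in>UNIV. ?a j *\<^sub>R ?z j) = fourier (dvg u) \<xi>"
      by (simp add: dvg_def fourier_ddiff scaleR_conv_of_real sum_distrib_left mult.assoc)
    then have az: "(\<Sum>j\<in>UNIV. ?a j *\<^sub>R ?z j) = 0" by (simp add: div)
    \<comment> \<open>The trace of the strain is the divergence, which makes the relaxed condition
      applicable.\<close>
    have tr: "(\<Sum>j\<in>UNIV. E \<xi> j j) = 0"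
      unfolding E sum_distrib_left[symmetric] sum.distrib az by simp
    have stress: "fourier (stress A u i \<alpha>) \<xi> = (\<Sum>j\<in>UNIV. \<Sum>\<beta>\<in>UNIV. A i j \<alpha> \<beta> *\<^sub>R E \<xi> j \<beta>)" for i \<alpha>
      by (simp add: stress_def E_def)
    have "weight \<xi> * (\<Sum>k\<in>UNIV. (cmod (?z k))\<^sup>2) \<le> 2 * nrm2 \<xi> * (\<Sum>k\<in>UNIV. (cmod (?z k))\<^sup>2)"
    proof (cases "\<xi> = 0")
      case True
      then show ?thesis using vHs_dotD(2)[OF u] by simp
    next
      case False
      then show ?thesis by (intro mult_right_mono weight_le_nrm2 sum_nonneg) auto
    qed
    then have "pi\<^sup>2 * (weight \<xi> * (\<Sum>k\<in>UNIV. (cmod (?z k))\<^sup>2)) \<le> pi\<^sup>2 * (2 * nrm2 \<xi> * (\<Sum>k\<in>UNIV. (cmod (?z k))\<^sup>2))"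
      by (intro mult_left_mono) auto
    also have "\<dots> = (\<Sum>j\<in>UNIV. \<Sum>\<beta>\<in>UNIV. (cmod (E \<xi> j \<beta>))\<^sup>2)"
      unfolding nrm2_def symmetrized_gradient_sq[OF az, symmetric] E
      by (simp add: norm_mult power_mult_distrib sum_distrib_left)
    also have "\<dots> \<le> C * ?e \<xi>"
      unfolding stress by (rule elliptic_complex[OF A(2)]) (simp_all only: tr, simp add: E add.commute)
    also have "weight \<xi> * (\<Sum>k\<in>UNIV. (cmod (?z k))\<^sup>2) = (norm (ell2_nth x \<xi>))\<^sup>2"
      using vHs_dotD[OF u]
      by (simp add: x_def norm_vec_sq vembed_nth power_mult_distrib weight_powr_half_sq[of _ 1, simplified] sum_distrib_left)
    finally show ?thesis .
  qed
  have "pi\<^sup>2 * (norm x)\<^sup>2 = (\<Sum>\<^sub>\<infinity>\<xi>. pi\<^sup>2 * (norm (ell2_nth x \<xi>))\<^sup>2)"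
    by (simp add: norm_ell2_sq infsum_cmult_right')
  also have "\<dots> \<le> (\<Sum>\<^sub>\<infinity>\<xi>. C * ?e \<xi>)"
    by (intro infsum_mono pw summable_on_cmult_right ell2_summable e_sum)
  also have "\<dots> = C * vpairing (- lop A u) u" by (simp only: infsum_cmult_right' eq)
  finally show ?thesis by (simp add: x_def norm_vembed[OF u])
qed

section \<open>The Leray projection and the pressure\<close>

lemma Hs_norm_eq_zero: "g \<in> Hs s \<Longrightarrow> Hs_norm s g = 0 \<Longrightarrow> g = 0"
proof -
  assume g: "g \<in> Hs s" "Hs_norm s g = 0"
  have "fourier g \<xi> = 0" for \<xi>
    using norm_fourier_le_Hs_norm[OF g(1), of \<xi>] g(2) by (simp add: mult_le_0_iff)
  then show "g = 0" by (intro fourier_inject) simp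
qed

text \<open>For nonnegative \<open>s\<close> the weight factor is at least 1, so the domination
  already makes \<open>c\<close> square-summable and \<open>riesz_fischer\<close> applies. It builds
  pressures (s = 0) and velocities (s = 1).\<close>

lemma pdist_with_fourier:
  fixes x :: "(int^'n::finite, 'b::real_inner) ell2"
  assumes herm: "\<And>\<xi>. c (- \<xi>) = cnj (c \<xi>)" and "c 0 = 0" and "s \<ge> 0" "K \<ge> 0"
    and le: "\<And>\<xi>. weight \<xi> powr (s/2) * cmod (c \<xi>) \<le> K * norm (ell2_nth x \<xi>)"
  obtains D where "D \<in> Hs_dot s" "\<And>\<xi>. fourier D \<xi> = c \<xi>" "Hs_norm s D \<le> K * norm x"
proof -
  have le2: "(cmod (c \<xi>))\<^sup>2 \<le> K\<^sup>2 * (norm (ell2_nth x \<xi>))\<^sup>2" for \<xi>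
  proof -
    have "1 \<le> weight \<xi> powr (s/2)" using weight_ge_1[of \<xi>] \<open>s \<ge> 0\<close> by (simp add: ge_one_powr_ge_zero)
    then have "1 * cmod (c \<xi>) \<le> weight \<xi> powr (s/2) * cmod (c \<xi>)" by (intro mult_right_mono) auto
    then have "cmod (c \<xi>) \<le> K * norm (ell2_nth x \<xi>)" using le[of \<xi>] by linarith
    from power_mono[OF this, of 2] show ?thesis by (simp add: power_mult_distrib)
  qed
  have "(\<lambda>\<xi>. (cmod (c \<xi>))\<^sup>2) summable_on UNIV"
    by (rule summable_on_comparison_test[OF summable_on_cmult_right[OF ell2_summable]]) (use le2 in auto)
  from riesz_fischer[OF herm this] obtain h where h: "\<And>\<xi>. fourier (dist_of h) \<xi> = c \<xi>" by blast
  have "dist_of h \<in> Hs s" "Hs_norm s (dist_of h) \<le> K * norm x"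
    by (rule Hs_dominated[OF \<open>K \<ge> 0\<close>, where x = x]; simp add: h le)+
  then show ?thesis using that[of "dist_of h"] h \<open>c 0 = 0\<close> by (simp add: Hs_dot_def)
qed

text \<open>Hermitian symmetry encodes real-valued distributions, the zero entry mean value zero;
  this is the image of \<open>vHs_dot 1\<close> under \<open>vembed 1\<close>.\<close>

definition hermitian_ell2 :: "(int^'n::finite, complex^'n) ell2 set" where
  "hermitian_ell2 = {x. (\<forall>\<xi> k. ell2_nth x (- \<xi>) $ k = cnj (ell2_nth x \<xi> $ k)) \<and> ell2_nth x 0 = 0}"

text \<open>The weight in the coordinates scales a frequency as a whole, so the condition has the
  same form as for unweighted Fourier coefficients.\<close>

definition solenoidal_ell2 :: "(int^'n::finite, complex^'n) ell2 set" where
  "solenoidal_ell2 = {x \<in> hermitian_ell2. \<forall>\<xi>. (\<Sum>k\<in>UNIV. real_of_int (\<xi> $ k) *\<^sub>R ell2_nth x \<xi> $ k) = 0}"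

lemma vembed_hermitian: "u \<in> vHs_dot s \<Longrightarrow> vembed s u \<in> hermitian_ell2"
  by (simp add: hermitian_ell2_def vec_eq_iff vembed_nth vHs_dotD fourier_minus)

lemma vembed_surj:
  assumes "x \<in> hermitian_ell2" obtains u where "u \<in> vHs_dot 1" "vembed 1 u = x"
proof -
  have w: "weight \<xi> powr (1/2) * weight \<xi> powr (-1/2) = 1" for \<xi> :: "int^'a"
    by (simp add: powr_add[symmetric])
  have "\<exists>D. D \<in> Hs_dot 1 \<and> (\<forall>\<xi>. fourier D \<xi> = (weight \<xi> powr (-1/2)) *\<^sub>R ell2_nth x \<xi> $ k)" for k
  proof (rule pdist_with_fourier[where K = 1 and s = 1 and x = x and c = "\<lambda>\<xi>. (weight \<xi> powr (-1/2)) *\<^sub>R ell2_nth x \<xi> $ k"])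
    fix \<xi>
    have "weight \<xi> powr (1/2) * cmod ((weight \<xi> powr (-1/2)) *\<^sub>R ell2_nth x \<xi> $ k) =
        (weight \<xi> powr (1/2) * weight \<xi> powr (-1/2)) * cmod (ell2_nth x \<xi> $ k)" by simp
    also have "\<dots> = cmod (ell2_nth x \<xi> $ k)" unfolding w by simp
    finally have e: "weight \<xi> powr (1/2) * cmod ((weight \<xi> powr (-1/2)) *\<^sub>R ell2_nth x \<xi> $ k) = cmod (ell2_nth x \<xi> $ k)" .
    show "weight \<xi> powr (1/2) * cmod ((weight \<xi> powr (-1/2)) *\<^sub>R ell2_nth x \<xi> $ k) \<le> 1 * norm (ell2_nth x \<xi>)"
      unfolding e using Finite_Cartesian_Product.norm_nth_le[of "ell2_nth x \<xi>" k] by simp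
  qed (use assms in \<open>auto simp: hermitian_ell2_def\<close>)
  then obtain D where D: "\<And>k. D k \<in> Hs_dot 1" "\<And>k \<xi>. fourier (D k) \<xi> = (weight \<xi> powr (-1/2)) *\<^sub>R ell2_nth x \<xi> $ k"
    by metis
  define u where "u = (\<chi> k. D k)"
  have u: "u \<in> vHs_dot 1" by (simp add: u_def vHs_dot_def D)
  have "vembed 1 u = x"
  proof (rule ell2_eqI)
    fix \<xi>
    have "ell2_nth (vembed 1 u) \<xi> $ k = (weight \<xi> powr (1/2) * weight \<xi> powr (-1/2)) *\<^sub>R ell2_nth x \<xi> $ k" for k
      unfolding vembed_nth[OF vHs_dotD(1)[OF u]] by (simp add: u_def D)
    then show "ell2_nth (vembed 1 u) \<xi> = ell2_nth x \<xi>" unfolding w by (simp add: vec_eq_iff)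
  qed
  then show ?thesis using that u by blast
qed

lemma vembed_inject: "u \<in> vHs_dot s \<Longrightarrow> v \<in> vHs_dot s \<Longrightarrow> vembed s u = vembed s v \<Longrightarrow> u = v"
  using vembed_eq_zero[of "u - v" s] by (simp add: vembed_diff vHs_dot_simps)

lemma vembed_solenoidal:
  assumes u: "u \<in> vHs_dot 1"
  shows "vembed 1 u \<in> solenoidal_ell2 \<longleftrightarrow> dvg u = 0"
proof -
  have "(\<Sum>k\<in>UNIV. real_of_int (\<xi> $ k) *\<^sub>R ell2_nth (vembed 1 u) \<xi> $ k) =
      (weight \<xi> powr (1/2)) *\<^sub>R (\<Sum>k\<in>UNIV. real_of_int (\<xi> $ k) *\<^sub>R fourier (u $ k) \<xi>)" for \<xi>
    by (simp add: vembed_nth vHs_dotD[OF u] scaleR_sum_right mult.commute)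
  moreover have "fourier (dvg u) \<xi> = (2 * pi * \<i>) * (\<Sum>k\<in>UNIV. real_of_int (\<xi> $ k) *\<^sub>R fourier (u $ k) \<xi>)" for \<xi>
    by (simp add: dvg_def fourier_ddiff scaleR_conv_of_real sum_distrib_left mult.assoc)
  ultimately have "vembed 1 u \<in> solenoidal_ell2 \<longleftrightarrow> (\<forall>\<xi>. fourier (dvg u) \<xi> = 0)"
    using vembed_hermitian[OF u] by (simp add: solenoidal_ell2_def)
  also have "\<dots> \<longleftrightarrow> dvg u = 0" using fourier_inject[of "dvg u" 0] by auto
  finally show ?thesis .
qed

lemma continuous_on_ell2_nth: "continuous_on S (\<lambda>x. ell2_nth x i)"
  by (rule linear_continuous_on[OF bounded_linear_ell2_nth])

lemma complete_solenoidal: "complete solenoidal_ell2"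
proof -
  have "closed {x :: (int^'n::finite, complex^'n) ell2.
      ((\<forall>\<xi> k. ell2_nth x (- \<xi>) $ k = cnj (ell2_nth x \<xi> $ k)) \<and> ell2_nth x 0 = 0) \<and>
      (\<forall>\<xi>. (\<Sum>k\<in>UNIV. real_of_int (\<xi> $ k) *\<^sub>R ell2_nth x \<xi> $ k) = 0)}"
    by (intro closed_Collect_conj closed_Collect_all closed_Collect_eq continuous_intros continuous_on_ell2_nth)
  then show ?thesis
    by (simp add: solenoidal_ell2_def hermitian_ell2_def complete_eq_closed)
qed

lemma subspace_solenoidal: "subspace solenoidal_ell2"
proof (rule subspaceI)
  fix c and x :: "(int^'n::finite, complex^'n) ell2" assume x: "x \<in> solenoidal_ell2"
  have "(\<Sum>k\<in>UNIV. real_of_int (\<xi> $ k) *\<^sub>R ell2_nth (c *\<^sub>R x) \<xi> $ k) =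
      c *\<^sub>R (\<Sum>k\<in>UNIV. real_of_int (\<xi> $ k) *\<^sub>R ell2_nth x \<xi> $ k)" for \<xi>
    by (simp add: scaleR_sum_right mult.commute)
  then show "c *\<^sub>R x \<in> solenoidal_ell2"
    using x by (simp add: solenoidal_ell2_def) (simp add: hermitian_ell2_def)
qed (simp_all add: solenoidal_ell2_def hermitian_ell2_def scaleR_right_distrib sum.distrib)

text \<open>At the frequency \<open>0\<close> the division by \<open>nrm2 0 = 0\<close> gives \<open>0\<close>, so that \<open>leray 0\<close> is the identity.\<close>

definition leray :: "int^'n::finite \<Rightarrow> complex^'n \<Rightarrow> complex^'n" where
  "leray \<xi> z = (\<chi> k. z $ k - (real_of_int (\<xi> $ k) / nrm2 \<xi>) *\<^sub>R (\<Sum>j\<in>UNIV. real_of_int (\<xi> $ j) *\<^sub>R z $ j))"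

lemma leray_solenoidal: "(\<Sum>k\<in>UNIV. real_of_int (\<xi> $ k) *\<^sub>R leray \<xi> z $ k) = 0"
proof (cases "\<xi> = 0")
  case False
  let ?S = "\<Sum>j\<in>UNIV. real_of_int (\<xi> $ j) *\<^sub>R z $ j"
  have n: "nrm2 \<xi> \<noteq> 0" using nrm2_eq_0 False by blast
  have "(\<Sum>k\<in>UNIV. real_of_int (\<xi> $ k) *\<^sub>R leray \<xi> z $ k) = ?S - (\<Sum>k\<in>UNIV. ((real_of_int (\<xi> $ k))\<^sup>2 / nrm2 \<xi>) *\<^sub>R ?S)"
    by (simp add: leray_def scaleR_diff_right sum_subtractf power2_eq_square)
  also have "(\<Sum>k\<in>UNIV. ((real_of_int (\<xi> $ k))\<^sup>2 / nrm2 \<xi>) *\<^sub>R ?S) = (nrm2 \<xi> / nrm2 \<xi>) *\<^sub>R ?S"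
    by (simp only: scaleR_sum_left[symmetric] sum_divide_distrib[symmetric] nrm2_def)
  finally show ?thesis using n by simp
qed simp

lemma leray_diff: "leray \<xi> (x - y) = leray \<xi> x - leray \<xi> y"
  by (simp add: leray_def vec_eq_iff scaleR_diff_right sum_subtractf)

text \<open>A rough bound suffices: it only enters the continuity constant \<open>M\<close> of
  \<open>coercive_surjective\<close> and stays out of the constants of the theorem.\<close>

lemma norm_leray_le: "norm (leray \<xi> z) \<le> CARD('n) * (1 + CARD('n)) * norm (z :: complex^'n::finite)"
proof -
  have comp: "cmod (leray \<xi> z $ k) \<le> (1 + CARD('n)) * norm z" for k
  proof -
    let ?S = "\<Sum>j\<in>UNIV. real_of_int (\<xi> $ j) *\<^sub>R z $ j"
    have prod: "\<bar>real_of_int (\<xi> $ k)\<bar> * \<bar>real_of_int (\<xi> $ j)\<bar> \<le> nrm2 \<xi>" for j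
    proof -
      have "\<bar>real_of_int (\<xi> $ i)\<bar> \<le> sqrt (nrm2 \<xi>)" for i
        unfolding nrm2_def by (intro real_le_rsqrt, subst power2_abs, rule member_le_sum) auto
      then have "\<bar>real_of_int (\<xi> $ k)\<bar> * \<bar>real_of_int (\<xi> $ j)\<bar> \<le> sqrt (nrm2 \<xi>) * sqrt (nrm2 \<xi>)"
        by (intro mult_mono) auto
      then show ?thesis by simp
    qed
    have "cmod ((real_of_int (\<xi> $ k) / nrm2 \<xi>) *\<^sub>R ?S) \<le> CARD('n) * norm z"
    proof (cases "\<xi> = 0")
      case False
      then have n: "nrm2 \<xi> > 0" using nrm2_eq_0[of \<xi>] nrm2_nonneg[of \<xi>] by linarith
      have "\<bar>real_of_int (\<xi> $ k)\<bar> * cmod ?S \<le> \<bar>real_of_int (\<xi> $ k)\<bar> * (\<Sum>j\<in>UNIV. \<bar>real_of_int (\<xi> $ j)\<bar> * cmod (z $ j))"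
        by (intro mult_left_mono order_trans[OF norm_sum] sum_mono) auto
      also have "\<dots> = (\<Sum>j\<in>UNIV. (\<bar>real_of_int (\<xi> $ k)\<bar> * \<bar>real_of_int (\<xi> $ j)\<bar>) * cmod (z $ j))"
        by (simp add: sum_distrib_left mult.assoc)
      also have "\<dots> \<le> (\<Sum>j\<in>(UNIV :: 'n set). nrm2 \<xi> * norm z)"
        by (intro sum_mono mult_mono prod Finite_Cartesian_Product.norm_nth_le) auto
      finally show ?thesis using n by (simp add: field_simps)
    qed simp
    moreover have "cmod (leray \<xi> z $ k) \<le> cmod (z $ k) + cmod ((real_of_int (\<xi> $ k) / nrm2 \<xi>) *\<^sub>R ?S)"
      unfolding leray_def vec_lambda_beta by (rule norm_triangle_ineq4)
    moreover have "cmod (z $ k) \<le> norm z" by (rule Finite_Cartesian_Product.norm_nth_le)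
    ultimately show ?thesis by (simp add: distrib_right)
  qed
  have "norm (leray \<xi> z) \<le> (\<Sum>k\<in>UNIV. cmod (leray \<xi> z $ k))"
    unfolding norm_vec_def by (rule L2_set_le_sum) simp
  also have "\<dots> \<le> (\<Sum>k\<in>(UNIV :: 'n set). (1 + CARD('n)) * norm z)" by (intro sum_mono comp)
  finally show ?thesis by (simp add: algebra_simps)
qed

definition Leray :: "(int^'n::finite, complex^'n) ell2 \<Rightarrow> (int^'n, complex^'n) ell2" where
  "Leray x = Abs_ell2 (\<lambda>\<xi>. leray \<xi> (ell2_nth x \<xi>))"

lemma
  fixes x :: "(int^'n::finite, complex^'n) ell2"
  shows Leray_nth: "ell2_nth (Leray x) \<xi> = leray \<xi> (ell2_nth x \<xi>)"
    and norm_Leray_le: "norm (Leray x) \<le> CARD('n) * (1 + CARD('n)) * norm x"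
proof -
  let ?K = "real (CARD('n) * (1 + CARD('n)))"
  have le: "(norm (leray \<xi> (ell2_nth x \<xi>)))\<^sup>2 \<le> ?K\<^sup>2 * (norm (ell2_nth x \<xi>))\<^sup>2" for \<xi>
    using power_mono[OF norm_leray_le[of \<xi> "ell2_nth x \<xi>"] norm_ge_zero, of 2] by (simp add: power_mult_distrib)
  have sm: "(\<lambda>\<xi>. ?K\<^sup>2 * (norm (ell2_nth x \<xi>))\<^sup>2) summable_on UNIV"
    by (intro summable_on_cmult_right ell2_summable)
  have sl: "(\<lambda>\<xi>. (norm (leray \<xi> (ell2_nth x \<xi>)))\<^sup>2) summable_on UNIV"
    by (rule summable_on_comparison_test[OF sm]) (use le in auto)
  have nth: "ell2_nth (Leray x) = (\<lambda>\<xi>. leray \<xi> (ell2_nth x \<xi>))"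
    unfolding Leray_def by (rule ell2_nth_Abs[OF sl])
  then show "ell2_nth (Leray x) \<xi> = leray \<xi> (ell2_nth x \<xi>)" by simp
  have "(norm (Leray x))\<^sup>2 \<le> (\<Sum>\<^sub>\<infinity>\<xi>. ?K\<^sup>2 * (norm (ell2_nth x \<xi>))\<^sup>2)"
    unfolding norm_ell2_sq nth by (intro infsum_mono sl sm le)
  also have "\<dots> = (?K * norm x)\<^sup>2" by (simp add: infsum_cmult_right' norm_ell2_sq power_mult_distrib)
  finally show "norm (Leray x) \<le> CARD('n) * (1 + CARD('n)) * norm x"
    by (rule power2_le_imp_le) simp
qed

lemma Leray_diff: "Leray (x - y) = Leray x - Leray y"
  by (rule ell2_eqI) (simp add: Leray_nth leray_diff)

lemma Leray_solenoidal:
  assumes "x \<in> hermitian_ell2" shows "Leray x \<in> solenoidal_ell2"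
proof -
  have "leray (- \<xi>) (ell2_nth x (- \<xi>)) $ k = cnj (leray \<xi> (ell2_nth x \<xi>) $ k)" for \<xi> k
    using assms by (simp add: leray_def hermitian_ell2_def sum_negf cnj_sum)
  then show ?thesis
    using assms unfolding solenoidal_ell2_def
    by (simp add: Leray_nth leray_solenoidal) (simp add: hermitian_ell2_def Leray_nth leray_def vec_eq_iff)
qed

text \<open>The part removed by the projection is parallel to the frequency vector, hence orthogonal
  to a solenoidal family.\<close>

lemma inner_Leray:
  assumes "v \<in> solenoidal_ell2" shows "v \<bullet> Leray x = v \<bullet> x"
proof -
  have "ell2_nth v \<xi> \<bullet> leray \<xi> z = ell2_nth v \<xi> \<bullet> z" for \<xi> z
  proof -
    let ?S = "\<Sum>j\<in>UNIV. real_of_int (\<xi> $ j) *\<^sub>R z $ j"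
    have "ell2_nth v \<xi> \<bullet> leray \<xi> z = ell2_nth v \<xi> \<bullet> z - (\<Sum>k\<in>UNIV. ell2_nth v \<xi> $ k \<bullet> ((real_of_int (\<xi> $ k) / nrm2 \<xi>) *\<^sub>R ?S))"
      by (simp only: inner_vec_def leray_def vec_lambda_beta inner_diff_right sum_subtractf)
    also have "(\<Sum>k\<in>UNIV. ell2_nth v \<xi> $ k \<bullet> ((real_of_int (\<xi> $ k) / nrm2 \<xi>) *\<^sub>R ?S)) =
        (1 / nrm2 \<xi>) * ((\<Sum>k\<in>UNIV. real_of_int (\<xi> $ k) *\<^sub>R ell2_nth v \<xi> $ k) \<bullet> ?S)"
      unfolding inner_sum_left sum_distrib_left by (intro sum.cong refl) simp
    finally show ?thesis using assms by (simp add: solenoidal_ell2_def)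
  qed
  then show ?thesis by (simp add: inner_ell2_eq Leray_nth)
qed

lemma weight_le_pi_nrm2: "\<xi> \<noteq> 0 \<Longrightarrow> weight \<xi> / (2 * pi * nrm2 \<xi>) \<le> 1"
proof -
  assume "\<xi> \<noteq> 0"
  note nz = nrm2_ge_1[OF this] weight_le_nrm2[OF this]
  have "1 * nrm2 \<xi> \<le> pi * nrm2 \<xi>" using pi_ge_two by (intro mult_right_mono) auto
  then have "weight \<xi> \<le> 2 * pi * nrm2 \<xi>" using nz by linarith
  then show ?thesis using nz(1) by (simp add: divide_le_eq_1)
qed

text \<open>A vanishing projection means that each coefficient is parallel to its frequency, that
  is, a gradient symbol times a scalar. Dividing by that symbol gives the pressure.\<close>

lemma pressure_exists:
  fixes F :: "'n::finite vdist"
  assumes F: "F \<in> vHs_dot (-1)" and L: "Leray (vembed (-1) F) = 0"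
  obtains p where "p \<in> L2_dot" "grad p = F"
proof -
  define z where "z \<xi> = ell2_nth (vembed (-1) F) \<xi>" for \<xi>
  define S where "S \<xi> = (\<Sum>j\<in>UNIV. real_of_int (\<xi> $ j) *\<^sub>R z \<xi> $ j)" for \<xi>
  \<comment> \<open>Division by the symbol 2 pi i \<xi>; the factor
    \<open>weight \<xi> powr (1/2)\<close> undoes the weight of order -1 contained in
    \<open>z\<close>. At frequency 0 the value is 0.\<close>
  define c where "c \<xi> = ((weight \<xi> powr (1/2)) / (2 * pi * nrm2 \<xi>)) *\<^sub>R (S \<xi> / \<i>)" for \<xi>
  have z_eq: "z \<xi> $ k = (real_of_int (\<xi> $ k) / nrm2 \<xi>) *\<^sub>R S \<xi>" for \<xi> k
  proof -
    have "leray \<xi> (z \<xi>) $ k = 0" using arg_cong[OF L, of "\<lambda>x. ell2_nth x \<xi> $ k"] by (simp add: Leray_nth z_def)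
    then show ?thesis by (simp add: leray_def S_def)
  qed
  have herm: "z (- \<xi>) $ k = cnj (z \<xi> $ k)" for \<xi> k
    using vembed_hermitian[OF F] by (simp add: hermitian_ell2_def z_def)
  obtain p where p: "p \<in> L2_dot" "\<And>\<xi>. fourier p \<xi> = c \<xi>"
  proof (rule pdist_with_fourier[where K = "CARD('n)" and s = 0 and x = "vembed (-1) F" and c = c])
    show "c (- \<xi>) = cnj (c \<xi>)" for \<xi>
      by (simp add: c_def S_def herm sum_negf cnj_sum scaleR_conv_of_real)
    show "c 0 = 0" by (simp add: c_def S_def)
    fix \<xi>
    have "cmod (S \<xi>) \<le> (\<Sum>j\<in>(UNIV :: 'n set). weight \<xi> powr (1/2) * norm (z \<xi>))"
      unfolding S_def by (rule order_trans[OF norm_sum], rule sum_mono)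
        (auto intro!: mult_mono abs_component_le Finite_Cartesian_Product.norm_nth_le)
    then have S: "cmod (S \<xi>) \<le> CARD('n) * (weight \<xi> powr (1/2) * norm (z \<xi>))" by simp
    show "weight \<xi> powr (0/2) * cmod (c \<xi>) \<le> real CARD('n) * norm (ell2_nth (vembed (-1) F) \<xi>)"
    proof (cases "\<xi> = 0")
      case False
      have "cmod (c \<xi>) = (weight \<xi> powr (1/2)) / (2 * pi * nrm2 \<xi>) * cmod (S \<xi>)"
        by (simp add: c_def norm_divide norm_mult)
      also have "\<dots> \<le> (weight \<xi> powr (1/2)) / (2 * pi * nrm2 \<xi>) * (CARD('n) * (weight \<xi> powr (1/2) * norm (z \<xi>)))"
        by (intro mult_left_mono S) auto
      also have "\<dots> = (weight \<xi> powr (1/2) * weight \<xi> powr (1/2)) / (2 * pi * nrm2 \<xi>) * (CARD('n) * norm (z \<xi>))"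
        by simp
      also have "weight \<xi> powr (1/2) * weight \<xi> powr (1/2) = weight \<xi>"
        by (simp add: powr_add[symmetric])
      also have "weight \<xi> / (2 * pi * nrm2 \<xi>) * (CARD('n) * norm (z \<xi>)) \<le> 1 * (CARD('n) * norm (z \<xi>))"
        by (intro mult_right_mono weight_le_pi_nrm2 False) auto
      finally show ?thesis by (simp add: z_def)
    qed (simp add: c_def S_def)
  qed auto
  have "grad p $ k = F $ k" for k
  proof (rule fourier_inject)
    fix \<xi> :: "int^'n"
    have w: "weight \<xi> powr (1/2) * weight \<xi> powr (-1/2) = 1" by (simp add: powr_add[symmetric])
    have "fourier (grad p $ k) \<xi> = (weight \<xi> powr (1/2)) *\<^sub>R ((real_of_int (\<xi> $ k) / nrm2 \<xi>) *\<^sub>R S \<xi>)"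
      by (simp add: grad_def fourier_ddiff p c_def scaleR_conv_of_real field_simps)
    also have "\<dots> = (weight \<xi> powr (1/2)) *\<^sub>R (z \<xi> $ k)" by (simp only: z_eq)
    also have "\<dots> = (weight \<xi> powr (1/2) * weight \<xi> powr (-1/2)) *\<^sub>R fourier (F $ k) \<xi>"
      by (simp add: z_def vembed_nth vHs_dotD[OF F])
    finally show "fourier (grad p $ k) \<xi> = fourier (F $ k) \<xi>" by (simp only: w scaleR_one)
  qed
  then show ?thesis using that p(1) by (simp add: vec_eq_iff)
qed

text \<open>The lift is the gradient of the inverse Laplacian of \<open>g\<close>: in symbols, \<xi>
  / (2 pi i |\<xi>|^2) times the coefficient of \<open>g\<close>. The dimension factor is the
  triangle inequality over the components.\<close>

lemma divergence_lift:
  fixes g :: "'n::finite pdist"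
  assumes g: "g \<in> L2_dot"
  obtains u where "u \<in> vHs_dot 1" "dvg u = g" "vHs_norm 1 u \<le> CARD('n) * L2_norm g"
proof -
  have g0: "g \<in> Hs 0" "fourier g 0 = 0" using g by (auto simp: Hs_dot_def)
  define c where "c k \<xi> = (real_of_int (\<xi> $ k) / (2 * pi * nrm2 \<xi>)) *\<^sub>R (fourier g \<xi> / \<i>)" for k :: 'n and \<xi>
  have "\<exists>D. D \<in> Hs_dot 1 \<and> (\<forall>\<xi>. fourier D \<xi> = c k \<xi>) \<and> Hs_norm 1 D \<le> 1 * norm (sembed 0 g)" for k
  proof (rule pdist_with_fourier[where K = 1 and s = 1 and x = "sembed 0 g" and c = "c k"])
    show "c k (- \<xi>) = cnj (c k \<xi>)" for \<xi>
      by (simp add: c_def fourier_minus scaleR_conv_of_real)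
    show "c k 0 = 0" by (simp add: c_def)
    fix \<xi>
    show "weight \<xi> powr (1/2) * cmod (c k \<xi>) \<le> 1 * norm (ell2_nth (sembed 0 g) \<xi>)"
    proof (cases "\<xi> = 0")
      case False
      have "weight \<xi> powr (1/2) * cmod (c k \<xi>) = (weight \<xi> powr (1/2) * \<bar>real_of_int (\<xi> $ k)\<bar>) / (2 * pi * nrm2 \<xi>) * cmod (fourier g \<xi>)"
        by (simp add: c_def norm_divide norm_mult)
      also have "\<dots> \<le> (weight \<xi> powr (1/2) * weight \<xi> powr (1/2)) / (2 * pi * nrm2 \<xi>) * cmod (fourier g \<xi>)"
        by (intro mult_right_mono divide_right_mono mult_left_mono abs_component_le) auto
      also have "weight \<xi> powr (1/2) * weight \<xi> powr (1/2) = weight \<xi>"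
        by (simp add: powr_add[symmetric])
      also have "weight \<xi> / (2 * pi * nrm2 \<xi>) * cmod (fourier g \<xi>) \<le> 1 * cmod (fourier g \<xi>)"
        by (intro mult_right_mono weight_le_pi_nrm2 False) auto
      finally show ?thesis by (simp add: sembed_nth[OF g0(1)])
    qed (simp add: c_def)
  qed auto
  then obtain D where D: "\<And>k. D k \<in> Hs_dot 1" "\<And>k \<xi>. fourier (D k) \<xi> = c k \<xi>"
    "\<And>k. Hs_norm 1 (D k) \<le> L2_norm g"
    unfolding norm_sembed[OF g0(1)] mult_1 by metis
  define u where "u = (\<chi> k. D k)"
  have u: "u \<in> vHs_dot 1" by (simp add: u_def vHs_dot_def D)
  have "vHs_norm 1 u \<le> (\<Sum>k\<in>(UNIV :: 'n set). L2_norm g)"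
    by (rule order_trans[OF vHs_norm_le_sum], rule sum_mono) (simp add: u_def D)
  moreover have "dvg u = g"
  proof (rule fourier_inject)
    fix \<xi>
    show "fourier (dvg u) \<xi> = fourier g \<xi>"
    proof (cases "\<xi> = 0")
      case False
      then have n: "nrm2 \<xi> \<noteq> 0" by (simp add: nrm2_eq_0)
      have "fourier (dvg u) \<xi> = (\<Sum>k\<in>UNIV. ((real_of_int (\<xi> $ k))\<^sup>2 / nrm2 \<xi>) *\<^sub>R fourier g \<xi>)"
        unfolding dvg_def u_def fourier_sum vec_lambda_beta fourier_ddiff D c_def
        by (intro sum.cong refl) (simp add: scaleR_conv_of_real power2_eq_square field_simps)
      also have "\<dots> = (nrm2 \<xi> / nrm2 \<xi>) *\<^sub>R fourier g \<xi>"
        by (simp only: scaleR_sum_left[symmetric] sum_divide_distrib[symmetric] nrm2_def)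
      finally show ?thesis using n by simp
    qed (simp add: dvg_def g0)
  qed
  ultimately show ?thesis using that u by simp
qed

section \<open>The Oseen system\<close>

text \<open>Chosen from \<open>U\<close> alone, so that the constants of the theorem can be
  functions fixed before the tensor and the data.\<close>

definition convection_const :: "(real^'n::finite \<Rightarrow> real^'n) \<Rightarrow> real" where
  "convection_const U = (SOME M. M > 0 \<and> (\<forall>u\<in>vHs_dot 1. vHs_norm (-1) (convection U u) \<le> M * vHs_norm 1 u))"

text \<open>A bound for the momentum operator without pressure, from order 1 to order -1;
  \<open>a\<close> stands for \<open>tensor_norm A\<close>.\<close>

definition op_const :: "real \<Rightarrow> (real^'n::finite \<Rightarrow> real^'n) \<Rightarrow> real" where
  "op_const a U = real CARD('n) ^ 4 * (2 * pi)\<^sup>2 * a + convection_const U"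

text \<open>The lift of the divergence costs the dimension factor. The 1 is the lift itself; the
  other summand is the coercivity estimate for the force that the lift creates.\<close>

definition sol_const :: "real \<Rightarrow> real \<Rightarrow> (real^'n::finite \<Rightarrow> real^'n) \<Rightarrow> real" where
  "sol_const C a U = CARD('n) * (1 + C / pi\<^sup>2 * op_const a U)"

lemma lop_add: "lop A (u + v) = lop A u + lop A v"
  by (simp add: vec_eq_iff lop_def stress_def strain_def ddiff_add ddiff_sum ddiff_scale scaleR_right_distrib
      sum.distrib algebra_simps)

lemma lop_scale: "lop A (c *\<^sub>R u) = c *\<^sub>R lop A u"
proof -
  have "strain (c *\<^sub>R u) j \<beta> = c *\<^sub>R strain u j \<beta>" for j \<beta>
    by (simp add: strain_def ddiff_scale scaleR_right_distrib)
  then have "stress A (c *\<^sub>R u) k \<alpha> = c *\<^sub>R stress A u k \<alpha>" for k \<alpha>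
    by (simp add: stress_def scaleR_sum_right mult.commute)
  then show ?thesis
    by (simp add: vec_eq_iff lop_def ddiff_scale scaleR_sum_right)
qed

lemma grad_add: "grad (p + q) = grad p + grad q"
  by (simp add: grad_def vec_eq_iff ddiff_add)

lemma grad_scale: "grad (c *\<^sub>R p) = c *\<^sub>R grad p"
  by (simp add: grad_def vec_eq_iff ddiff_scale)

lemma dvg_add: "dvg (u + v) = dvg u + dvg v"
  by (simp add: dvg_def ddiff_add sum.distrib)

lemma dvg_scale: "dvg (c *\<^sub>R u) = c *\<^sub>R dvg u"
  by (simp add: dvg_def ddiff_scale scaleR_sum_right)

lemma vpairing_grad:
  assumes v: "v \<in> vHs_dot 1" and p: "p \<in> L2_dot"
  shows "vpairing (grad p) v = b_form v p"
proof -
  have p0: "p \<in> Hs 0" using p by (simp add: Hs_dot_def)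
  have d: "ddiff k (v $ k) \<in> Hs 0" for k by (rule ddiff_L2[OF v])
  have "pairing (grad p $ k) (v $ k) = - pairing (ddiff k (v $ k)) p" for k
  proof -
    have "pairing (grad p $ k) (v $ k) = - pairing p (ddiff k (v $ k))"
      by (simp add: grad_def pairing_ddiff)
    also have "pairing p (ddiff k (v $ k)) = pairing (ddiff k (v $ k)) p"
      using p0 d[of k] by (simp add: pairing_eq_inner[where s = 0] inner_commute)
    finally show ?thesis .
  qed
  then show ?thesis
    using p0 d by (simp add: vpairing_def b_form_def dvg_def sum_negf pairing_sum_left[where s = 0])
qed

lemma vpairing_add_left:
  "f \<in> vHs_dot (- s) \<Longrightarrow> f' \<in> vHs_dot (- s) \<Longrightarrow> v \<in> vHs_dot s \<Longrightarrow> vpairing (f + f') v = vpairing f v + vpairing f' v"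
  by (simp add: vpairing_eq_inner[where s = s] vHs_dot_simps vembed_add inner_add_left)

lemma vpairing_diff_left:
  "f \<in> vHs_dot (- s) \<Longrightarrow> f' \<in> vHs_dot (- s) \<Longrightarrow> v \<in> vHs_dot s \<Longrightarrow> vpairing (f - f') v = vpairing f v - vpairing f' v"
  by (simp add: vpairing_eq_inner[where s = s] vHs_dot_simps vembed_diff inner_diff_left)

text \<open>The test field is the Riesz representative of \<open>F\<close>: the field of order 1
  with the same coordinates.\<close>

lemma vpairing_nondegenerate:
  assumes F: "F \<in> vHs_dot (-1)" and zero: "\<And>v. v \<in> vHs_dot 1 \<Longrightarrow> vpairing F v = 0"
  shows "F = 0"
proof -
  obtain v where v: "v \<in> vHs_dot 1" "vembed 1 v = vembed (-1) F"
    using vembed_surj[OF vembed_hermitian[OF F]] by blast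
  have "vpairing F v = vembed (-1) F \<bullet> vembed (-1) F"
    using F v by (simp add: vpairing_eq_inner[where s = 1])
  then have "vembed (-1) F = 0" using zero[OF v(1)] by simp
  then show ?thesis by (rule vembed_eq_zero[OF F])
qed

lemma pairing_nondegenerate:
  assumes g: "g \<in> L2_dot" "g' \<in> L2_dot" and eq: "\<And>q. q \<in> L2_dot \<Longrightarrow> pairing g q = pairing g' q"
  shows "g = g'"
proof -
  have d: "g - g' \<in> L2_dot" "g - g' \<in> Hs 0" "g \<in> Hs 0" "g' \<in> Hs 0" using g by (auto simp: Hs_dot_simps Hs_dot_def intro: Hs_diff)
  have "sembed 0 (g - g') \<bullet> sembed 0 (g - g') = pairing g (g - g') - pairing g' (g - g')"
    using d by (simp add: pairing_eq_inner[where s = 0] sembed_diff inner_diff_left)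
  then have "norm (sembed 0 (g - g')) = 0" using eq[OF d(1)] by (simp add: norm_eq_sqrt_inner)
  then have "g - g' = 0" using d Hs_norm_eq_zero[of "g - g'" 0] by (simp add: norm_sembed)
  then show ?thesis by simp
qed

lemma pair_norm_bounds:
  "vHs_norm s (fst x) \<le> pair_norm s x" "L2_norm (snd x) \<le> pair_norm s x"
  "pair_norm s x \<le> vHs_norm s (fst x) + L2_norm (snd x)"
  by (auto simp: pair_norm_def case_prod_beta intro!: real_le_rsqrt sqrt_sum_squares_le_sum)

section \<open>Well-posedness for fixed coefficients\<close>

locale oseen =
  fixes A :: "'n::finite tensor" and C \<theta> :: real and U :: "real^'n \<Rightarrow> real^'n"
  assumes symmetric: "tensor_symmetric A" and elliptic: "relaxed_elliptic A C"
    and \<theta>: "\<theta> > 2" "\<theta> \<ge> real CARD('n)" and U: "U \<in> Lq_sol \<theta>"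
begin

definition T :: "'n vdist \<Rightarrow> 'n vdist" where "T u = - lop A u + convection U u"

abbreviation \<Lambda> :: real where "\<Lambda> \<equiv> op_const (tensor_norm A) U"
abbreviation K\<^sub>0 :: real where "K\<^sub>0 \<equiv> sol_const C (tensor_norm A) U"
abbreviation X :: "('n vdist \<times> 'n pdist) set" where "X \<equiv> vHs_dot 1 \<times> L2_dot"
abbreviation Y :: "('n vdist \<times> 'n pdist) set" where "Y \<equiv> vHs_dot (-1) \<times> L2_dot"

lemma C_pos: "C > 0"
  using elliptic by (simp add: relaxed_elliptic_def)

lemma U_Lq: "(\<lambda>x. U x $ j) \<in> Lq \<theta>" "(\<lambda>x. U x $ j) \<in> Lq 2"
proof -
  show "(\<lambda>x. U x $ j) \<in> Lq \<theta>" using U by (simp add: Lq_sol_def)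
  then show "(\<lambda>x. U x $ j) \<in> Lq 2" by (rule Lq_mono) (use \<theta> in auto)
qed

lemma convection_const:
  "convection_const U > 0" "u \<in> vHs_dot 1 \<Longrightarrow> vHs_norm (-1) (convection U u) \<le> convection_const U * vHs_norm 1 u"
proof -
  have "\<exists>M. M > 0 \<and> (\<forall>u\<in>vHs_dot 1. vHs_norm (-1) (convection U u) \<le> M * vHs_norm 1 u)"
    by (rule convection_bound[OF \<theta> U_Lq(1)]) blast
  from someI_ex[OF this]
  show "convection_const U > 0" "u \<in> vHs_dot 1 \<Longrightarrow> vHs_norm (-1) (convection U u) \<le> convection_const U * vHs_norm 1 u"
    unfolding convection_const_def by auto
qed

lemma \<Lambda>_pos: "\<Lambda> > 0"
  using convection_const(1) by (simp add: op_const_def tensor_norm_nonneg add_nonneg_pos)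

lemma T_vHs_dot: "u \<in> vHs_dot 1 \<Longrightarrow> T u \<in> vHs_dot (-1)"
  unfolding T_def by (intro vHs_dot_simps lop_vHs_dot convection_solenoidal[OF \<theta> U])

lemma T_bound:
  assumes u: "u \<in> vHs_dot 1" shows "vHs_norm (-1) (T u) \<le> \<Lambda> * vHs_norm 1 u"
proof -
  have "vHs_norm (-1) (T u) \<le> vHs_norm (-1) (convection U u) + vHs_norm (-1) (lop A u)"
    using vHs_norm_triangle_diff[of "convection U u" "-1" "lop A u"] convection_solenoidal(1)[OF \<theta> U u] lop_vHs_dot(1)[OF u]
    by (simp add: T_def)
  also have "\<dots> \<le> convection_const U * vHs_norm 1 u + real CARD('n) ^ 4 * (2 * pi)\<^sup>2 * tensor_norm A * vHs_norm 1 u"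
    by (intro add_mono convection_const lop_vHs_dot u)
  finally show ?thesis by (simp add: op_const_def algebra_simps)
qed

lemma T_add: "u \<in> vHs_dot 1 \<Longrightarrow> v \<in> vHs_dot 1 \<Longrightarrow> T (u + v) = T u + T v"
  by (simp add: T_def lop_add convection_add U_Lq)

lemma T_scale: "u \<in> vHs_dot 1 \<Longrightarrow> T (c *\<^sub>R u) = c *\<^sub>R T u"
  by (simp add: T_def lop_scale convection_scale U_Lq scaleR_diff_right)

lemma T_diff: "u \<in> vHs_dot 1 \<Longrightarrow> v \<in> vHs_dot 1 \<Longrightarrow> T (u - v) = T u - T v"
  using T_add[of u "(-1) *\<^sub>R v"] T_scale[of v "-1"] vHs_dot_simps(4)[of v 1 "-1"] by simp

lemma a_form_T:
  assumes u: "u \<in> vHs_dot 1" and v: "v \<in> vHs_dot 1"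
  shows "a_form A U u v = vpairing (T u) v"
  unfolding a_form_def T_def pairing_stress_strain[OF symmetric u v]
  by (rule vpairing_add_left[where s = 1, symmetric])
    (simp_all add: vHs_dot_simps lop_vHs_dot u v convection_solenoidal(1)[OF \<theta> U u])

text \<open>Convection drops out on the diagonal, so the constant is independent of
  \<open>U\<close>.\<close>

lemma T_coercive:
  assumes u: "u \<in> vHs_dot 1" and div: "dvg u = 0"
  shows "pi\<^sup>2 / C * (vHs_norm 1 u)\<^sup>2 \<le> vpairing (T u) u"
proof -
  have "vpairing (T u) u = vpairing (- lop A u) u + vpairing (convection U u) u"
    unfolding T_def by (rule vpairing_add_left[where s = 1])
      (simp_all add: vHs_dot_simps lop_vHs_dot u convection_solenoidal(1)[OF \<theta> U u])
  then have "vpairing (T u) u = vpairing (- lop A u) u"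
    using convection_solenoidal(2)[OF \<theta> U u] by simp
  moreover have "pi\<^sup>2 * (vHs_norm 1 u)\<^sup>2 \<le> C * vpairing (- lop A u) u"
    by (rule elliptic_energy[OF symmetric elliptic u div])
  ultimately show ?thesis using C_pos by (simp add: field_simps)
qed

lemma oseen_solution_iff:
  "oseen_solution A U (f, g) (u, p) \<longleftrightarrow>
    u \<in> vHs_dot 1 \<and> p \<in> L2_dot \<and> T u + grad p = f \<and> dvg u = g"
  by (auto simp: oseen_solution_def T_def algebra_simps)

text \<open>The weak form pairs the residuals with all mean-zero test objects. The residuals have
  mean value zero too, so nondegeneracy of the pairings recovers the equations.\<close>

lemma oseen_iff_variational:
  assumes f: "f \<in> vHs_dot (-1)" and g: "g \<in> L2_dot"
  shows "oseen_solution A U (f, g) (u, p) \<longleftrightarrow> variational_solution A U (f, g) (u, p)"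
proof (cases "u \<in> vHs_dot 1 \<and> p \<in> L2_dot")
  case True
  then have u: "u \<in> vHs_dot 1" and p: "p \<in> L2_dot" by auto
  let ?R = "T u + grad p"
  have R: "?R \<in> vHs_dot (-1)" by (intro vHs_dot_simps T_vHs_dot grad_vHs_dot u p)
  have weak: "a_form A U u v + b_form v p = vpairing ?R v" if v: "v \<in> vHs_dot 1" for v
    using vpairing_add_left[of "T u" 1 "grad p" v] T_vHs_dot[OF u] grad_vHs_dot(1)[OF p] v
    by (simp add: a_form_T u vpairing_grad p)
  have "(\<forall>v\<in>vHs_dot 1. a_form A U u v + b_form v p = vpairing f v) \<longleftrightarrow> ?R = f"
  proof
    assume *: "\<forall>v\<in>vHs_dot 1. a_form A U u v + b_form v p = vpairing f v"
    have "?R - f = 0"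
    proof (rule vpairing_nondegenerate)
      show "?R - f \<in> vHs_dot (-1)" by (intro vHs_dot_simps R f)
      show "vpairing (?R - f) v = 0" if "v \<in> vHs_dot 1" for v
        using * vpairing_diff_left[of ?R 1 f v] R f weak that by auto
    qed
    then show "?R = f" by simp
  qed (use weak in auto)
  moreover have "(\<forall>q\<in>L2_dot. b_form u q = - pairing g q) \<longleftrightarrow> dvg u = g"
    using pairing_nondegenerate[OF dvg_L2_dot(1)[OF u] g] by (auto simp: b_form_def)
  ultimately show ?thesis
    using u p by (simp add: oseen_solution_iff variational_solution_def)
qed (auto simp: oseen_solution_iff variational_solution_def)

lemma solenoidal_solution:
  assumes F: "F \<in> vHs_dot (-1)"
  obtains u p where "u \<in> vHs_dot 1" "p \<in> L2_dot" "dvg u = 0" "T u + grad p = F"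
proof -
  let ?V = "solenoidal_ell2 :: (int^'n, complex^'n) ell2 set"
  let ?P = "\<lambda>F. Leray (vembed (-1) F)"
  \<comment> \<open>The preimage under \<open>vembed 1\<close>. It is unique by
    \<open>vembed_inject\<close>, which is why differences are respected below.\<close>
  define of_ell2 :: "(int^'n, complex^'n) ell2 \<Rightarrow> 'n vdist" where
    "of_ell2 x = (SOME u. u \<in> vHs_dot 1 \<and> vembed 1 u = x)" for x
  have of: "of_ell2 x \<in> vHs_dot 1" "vembed 1 (of_ell2 x) = x" "dvg (of_ell2 x) = 0" if "x \<in> ?V" for x
  proof -
    have "x \<in> hermitian_ell2" using that by (simp add: solenoidal_ell2_def)
    then have "\<exists>u. u \<in> vHs_dot 1 \<and> vembed 1 u = x" using vembed_surj by metis
    from someI_ex[OF this] show *: "of_ell2 x \<in> vHs_dot 1" "vembed 1 (of_ell2 x) = x"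
      unfolding of_ell2_def by auto
    then show "dvg (of_ell2 x) = 0" using that vembed_solenoidal by metis
  qed
  define G where "G x = ?P (T (of_ell2 x))" for x
  have PV: "?P H \<in> ?V" if "H \<in> vHs_dot (-1)" for H by (intro Leray_solenoidal vembed_hermitian that)
  have nrm: "vHs_norm 1 (of_ell2 x) = norm x" if "x \<in> ?V" for x
    using norm_vembed[OF of(1)[OF that]] of(2)[OF that] by simp
  have "\<exists>x\<in>?V. G x = ?P F"
  proof (rule coercive_surjective[where \<alpha> = "pi\<^sup>2 / C" and M = "CARD('n) * (1 + CARD('n)) * \<Lambda>"])
    show "complete ?V" by (rule complete_solenoidal)
    show "subspace ?V" by (rule subspace_solenoidal)
    show "pi\<^sup>2 / C > 0" using C_pos by simp
    show "?P F \<in> ?V" by (rule PV[OF F])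
    fix x assume x: "x \<in> ?V"
    show "G x \<in> ?V" unfolding G_def by (intro PV T_vHs_dot of x)
    have "norm (G x) \<le> CARD('n) * (1 + CARD('n)) * norm (vembed (-1) (T (of_ell2 x)))"
      unfolding G_def by (rule norm_Leray_le)
    also have "\<dots> \<le> CARD('n) * (1 + CARD('n)) * (\<Lambda> * vHs_norm 1 (of_ell2 x))"
      unfolding norm_vembed[OF T_vHs_dot[OF of(1)[OF x]]] by (intro mult_left_mono T_bound of x) auto
    finally show "norm (G x) \<le> CARD('n) * (1 + CARD('n)) * \<Lambda> * norm x" by (simp add: nrm[OF x] mult.assoc)
    \<comment> \<open>Against a solenoidal family the projection is invisible, so \<open>G\<close>
      inherits the coercivity of \<open>T\<close>.\<close>
    have "x \<bullet> G x = x \<bullet> vembed (-1) (T (of_ell2 x))" unfolding G_def by (rule inner_Leray[OF x])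
    also have "\<dots> = vpairing (T (of_ell2 x)) (of_ell2 x)"
      using of[OF x] T_vHs_dot[OF of(1)[OF x]] by (simp add: vpairing_eq_inner[where s = 1] inner_commute)
    also have "\<dots> \<ge> pi\<^sup>2 / C * (vHs_norm 1 (of_ell2 x))\<^sup>2" by (intro T_coercive of x)
    finally show "x \<bullet> G x \<ge> pi\<^sup>2 / C * (norm x)\<^sup>2" by (simp add: nrm[OF x])
  next
    fix x y assume xy: "x \<in> ?V" "y \<in> ?V"
    have d: "x - y \<in> ?V" by (rule subspace_diff[OF subspace_solenoidal xy])
    have "of_ell2 (x - y) = of_ell2 x - of_ell2 y"
      by (rule vembed_inject[where s = 1]) (simp_all add: vHs_dot_simps of xy d vembed_diff)
    then show "G (x - y) = G x - G y"
      unfolding G_def by (simp add: T_diff of xy vembed_diff T_vHs_dot Leray_diff)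
  qed
  then obtain x where x: "x \<in> ?V" "G x = ?P F" by blast
  have D: "F - T (of_ell2 x) \<in> vHs_dot (-1)" by (intro vHs_dot_simps F T_vHs_dot of x)
  have "?P (F - T (of_ell2 x)) = 0"
    using x by (simp add: G_def vembed_diff F T_vHs_dot of Leray_diff)
  then obtain p where p: "p \<in> L2_dot" "grad p = F - T (of_ell2 x)" using pressure_exists[OF D] by blast
  show ?thesis
    by (rule that[of "of_ell2 x" p]) (simp_all add: of x p)
qed

lemma oseen_exists:
  assumes f: "f \<in> vHs_dot (-1)" and g: "g \<in> L2_dot"
  shows "\<exists>u p. oseen_solution A U (f, g) (u, p)"
proof -
  obtain ug where ug: "ug \<in> vHs_dot 1" "dvg ug = g" using divergence_lift[OF g] by blast
  have "f - T ug \<in> vHs_dot (-1)" by (intro vHs_dot_simps f T_vHs_dot ug)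
  from solenoidal_solution[OF this] obtain u p where
    "u \<in> vHs_dot 1" "p \<in> L2_dot" "dvg u = 0" "T u + grad p = f - T ug" by blast
  then have "oseen_solution A U (f, g) (u + ug, p)"
    using ug by (simp add: oseen_solution_iff vHs_dot_simps T_add dvg_add algebra_simps)
  then show ?thesis by blast
qed

text \<open>Subtracting the lift of \<open>g\<close> leaves a solenoidal \<open>w\<close>. Testing
  its equation with \<open>w\<close> removes the pressure, and coercivity bounds \<open>w\<close> by
  the corrected force \<open>f - T ug\<close>.\<close>

lemma velocity_bound:
  assumes f: "f \<in> vHs_dot (-1)" and g: "g \<in> L2_dot" and sol: "oseen_solution A U (f, g) (u, p)"
  shows "vHs_norm 1 u \<le> C / pi\<^sup>2 * vHs_norm (-1) f + K\<^sub>0 * L2_norm g"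
proof -
  have u: "u \<in> vHs_dot 1" and p: "p \<in> L2_dot" and eq: "T u + grad p = f" and div: "dvg u = g"
    using sol by (auto simp: oseen_solution_iff)
  obtain ug where ug: "ug \<in> vHs_dot 1" "dvg ug = g" "vHs_norm 1 ug \<le> CARD('n) * L2_norm g"
    using divergence_lift[OF g] by blast
  define w where "w = u - ug"
  have w: "w \<in> vHs_dot 1" unfolding w_def by (intro vHs_dot_simps u ug)
  have "dvg u = dvg w + dvg ug" using dvg_add[of w ug] by (simp add: w_def)
  then have dw: "dvg w = 0" using div ug by simp
  have "T w = (f - T ug) - grad p"
    using eq by (simp add: w_def T_diff u ug algebra_simps)
  then have "vpairing (T w) w = vpairing (f - T ug) w - vpairing (grad p) w"
    using vpairing_diff_left[of "f - T ug" 1 "grad p" w] f T_vHs_dot[OF ug(1)] grad_vHs_dot(1)[OF p] w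
    by (simp add: vHs_dot_simps)
  also have "vpairing (grad p) w = 0" by (simp add: vpairing_grad w p b_form_def dw)
  also have "vpairing (f - T ug) w - 0 \<le> vHs_norm (-1) (f - T ug) * vHs_norm 1 w"
    using vpairing_le[of "f - T ug" 1 w] w f T_vHs_dot[OF ug(1)] by (simp add: vHs_dot_simps)
  also have "\<dots> \<le> (vHs_norm (-1) f + \<Lambda> * (CARD('n) * L2_norm g)) * vHs_norm 1 w"
  proof (rule mult_right_mono)
    have "vHs_norm (-1) (f - T ug) \<le> vHs_norm (-1) f + vHs_norm (-1) (T ug)"
      by (intro vHs_norm_triangle_diff f T_vHs_dot ug)
    also have "vHs_norm (-1) (T ug) \<le> \<Lambda> * vHs_norm 1 ug" by (rule T_bound[OF ug(1)])
    also have "\<dots> \<le> \<Lambda> * (CARD('n) * L2_norm g)" using \<Lambda>_pos ug(3) by (intro mult_left_mono) auto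
    finally show "vHs_norm (-1) (f - T ug) \<le> vHs_norm (-1) f + \<Lambda> * (CARD('n) * L2_norm g)" by simp
  qed simp
  finally have "pi\<^sup>2 / C * (vHs_norm 1 w)\<^sup>2 \<le> (vHs_norm (-1) f + \<Lambda> * (CARD('n) * L2_norm g)) * vHs_norm 1 w"
    using T_coercive[OF w dw] by linarith
  \<comment> \<open>One factor of the norm of \<open>w\<close> is cancelled; if the norm is zero,
    the right-hand side is nonnegative.\<close>
  then have "pi\<^sup>2 / C * vHs_norm 1 w \<le> vHs_norm (-1) f + \<Lambda> * (CARD('n) * L2_norm g)"
  proof (cases "vHs_norm 1 w = 0")
    case True
    then show ?thesis using \<Lambda>_pos by simp
  next
    case False
    then have "vHs_norm 1 w > 0" using vHs_norm_nonneg[of 1 w] by linarith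
    moreover assume "pi\<^sup>2 / C * (vHs_norm 1 w)\<^sup>2 \<le> (vHs_norm (-1) f + \<Lambda> * (CARD('n) * L2_norm g)) * vHs_norm 1 w"
    then have "(pi\<^sup>2 / C * vHs_norm 1 w) * vHs_norm 1 w \<le> (vHs_norm (-1) f + \<Lambda> * (CARD('n) * L2_norm g)) * vHs_norm 1 w"
      by (simp only: power2_eq_square mult.assoc)
    ultimately show ?thesis by (simp only: mult_le_cancel_right_pos)
  qed
  then have "C / pi\<^sup>2 * (pi\<^sup>2 / C * vHs_norm 1 w) \<le> C / pi\<^sup>2 * (vHs_norm (-1) f + \<Lambda> * (CARD('n) * L2_norm g))"
    using C_pos by (intro mult_left_mono) auto
  then have wb: "vHs_norm 1 w \<le> C / pi\<^sup>2 * (vHs_norm (-1) f + \<Lambda> * (CARD('n) * L2_norm g))"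
    using C_pos by simp
  have "vHs_norm 1 u \<le> vHs_norm 1 w + vHs_norm 1 ug"
    using vHs_norm_triangle[OF w ug(1)] by (simp add: w_def)
  also have "\<dots> \<le> C / pi\<^sup>2 * (vHs_norm (-1) f + \<Lambda> * (CARD('n) * L2_norm g)) + CARD('n) * L2_norm g"
    by (intro add_mono wb ug)
  also have "\<dots> = C / pi\<^sup>2 * vHs_norm (-1) f + K\<^sub>0 * L2_norm g"
    by (simp add: sol_const_def algebra_simps)
  finally show ?thesis .
qed

text \<open>The equation is solved for the gradient of \<open>p\<close>, which controls
  \<open>p\<close>; the velocity is already estimated.\<close>

lemma pressure_estimate:
  assumes f: "f \<in> vHs_dot (-1)" and g: "g \<in> L2_dot" and sol: "oseen_solution A U (f, g) (u, p)"
  shows "L2_norm p \<le> K\<^sub>0 * vHs_norm (-1) f +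
    (\<Lambda> * K\<^sub>0) * L2_norm g"
proof -
  have u: "u \<in> vHs_dot 1" and p: "p \<in> L2_dot" and eq: "T u + grad p = f"
    using sol by (auto simp: oseen_solution_iff)
  have "grad p = f - T u" using eq by (simp add: algebra_simps)
  then have "L2_norm p \<le> vHs_norm (-1) (f - T u)" using pressure_bound[OF p] by simp
  also have "\<dots> \<le> vHs_norm (-1) f + vHs_norm (-1) (T u)" by (intro vHs_norm_triangle_diff f T_vHs_dot u)
  also have "\<dots> \<le> vHs_norm (-1) f + \<Lambda> * (C / pi\<^sup>2 * vHs_norm (-1) f + K\<^sub>0 * L2_norm g)"
    using order_trans[OF T_bound[OF u] mult_left_mono[OF velocity_bound[OF f g sol]]] \<Lambda>_pos by simp
  also have "\<dots> = (1 + C / pi\<^sup>2 * \<Lambda>) * vHs_norm (-1) f + (\<Lambda> * K\<^sub>0) * L2_norm g"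
    by (simp add: algebra_simps)
  \<comment> \<open>The dimension factor in \<open>sol_const\<close> is at least 1, so the constant
    of the velocity estimate serves here as well, as the theorem demands.\<close>
  also have "(1 + C / pi\<^sup>2 * \<Lambda>) * vHs_norm (-1) f \<le> K\<^sub>0 * vHs_norm (-1) f"
  proof (rule mult_right_mono)
    have "0 \<le> 1 + C / pi\<^sup>2 * \<Lambda>" using C_pos \<Lambda>_pos by simp
    moreover have "1 \<le> real CARD('n)" by (simp add: Suc_le_eq)
    ultimately have "1 * (1 + C / pi\<^sup>2 * \<Lambda>) \<le> real CARD('n) * (1 + C / pi\<^sup>2 * \<Lambda>)" by (intro mult_right_mono)
    then show "1 + C / pi\<^sup>2 * \<Lambda> \<le> K\<^sub>0" by (simp add: sol_const_def)
  qed simp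
  finally show ?thesis by simp
qed

lemma oseen_op_eq: "oseen_op A U (u, p) = (T u + grad p, dvg u)"
  by (simp add: oseen_op_def T_def algebra_simps)

lemma oseen_op_range:
  "x \<in> X \<Longrightarrow> oseen_op A U x \<in> Y"
  by (auto simp: oseen_op_eq intro!: vHs_dot_simps T_vHs_dot grad_vHs_dot dvg_L2_dot)

lemma oseen_solution_op: "oseen_solution A U y x \<longleftrightarrow> x \<in> X \<and> oseen_op A U x = y"
  by (cases x; cases y) (auto simp: oseen_solution_iff oseen_op_eq)

lemma oseen_op_add:
  "x \<in> X \<Longrightarrow> x' \<in> X \<Longrightarrow> oseen_op A U (x + x') = oseen_op A U x + oseen_op A U x'"
  by (cases x; cases x') (auto simp: oseen_op_eq T_add grad_add dvg_add)

lemma oseen_op_scale: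
  "x \<in> X \<Longrightarrow> oseen_op A U (c *\<^sub>R x) = c *\<^sub>R oseen_op A U x"
  by (cases x) (auto simp: oseen_op_eq T_scale grad_scale dvg_scale scaleR_right_distrib)

lemma X_diff: "x \<in> vHs_dot s \<times> L2_dot \<Longrightarrow> x' \<in> vHs_dot s \<times> L2_dot \<Longrightarrow> x - x' \<in> vHs_dot s \<times> L2_dot"
  by (cases x; cases x') (auto intro: vHs_dot_simps Hs_dot_simps)

lemma oseen_op_diff:
  assumes "x \<in> X" "x' \<in> X"
  shows "oseen_op A U (x - x') = oseen_op A U x - oseen_op A U x'"
  using oseen_op_add[OF X_diff[OF assms] assms(2)] by (simp add: algebra_simps)

lemma oseen_op_bounded:
  "\<exists>K. \<forall>x\<in>X. pair_norm (-1) (oseen_op A U x) \<le> K * pair_norm 1 x"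
proof (intro exI ballI)
  fix x :: "'n vdist \<times> 'n pdist" assume "x \<in> X"
  then obtain u p where x: "x = (u, p)" and u: "u \<in> vHs_dot 1" and p: "p \<in> L2_dot" by auto
  let ?N = "pair_norm 1 x" and ?n = "real CARD('n)"
  have N: "vHs_norm 1 u \<le> ?N" "L2_norm p \<le> ?N" using pair_norm_bounds[where s = 1 and x = x] x by auto
  have "pair_norm (-1) (oseen_op A U x) \<le> vHs_norm (-1) (T u + grad p) + L2_norm (dvg u)"
    using pair_norm_bounds(3)[of "-1" "oseen_op A U x"] by (simp add: x oseen_op_eq)
  also have "vHs_norm (-1) (T u + grad p) \<le> vHs_norm (-1) (T u) + vHs_norm (-1) (grad p)"
    by (intro vHs_norm_triangle T_vHs_dot grad_vHs_dot u p)
  also have "vHs_norm (-1) (T u) \<le> \<Lambda> * vHs_norm 1 u" by (rule T_bound[OF u])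
  also have "\<dots> \<le> \<Lambda> * ?N" using \<Lambda>_pos N by (intro mult_left_mono) auto
  also have "vHs_norm (-1) (grad p) \<le> ?n * (2 * pi * L2_norm p)" by (rule grad_vHs_dot[OF p])
  also have "\<dots> \<le> ?n * (2 * pi * ?N)" using N by (intro mult_left_mono) auto
  also have "L2_norm (dvg u) \<le> 2 * pi * ?n * vHs_norm 1 u" by (rule dvg_L2_dot[OF u])
  also have "\<dots> \<le> 2 * pi * ?n * ?N" using N by (intro mult_left_mono) auto
  finally show "pair_norm (-1) (oseen_op A U x) \<le> (\<Lambda> + ?n * 2 * pi + 2 * pi * ?n) * ?N"
    by (simp add: algebra_simps)
qed

text \<open>The two a priori estimates combined; injectivity, continuous dependence and the bounded
  inverse follow from it.\<close>

lemma oseen_op_bounded_below: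
  "\<exists>K\<ge>0. \<forall>x\<in>X. pair_norm 1 x \<le> K * pair_norm (-1) (oseen_op A U x)"
proof -
  have c: "K\<^sub>0 \<ge> 0" using C_pos \<Lambda>_pos by (simp add: sol_const_def)
  have le: "pair_norm 1 x \<le> (C / pi\<^sup>2 + K\<^sub>0 + (K\<^sub>0 + \<Lambda> * K\<^sub>0)) * pair_norm (-1) (oseen_op A U x)" if x_X: "x \<in> X" for x
  proof -
    obtain u p where x: "x = (u, p)" by (cases x)
    obtain f g where y: "oseen_op A U x = (f, g)" by (cases "oseen_op A U x")
    let ?N = "pair_norm (-1) (f, g)"
    have f: "f \<in> vHs_dot (-1)" and g: "g \<in> L2_dot" using oseen_op_range[OF x_X] y by auto
    have sol: "oseen_solution A U (f, g) (u, p)" using x_X x y by (simp add: oseen_solution_op)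
    have N: "vHs_norm (-1) f \<le> ?N" "L2_norm g \<le> ?N" using pair_norm_bounds[where s = "-1" and x = "(f, g)"] by auto
    have "pair_norm 1 x \<le> vHs_norm 1 u + L2_norm p" using pair_norm_bounds(3)[of 1 x] x by simp
    also have "\<dots> \<le> (C / pi\<^sup>2 * vHs_norm (-1) f + K\<^sub>0 * L2_norm g) + (K\<^sub>0 * vHs_norm (-1) f + (\<Lambda> * K\<^sub>0) * L2_norm g)"
      by (intro add_mono velocity_bound[OF f g sol] pressure_estimate[OF f g sol])
    also have "\<dots> \<le> (C / pi\<^sup>2 * ?N + K\<^sub>0 * ?N) + (K\<^sub>0 * ?N + (\<Lambda> * K\<^sub>0) * ?N)"
      using C_pos \<Lambda>_pos c N by (intro add_mono mult_left_mono) auto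
    finally show ?thesis unfolding y by (simp add: algebra_simps)
  qed
  have "0 \<le> C / pi\<^sup>2 + K\<^sub>0 + (K\<^sub>0 + \<Lambda> * K\<^sub>0)" using C_pos \<Lambda>_pos c by simp
  then show ?thesis using le by blast
qed

lemma oseen_op_inj: "inj_on (oseen_op A U) (X)"
proof (rule inj_onI)
  fix x x' :: "'n vdist \<times> 'n pdist"
  assume xX: "x \<in> X" "x' \<in> X" and eq: "oseen_op A U x = oseen_op A U x'"
  obtain K where K: "\<And>x. x \<in> X \<Longrightarrow> pair_norm 1 x \<le> K * pair_norm (-1) (oseen_op A U x)"
    using oseen_op_bounded_below by blast
  have "oseen_op A U (x - x') = 0" using oseen_op_diff[OF xX] eq by simp
  moreover have "pair_norm (-1) (0 :: 'n vdist \<times> 'n pdist) = 0"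
    by (simp add: pair_norm_def zero_prod_def vHs_norm_def)
  ultimately have le: "pair_norm 1 (x - x') \<le> 0" using K[OF X_diff[OF xX]] by simp
  obtain u p where d: "x - x' = (u, p)" by (cases "x - x'")
  have up: "u \<in> vHs_dot 1" "p \<in> L2_dot" using X_diff[OF xX] d by auto
  have "vHs_norm 1 u \<le> 0" "L2_norm p \<le> 0"
    using pair_norm_bounds(1,2)[where s = 1 and x = "x - x'"] le d by auto
  then have "u = 0" "p = 0"
    using up vHs_norm_eq_zero[of u 1] Hs_norm_eq_zero[of p 0]
    by (auto simp: Hs_dot_def order_antisym)
  then have "x - x' = 0" using d by (simp add: zero_prod_def)
  then show "x = x'" by simp
qed

lemma oseen_op_bij: "bij_betw (oseen_op A U) (X) (Y)"
proof (rule bij_betw_imageI[OF oseen_op_inj], rule subset_antisym)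
  show "oseen_op A U ` (X) \<subseteq> Y" using oseen_op_range by blast
  show "Y \<subseteq> oseen_op A U ` (X)"
  proof
    fix y :: "'n vdist \<times> 'n pdist" assume "y \<in> Y"
    then obtain x where "oseen_solution A U y x" using oseen_exists by fastforce
    then show "y \<in> oseen_op A U ` (X)" by (auto simp: oseen_solution_op)
  qed
qed

lemma oseen_unique:
  assumes "y \<in> Y" shows "\<exists>!x. oseen_solution A U y x"
proof -
  obtain x where x: "x \<in> X" "y = oseen_op A U x"
    using assms unfolding bij_betw_imp_surj_on[OF oseen_op_bij, symmetric] by (rule imageE)
  show ?thesis
  proof (rule ex1I[of _ x])
    show "oseen_solution A U y x" using x by (simp add: oseen_solution_op)
    show "x' = x" if "oseen_solution A U y x'" for x'
      by (rule inj_onD[OF oseen_op_inj]) (use that x in \<open>simp_all add: oseen_solution_op\<close>)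
  qed
qed

lemma oseen_well_posed:
  "well_posed (X) (pair_norm 1) (Y) (pair_norm (-1)) (oseen_solution A U)"
  unfolding well_posed_def
proof (intro conjI ballI impI allI)
  fix y :: "'n vdist \<times> 'n pdist" assume "y \<in> Y"
  from oseen_unique[OF this] show "\<exists>!x. x \<in> X \<and> oseen_solution A U y x"
    by (simp add: oseen_solution_op)
next
  fix y x :: "'n vdist \<times> 'n pdist" and \<epsilon> :: real
  assume x: "x \<in> X" "oseen_solution A U y x" and \<epsilon>: "\<epsilon> > 0"
  obtain K where K: "K \<ge> 0" "\<And>x. x \<in> X \<Longrightarrow> pair_norm 1 x \<le> K * pair_norm (-1) (oseen_op A U x)"
    using oseen_op_bounded_below by blast
  show "\<exists>\<delta>>0. \<forall>y'\<in>Y. \<forall>x'\<in>X.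
      oseen_solution A U y' x' \<and> pair_norm (-1) (y' - y) < \<delta> \<longrightarrow> pair_norm 1 (x' - x) < \<epsilon>"
  proof (intro exI conjI ballI impI)
    \<comment> \<open>The added 1 covers \<open>K = 0\<close> and makes the final inequality
      strict.\<close>
    show "\<epsilon> / (K + 1) > 0" using \<epsilon> K by simp
    fix y' x' :: "'n vdist \<times> 'n pdist"
    assume x': "x' \<in> X" and *: "oseen_solution A U y' x' \<and> pair_norm (-1) (y' - y) < \<epsilon> / (K + 1)"
    have "oseen_op A U (x' - x) = y' - y"
      using * x oseen_op_diff[OF x' x(1)] by (simp add: oseen_solution_op)
    then have "pair_norm 1 (x' - x) \<le> K * pair_norm (-1) (y' - y)"
      using K(2)[OF X_diff[OF x' x(1)]] by simp
    also have "\<dots> \<le> K * (\<epsilon> / (K + 1))" using * K by (intro mult_left_mono) auto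
    also have "\<dots> < \<epsilon>" using \<epsilon> K by (simp add: field_simps)
    finally show "pair_norm 1 (x' - x) < \<epsilon>" .
  qed
qed

lemma oseen_isomorphism:
  "isomorphism_on (X) (pair_norm 1) (Y) (pair_norm (-1)) (oseen_op A U)"
  unfolding isomorphism_on_def
  using oseen_op_add oseen_op_scale oseen_op_bij oseen_op_bounded oseen_op_bounded_below by blast

end

theorem theorem5p1:
  assumes "CARD('n::finite) \<ge> 2"
  shows "\<exists>C1 C2 :: real \<Rightarrow> real \<Rightarrow> (real^'n \<Rightarrow> real^'n) \<Rightarrow> real.
    \<forall>(A :: 'n tensor) C\<^sub>A (\<theta> :: real) U.
      tensor_symmetric A \<and> relaxed_elliptic A C\<^sub>A \<and>
      (if CARD('n) = 2 then \<theta> > 2 else \<theta> \<ge> real CARD('n)) \<and> U \<in> Lq_sol \<theta> \<longrightarrow>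
      (\<forall>f\<in>vHs_dot (-1). \<forall>g\<in>L2_dot.
        (\<exists>!(u, p). variational_solution A U (f, g) (u, p)) \<and>
        (\<forall>u p. variational_solution A U (f, g) (u, p) \<longrightarrow>
          vHs_norm 1 u \<le> C\<^sub>A / pi\<^sup>2 * vHs_norm (-1) f + C1 C\<^sub>A (tensor_norm A) U * L2_norm g \<and>
          L2_norm p \<le> C1 C\<^sub>A (tensor_norm A) U * vHs_norm (-1) f
                       + C2 C\<^sub>A (tensor_norm A) U * L2_norm g)) \<and>
      well_posed (vHs_dot 1 \<times> L2_dot) (pair_norm 1) (vHs_dot (-1) \<times> L2_dot) (pair_norm (-1))
        (oseen_solution A U) \<and>
      (\<forall>f\<in>vHs_dot (-1). \<forall>g\<in>L2_dot. \<forall>u p.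
        oseen_solution A U (f, g) (u, p) \<longleftrightarrow> variational_solution A U (f, g) (u, p)) \<and>
      isomorphism_on (vHs_dot 1 \<times> L2_dot) (pair_norm 1) (vHs_dot (-1) \<times> L2_dot) (pair_norm (-1))
        (oseen_op A U)"
proof (rule exI[of _ sol_const], rule exI[of _ "\<lambda>C a U. op_const a U * sol_const C a U"],
    intro allI impI, goal_cases)
  case (1 A C \<theta> U)
  \<comment> \<open>Both cases of the exponent condition imply that \<open>\<theta>\<close> exceeds
    2 and is at least the dimension: for dimension at least 3 the second bound yields the
    first.\<close>
  interpret oseen A C \<theta> U
    by standard (use 1 assms in \<open>auto split: if_splits\<close>)
  have ex1: "\<exists>!(u, p). variational_solution A U (f, g) (u, p)" if "f \<in> vHs_dot (-1)" "g \<in> L2_dot" for f g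
  proof -
    have "oseen_solution A U (f, g) = variational_solution A U (f, g)"
      using oseen_iff_variational[OF that] by (auto simp: fun_eq_iff)
    then show ?thesis using oseen_unique[of "(f, g)"] that by simp
  qed
  show ?case
  proof (intro conjI ballI allI impI)
    fix f :: "'n vdist" and g :: "'n pdist" assume fg: "f \<in> vHs_dot (-1)" "g \<in> L2_dot"
    show "\<exists>!(u, p). variational_solution A U (f, g) (u, p)" by (rule ex1[OF fg])
    fix u p
    show "oseen_solution A U (f, g) (u, p) \<longleftrightarrow> variational_solution A U (f, g) (u, p)"
      by (rule oseen_iff_variational[OF fg])
    assume "variational_solution A U (f, g) (u, p)"
    then have sol: "oseen_solution A U (f, g) (u, p)" by (simp only: oseen_iff_variational[OF fg])
    show "vHs_norm 1 u \<le> C / pi\<^sup>2 * vHs_norm (-1) f + sol_const C (tensor_norm A) U * L2_norm g"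
      by (rule velocity_bound[OF fg sol])
    show "L2_norm p \<le> sol_const C (tensor_norm A) U * vHs_norm (-1) f
        + op_const (tensor_norm A) U * sol_const C (tensor_norm A) U * L2_norm g"
      by (rule pressure_estimate[OF fg sol])
  qed (rule oseen_well_posed oseen_isomorphism)+
qed

end
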